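(* In the setting described in the context, for every $n\in\overline{\mathbb N}$, the operator $D_n$, defined on $\mathrm{dom}(D_n)$, is self-adjoint with compact resolvent.
   Context: TORI. $\mathbb N_*=\mathbb N\setminus\{0,1\}$, $\overline{\mathbb N}=\mathbb N\cup\{\infty\}$, $\overline{\mathbb N}_*=\mathbb N_*\cup\{\infty\}$ (one-point compactification), $\mathbb T=\{z\in\mathbb C:|z|=1\}$. For $q\in\mathbb N_*$ and $k\in\overline{\mathbb N}_*^q$, $\mathbb Z^q_k=\prod_{j}\mathbb Z/k(j)\mathbb Z$ with $\infty\mathbb Z=\{0\}$; $\infty^q=(\infty,\dots,\infty)$; $e_j$ is the $j$-th canonical vector of $\mathbb Z^q$ or its class in $\mathbb Z^q_k$. A normalized 2-cocycle of an Abelian group $G$ is $\sigma:G\times G\to\mathbb T$ with $\sigma(x,y)\sigma(x+y,z)=\sigma(x,y+z)\sigma(y,z)$, $\sigma(0,x)=\sigma(x,0)=1$, $\sigma(x,-x)=1$. Cocycles of $\mathbb Z^q_k$ are viewed as cocycles of $\mathbb Z^q$ via the quotient map. $\Xi^q$ is the set of pairs $(k,\sigma)$ with $k\in\overline{\mathbb N}_*^q$ and $\sigma$ a normalized 2-cocycle of $\mathbb Z^q_k$, with the topology induced from the product of $\overline{\mathbb N}_*^q$ and the normalized 2-cocycles of $\mathbb Z^q$ with pointwise convergence. For $(k,\sigma)\in\Xi^q$, $m\in\mathbb Z^q_k$: $W^m_{k,\sigma}$ is the unitary on $\ell^2(\mathbb Z^q_k)$ with $(W^m_{k,\sigma}\xi)(p)=\sigma(m,p-m)\xi(p-m)$;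 $C^*(\mathbb Z^q_k,\sigma)$ is the C*-algebra generated by all $W^m_{k,\sigma}$. $\mathbb U^q_k=\{z\in\mathbb T^q: z_j^{k(j)}=1\text{ whenever }k(j)<\infty\}$, and $z^m=\prod_j z_j^{m_j}$ for $m\in\mathbb Z^q_k$, $z\in\mathbb U^q_k$. SETTING. Fix $d,d'\in\mathbb N_*$, $d\le d'$, and a fixed-point-free permutation $f$ of $\{1,\dots,d'\}$ of order $2$ with $\{d+1,\dots,d'\}\subseteq f(\{1,\dots,d\})$. For each $n\in\overline{\mathbb N}$ let $(k_n,\sigma_n)\in\Xi^d$, $(k_n',\sigma_n')\in\Xi^{d'}$ be such that: $(k_n,\sigma_n)\to(k_\infty,\sigma_\infty)$ with $k_\infty=\infty^d$; $(k'_n,\sigma'_n)\to(k'_\infty,\sigma'_\infty)$ with $k'_\infty=\infty^{d'}$; for each $j\le d$ either $k_n(j)<\infty$ for all $n\in\mathbb N$ or $k_n(j)=\infty$ for all $n\in\mathbb N$; $k'_n(f(j))=k'_n(j)=k_n(j)$ for $j\le d$; $\sigma_n$ is the restriction of $\sigma'_n$ to $\mathbb Z^d_{k_n}\times\{0\}$; and, with $U_{n,j}=W^{e_j}_{k'_n,\sigma'_n}$, for all $j\le d$, $s\le d'$: $U_{n,f(j)}U_{n,s}=\lambda\, U_{n,s}U_{n,f(j)}$, where $\lambda=\exp(2i\pi/k_n(j))$ if $s=j$, $k_n(j)<\infty$, $j<f(j)$; $\lambda=\exp(-2i\pi/k_n(j))$ if $s=j$, $k_n(j)<\infty$, $j>f(j)$;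 $\lambda=1$ otherwise. Put $\mathfrak B_n=C^*(\mathbb Z^{d'}_{k'_n},\sigma'_n)$, $\widehat{G_n}=\mathbb Z^{d'}_{k'_n}$, $G_n=\mathbb U^{d'}_{k'_n}$, $\mathcal H_n=\ell^2(\widehat{G_n})$, $(v_n^z\xi)(m)=z^m\xi(m)$ for $z\in G_n$. Let $z_{n,j}\in G_n$ have $j$-th entry $\exp(2i\pi/k'_n(j))$ (or $1$ if $k'_n(j)=\infty$) and other entries $1$. If $k_n'(j)=\infty$, $(\partial_{n,j}\xi)(m)=i m_j\xi(m)$. Let $(J_n\xi)(m)=\overline{\xi(-m)}$, $\xi\cdot a=J_na^*J_n\xi$, $[a,\xi]=a\xi-\xi\cdot a$ for $a\in\mathfrak B_n$, $\xi\in\mathcal H_n$. $\Re b=\frac{b+b^*}2$, $\Im b=\frac{b-b^*}{2i}$. DIRAC OPERATORS. For $j\le d$: $X_{n,j}=\Re(U_{n,f(j)})$, $Y_{n,j}=\pm\Im(U_{n,f(j)})$ with sign $+$ if $f(j)>j$, $-$ if $f(j)<j$. For $j\le d$ with $k_n(j)=\infty$: $\Gamma_{n,j}=X_{n,j}\partial_{n,j}$, $\Gamma_{n,d+j}=Y_{n,j}\partial_{n,j}$. For $j\le d$ with $k_n(j)<\infty$: $\Gamma_{n,j}\xi=\frac{-k_n(j)}{2i\pi}[Y_{n,j},\xi]$, $\Gamma_{n,d+j}\xi=\frac{k_n(j)}{2i\pi}[X_{n,j},\xi]$. For $d<j\le d'$: $\Gamma_{n,d+j}=\partial_{n,j}$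 if $k'_n(j)=\infty$, and $\Gamma_{n,d+j}=\frac{k'_n(j)}{2i\pi}\Im(1-v_n^{z_{n,j}})$ if $k_n'(j)<\infty$. Let $c$ be a fixed faithful *-representation on a finite dimensional Hilbert space $\mathcal S$ of the Clifford algebra generated by $\gamma_1,\dots,\gamma_{d+d'}$ with $\gamma_j^*=-\gamma_j$, $\gamma_j^2=-1$, $\gamma_j\gamma_s=-\gamma_s\gamma_j$ ($j\ne s$). Let $\mathcal J_n=\mathcal H_n\otimes\mathcal S=\ell^2(\widehat{G_n},\mathcal S)$, $\langle m,m\rangle_n=\sum_{j:k'_n(j)=\infty}m_j^2$, $\mathrm{dom}(D_n)=\{\xi\in\mathcal J_n:\sum_m(1+\langle m,m\rangle_n)\|\xi(m)\|^2<\infty\}$ and $D_n=\sum_{j=1}^{d+d'}\Gamma_{n,j}\otimes c(\gamma_j)$ on $\mathrm{dom}(D_n)$. *)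

theory Defs
  imports "HOL-Analysis.Analysis" "HOL-Algebra.Product_Groups" "HOL-Algebra.Elementary_Groups"
    "HOL-Combinatorics.Permutations"
begin

section \<open>Quotients of integer lattices and their cocycles\<close>

text \<open>The quotient of the integers by \<open>k\<close> times the integers, where \<open>\<infinity>\<close> times the integers is
  the zero group, is \<^term>\<open>integer_mod_group (modulus k)\<close>: the library's
  \<^term>\<open>integer_mod_group 0\<close> is the group of integers, and for \<open>N > 0\<close> the classes are represented
  by \<open>0, \<dots>, N - 1\<close>. Indices \<open>1, \<dots>, q\<close> are natural numbers, and elements of the product
  are functions that are \<^term>\<open>undefined\<close> off \<open>{1..q}\<close>.\<close>

definition modulus :: "enat \<Rightarrow> nat" where
  "modulus k = (case k of enat N \<Rightarrow> N | \<infinity> \<Rightarrow> 0)"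

definition Zk :: "nat \<Rightarrow> (nat \<Rightarrow> enat) \<Rightarrow> (nat \<Rightarrow> int) monoid" where
  "Zk q k = product_group {1..q} (\<lambda>j. integer_mod_group (modulus (k j)))"

definition unit_vec :: "nat \<Rightarrow> nat \<Rightarrow> (nat \<Rightarrow> int)" where
  "unit_vec q j = (\<lambda>i\<in>{1..q}. if i = j then 1 else 0)"

text \<open>The quotient map from \<^term>\<open>Zk q (\<lambda>_. \<infinity>)\<close> onto \<^term>\<open>Zk q k\<close>; recall \<open>x mod 0 = x\<close>.\<close>

definition quot_map :: "nat \<Rightarrow> (nat \<Rightarrow> enat) \<Rightarrow> (nat \<Rightarrow> int) \<Rightarrow> (nat \<Rightarrow> int)" where
  "quot_map q k m = (\<lambda>j\<in>{1..q}. m j mod int (modulus (k j)))"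

lemma comm_group_Zk: "comm_group (Zk q k)"
proof (rule group.group_comm_groupI)
  show "group (Zk q k)"
    by (simp add: Zk_def)
  show "x \<otimes>\<^bsub>Zk q k\<^esub> y = y \<otimes>\<^bsub>Zk q k\<^esub> x" for x y
    by (simp add: Zk_def product_group_def add.commute)
qed

lemma quot_map_surj: "quot_map q k ` carrier (Zk q (\<lambda>_. \<infinity>)) = carrier (Zk q k)"
proof (intro equalityI subsetI)
  fix x assume "x \<in> quot_map q k ` carrier (Zk q (\<lambda>_. \<infinity>))"
  then show "x \<in> carrier (Zk q k)"
    by (auto simp: Zk_def quot_map_def carrier_integer_mod_group)
next
  fix x assume x: "x \<in> carrier (Zk q k)"
  have "quot_map q k x = x"
  proof
    fix j
    have "x j mod int (modulus (k j)) = x j" if "j \<in> {1..q}"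
    proof -
      have "x j \<in> carrier (integer_mod_group (modulus (k j)))"
        using x that by (auto simp: Zk_def PiE_iff)
      then show ?thesis
        by (auto simp: carrier_integer_mod_group split: if_splits)
    qed
    then show "quot_map q k x j = x j"
      using x by (auto simp: Zk_def quot_map_def PiE_iff extensional_def)
  qed
  moreover have "x \<in> carrier (Zk q (\<lambda>_. \<infinity>))"
    using x by (auto simp: Zk_def PiE_iff carrier_integer_mod_group modulus_def)
  ultimately show "x \<in> quot_map q k ` carrier (Zk q (\<lambda>_. \<infinity>))"
    by (metis imageI)
qed

definition normalized_cocycle :: "('a, 'b) monoid_scheme \<Rightarrow> ('a \<Rightarrow> 'a \<Rightarrow> complex) \<Rightarrow> bool" where
  "normalized_cocycle G \<sigma> \<longleftrightarrow>
     (\<forall>x\<in>carrier G. \<forall>y\<in>carrier G. norm (\<sigma> x y) = 1) \<and>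
     (\<forall>x\<in>carrier G. \<forall>y\<in>carrier G. \<forall>z\<in>carrier G.
        \<sigma> x y * \<sigma> (x \<otimes>\<^bsub>G\<^esub> y) z = \<sigma> x (y \<otimes>\<^bsub>G\<^esub> z) * \<sigma> y z) \<and>
     (\<forall>x\<in>carrier G. \<sigma> \<one>\<^bsub>G\<^esub> x = 1 \<and> \<sigma> x \<one>\<^bsub>G\<^esub> = 1 \<and> \<sigma> x (inv\<^bsub>G\<^esub> x) = 1)"

definition Xi :: "nat \<Rightarrow> ((nat \<Rightarrow> enat) \<times> ((nat \<Rightarrow> int) \<Rightarrow> (nat \<Rightarrow> int) \<Rightarrow> complex)) set" where
  "Xi q = {(k, \<sigma>). (\<forall>j\<in>{1..q}. 2 \<le> k j) \<and> normalized_cocycle (Zk q k) \<sigma>}"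

text \<open>Convergence in \<^term>\<open>Xi q\<close> of the sequence indexed by the finite \<open>n\<close> to the term at \<open>\<infinity>\<close>.
  The topology on \<^typ>\<open>enat\<close> is that of the one-point compactification, and cocycles are
  compared after being pulled back to the lattice.\<close>

definition Xi_converges ::
  "nat \<Rightarrow> (enat \<Rightarrow> nat \<Rightarrow> enat) \<Rightarrow> (enat \<Rightarrow> (nat \<Rightarrow> int) \<Rightarrow> (nat \<Rightarrow> int) \<Rightarrow> complex) \<Rightarrow> bool" where
  "Xi_converges q k \<sigma> \<longleftrightarrow>
     (\<forall>j\<in>{1..q}. (\<lambda>n::nat. k (enat n) j) \<longlonglongrightarrow> k \<infinity> j) \<and>
     (\<forall>x\<in>carrier (Zk q (\<lambda>_. \<infinity>)). \<forall>y\<in>carrier (Zk q (\<lambda>_. \<infinity>)).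
        (\<lambda>n::nat. \<sigma> (enat n) (quot_map q (k (enat n)) x) (quot_map q (k (enat n)) y))
          \<longlonglongrightarrow> \<sigma> \<infinity> (quot_map q (k \<infinity>) x) (quot_map q (k \<infinity>) y))"

text \<open>The inclusion of the first \<open>d\<close> coordinates among \<open>d'\<close> coordinates.\<close>

definition embed :: "nat \<Rightarrow> nat \<Rightarrow> (nat \<Rightarrow> int) \<Rightarrow> (nat \<Rightarrow> int)" where
  "embed d d' m = (\<lambda>j\<in>{1..d'}. if j \<le> d then m j else 0)"

section \<open>Square-summable functions and operators\<close>

text \<open>Square-summable functions on a set \<open>A\<close> are represented by functions that vanish off \<open>A\<close>, with
  values in \<^typ>\<open>complex\<close> or in the Hilbert space \<^typ>\<open>complex ^ 's\<close>, whose library norm is the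
  Euclidean one. Inner products are linear in the second argument.\<close>

definition ell2 :: "'g set \<Rightarrow> ('g \<Rightarrow> 'v::real_normed_vector) set" where
  "ell2 A = {\<xi>. (\<forall>m. m \<notin> A \<longrightarrow> \<xi> m = 0) \<and> (\<lambda>m. (norm (\<xi> m))\<^sup>2) summable_on A}"

definition ell2_norm :: "'g set \<Rightarrow> ('g \<Rightarrow> 'v::real_normed_vector) \<Rightarrow> real" where
  "ell2_norm A \<xi> = sqrt (\<Sum>\<^sub>\<infinity>m\<in>A. (norm (\<xi> m))\<^sup>2)"

definition ell2_inner :: "'g set \<Rightarrow> ('g \<Rightarrow> complex) \<Rightarrow> ('g \<Rightarrow> complex) \<Rightarrow> complex" where
  "ell2_inner A \<xi> \<eta> = (\<Sum>\<^sub>\<infinity>m\<in>A. cnj (\<xi> m) * \<eta> m)"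

definition ell2_vinner :: "'g set \<Rightarrow> ('g \<Rightarrow> complex ^ 's) \<Rightarrow> ('g \<Rightarrow> complex ^ 's) \<Rightarrow> complex" where
  "ell2_vinner A \<xi> \<eta> = (\<Sum>\<^sub>\<infinity>m\<in>A. \<Sum>i\<in>UNIV. cnj (\<xi> m $ i) * \<eta> m $ i)"

text \<open>The Hilbert adjoint of \<open>T\<close> with domain \<open>E\<close> in the space \<open>H\<close> with inner product \<open>ip\<close>. The
  value \<^term>\<open>hadjoint H ip E T \<eta>\<close> is meaningful for \<open>\<eta>\<close> in \<^term>\<open>hadjoint_dom H ip E T\<close>, provided
  \<open>E\<close> is dense; a bounded operator has \<open>E = H\<close>.\<close>

definition hadjoint_dom :: "'h set \<Rightarrow> ('h \<Rightarrow> 'h \<Rightarrow> complex) \<Rightarrow> 'h set \<Rightarrow> ('h \<Rightarrow> 'h) \<Rightarrow> 'h set" where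
  "hadjoint_dom H ip E T = {\<eta>\<in>H. \<exists>\<zeta>\<in>H. \<forall>\<xi>\<in>E. ip \<zeta> \<xi> = ip \<eta> (T \<xi>)}"

definition hadjoint :: "'h set \<Rightarrow> ('h \<Rightarrow> 'h \<Rightarrow> complex) \<Rightarrow> 'h set \<Rightarrow> ('h \<Rightarrow> 'h) \<Rightarrow> 'h \<Rightarrow> 'h" where
  "hadjoint H ip E T \<eta> = (THE \<zeta>. \<zeta> \<in> H \<and> (\<forall>\<xi>\<in>E. ip \<zeta> \<xi> = ip \<eta> (T \<xi>)))"

definition densely_defined ::
  "'g set \<Rightarrow> ('g \<Rightarrow> complex ^ 's) set \<Rightarrow> (('g \<Rightarrow> complex ^ 's) \<Rightarrow> ('g \<Rightarrow> complex ^ 's)) \<Rightarrow> bool" where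
  "densely_defined A E T \<longleftrightarrow>
     E \<subseteq> ell2 A \<and> (\<lambda>_. 0) \<in> E \<and>
     (\<forall>\<xi>\<in>E. \<forall>\<eta>\<in>E. (\<lambda>m. \<xi> m + \<eta> m) \<in> E \<and> T (\<lambda>m. \<xi> m + \<eta> m) = (\<lambda>m. T \<xi> m + T \<eta> m)) \<and>
     (\<forall>a. \<forall>\<xi>\<in>E. (\<lambda>m. a *s \<xi> m) \<in> E \<and> T (\<lambda>m. a *s \<xi> m) = (\<lambda>m. a *s T \<xi> m)) \<and>
     T ` E \<subseteq> ell2 A \<and>
     (\<forall>\<eta>\<in>ell2 A. \<forall>\<epsilon>>0. \<exists>\<xi>\<in>E. ell2_norm A (\<lambda>m. \<eta> m - \<xi> m) < \<epsilon>)"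

definition self_adjoint ::
  "'g set \<Rightarrow> ('g \<Rightarrow> complex ^ 's) set \<Rightarrow> (('g \<Rightarrow> complex ^ 's) \<Rightarrow> ('g \<Rightarrow> complex ^ 's)) \<Rightarrow> bool" where
  "self_adjoint A E T \<longleftrightarrow>
     densely_defined A E T \<and>
     hadjoint_dom (ell2 A) (ell2_vinner A) E T = E \<and>
     (\<forall>\<eta>\<in>E. hadjoint (ell2 A) (ell2_vinner A) E T \<eta> = T \<eta>)"

definition resolvent_set ::
  "'g set \<Rightarrow> ('g \<Rightarrow> complex ^ 's) set \<Rightarrow> (('g \<Rightarrow> complex ^ 's) \<Rightarrow> ('g \<Rightarrow> complex ^ 's)) \<Rightarrow> complex set" where
  "resolvent_set A E T =
     {z. bij_betw (\<lambda>\<xi> m. T \<xi> m - z *s \<xi> m) E (ell2 A) \<and>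
         (\<exists>C. \<forall>\<xi>\<in>E. ell2_norm A \<xi> \<le> C * ell2_norm A (\<lambda>m. T \<xi> m - z *s \<xi> m))}"

definition resolvent ::
  "('g \<Rightarrow> complex ^ 's) set \<Rightarrow> (('g \<Rightarrow> complex ^ 's) \<Rightarrow> ('g \<Rightarrow> complex ^ 's)) \<Rightarrow> complex
     \<Rightarrow> ('g \<Rightarrow> complex ^ 's) \<Rightarrow> ('g \<Rightarrow> complex ^ 's)" where
  "resolvent E T z = inv_into E (\<lambda>\<xi> m. T \<xi> m - z *s \<xi> m)"

definition compact_operator ::
  "'g set \<Rightarrow> (('g \<Rightarrow> complex ^ 's) \<Rightarrow> ('g \<Rightarrow> complex ^ 's)) \<Rightarrow> bool" where
  "compact_operator A K \<longleftrightarrow>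
     (\<forall>\<xi>::nat \<Rightarrow> 'g \<Rightarrow> complex ^ 's. (\<forall>n. \<xi> n \<in> ell2 A \<and> ell2_norm A (\<xi> n) \<le> 1) \<longrightarrow>
        (\<exists>r \<eta>. strict_mono r \<and> \<eta> \<in> ell2 A \<and>
           (\<lambda>n. ell2_norm A (\<lambda>m. K (\<xi> (r n)) m - \<eta> m)) \<longlonglongrightarrow> 0))"

definition compact_resolvent ::
  "'g set \<Rightarrow> ('g \<Rightarrow> complex ^ 's) set \<Rightarrow> (('g \<Rightarrow> complex ^ 's) \<Rightarrow> ('g \<Rightarrow> complex ^ 's)) \<Rightarrow> bool" where
  "compact_resolvent A E T \<longleftrightarrow>
     resolvent_set A E T \<noteq> {} \<and>
     (\<forall>z\<in>resolvent_set A E T. compact_operator A (resolvent E T z))"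

section \<open>Operators on the scalar square-summable functions on a group\<close>

type_synonym 'g op = "('g \<Rightarrow> complex) \<Rightarrow> ('g \<Rightarrow> complex)"

abbreviation bounded_adjoint :: "'g set \<Rightarrow> 'g op \<Rightarrow> 'g op" where
  "bounded_adjoint A b \<equiv> hadjoint (ell2 A) (ell2_inner A) (ell2 A) b"

definition Re_op :: "'g set \<Rightarrow> 'g op \<Rightarrow> 'g op" where
  "Re_op A b = (\<lambda>\<xi> m. (b \<xi> m + bounded_adjoint A b \<xi> m) / 2)"

definition Im_op :: "'g set \<Rightarrow> 'g op \<Rightarrow> 'g op" where
  "Im_op A b = (\<lambda>\<xi> m. (b \<xi> m - bounded_adjoint A b \<xi> m) / (2 * \<i>))"

definition W_op :: "('g, 'b) monoid_scheme \<Rightarrow> ('g \<Rightarrow> 'g \<Rightarrow> complex) \<Rightarrow> 'g \<Rightarrow> 'g op" where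
  "W_op G \<sigma> m = (\<lambda>\<xi> p. if p \<in> carrier G
     then \<sigma> m (p \<otimes>\<^bsub>G\<^esub> inv\<^bsub>G\<^esub> m) * \<xi> (p \<otimes>\<^bsub>G\<^esub> inv\<^bsub>G\<^esub> m) else 0)"

definition J_op :: "('g, 'b) monoid_scheme \<Rightarrow> 'g op" where
  "J_op G = (\<lambda>\<xi> m. if m \<in> carrier G then cnj (\<xi> (inv\<^bsub>G\<^esub> m)) else 0)"

definition right_act :: "('g, 'b) monoid_scheme \<Rightarrow> 'g op \<Rightarrow> 'g op" where
  "right_act G a = (\<lambda>\<xi>. J_op G (bounded_adjoint (carrier G) a (J_op G \<xi>)))"

definition commutator :: "('g, 'b) monoid_scheme \<Rightarrow> 'g op \<Rightarrow> 'g op" where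
  "commutator G a = (\<lambda>\<xi> m. a \<xi> m - right_act G a \<xi> m)"

section \<open>The operators of the construction\<close>

definition U_op :: "nat \<Rightarrow> (nat \<Rightarrow> enat) \<Rightarrow> ((nat \<Rightarrow> int) \<Rightarrow> (nat \<Rightarrow> int) \<Rightarrow> complex) \<Rightarrow> nat
     \<Rightarrow> (nat \<Rightarrow> int) op" where
  "U_op q k \<sigma> j = W_op (Zk q k) \<sigma> (unit_vec q j)"

text \<open>The scalar in the relation between \<open>U_op _ _ _ (f j)\<close> and \<open>U_op _ _ _ s\<close>.\<close>

definition lambda_scalar :: "(nat \<Rightarrow> enat) \<Rightarrow> (nat \<Rightarrow> nat) \<Rightarrow> nat \<Rightarrow> nat \<Rightarrow> complex" where
  "lambda_scalar k f j s =
     (if s = j \<and> k j < \<infinity> \<and> j < f j then exp (2 * \<i> * pi / of_nat (modulus (k j)))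
      else if s = j \<and> k j < \<infinity> \<and> f j < j then exp (- 2 * \<i> * pi / of_nat (modulus (k j)))
      else 1)"

definition partial_op :: "nat \<Rightarrow> (nat \<Rightarrow> int) op" where
  "partial_op j = (\<lambda>\<xi> m. \<i> * of_int (m j) * \<xi> m)"

text \<open>The dual action. For \<open>z\<close> with \<open>z j ^ k j = 1\<close> whenever \<open>k j\<close> is finite, the monomial does not
  depend on the representatives \<open>m j\<close> chosen in \<^term>\<open>Zk q k\<close>.\<close>

definition v_op :: "nat \<Rightarrow> (nat \<Rightarrow> complex) \<Rightarrow> (nat \<Rightarrow> int) op" where
  "v_op q z = (\<lambda>\<xi> m. (\<Prod>j\<in>{1..q}. z j powi m j) * \<xi> m)"

definition z_gen :: "(nat \<Rightarrow> enat) \<Rightarrow> nat \<Rightarrow> (nat \<Rightarrow> complex)" where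
  "z_gen k j = (\<lambda>i. if i = j \<and> k j < \<infinity> then exp (2 * \<i> * pi / of_nat (modulus (k j))) else 1)"

context
  fixes d d' :: nat and f :: "nat \<Rightarrow> nat"
    and k k' :: "nat \<Rightarrow> enat" and \<sigma>' :: "(nat \<Rightarrow> int) \<Rightarrow> (nat \<Rightarrow> int) \<Rightarrow> complex"
begin

definition X_op :: "nat \<Rightarrow> (nat \<Rightarrow> int) op" where
  "X_op j = Re_op (carrier (Zk d' k')) (U_op d' k' \<sigma>' (f j))"

definition Y_op :: "nat \<Rightarrow> (nat \<Rightarrow> int) op" where
  "Y_op j = (\<lambda>\<xi> m. (if j < f j then 1 else -1) *
     Im_op (carrier (Zk d' k')) (U_op d' k' \<sigma>' (f j)) \<xi> m)"

definition Gamma_op :: "nat \<Rightarrow> (nat \<Rightarrow> int) op" where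
  "Gamma_op l =
     (if l \<le> d then let j = l in
        (if k j = \<infinity> then (\<lambda>\<xi>. X_op j (partial_op j \<xi>))
         else (\<lambda>\<xi> m. - of_nat (modulus (k j)) / (2 * \<i> * pi) * commutator (Zk d' k') (Y_op j) \<xi> m))
      else if l \<le> 2 * d then let j = l - d in
        (if k j = \<infinity> then (\<lambda>\<xi>. Y_op j (partial_op j \<xi>))
         else (\<lambda>\<xi> m. of_nat (modulus (k j)) / (2 * \<i> * pi) * commutator (Zk d' k') (X_op j) \<xi> m))
      else let j = l - d in
        (if k' j = \<infinity> then partial_op j
         else (\<lambda>\<xi> m. of_nat (modulus (k' j)) / (2 * \<i> * pi) *
           Im_op (carrier (Zk d' k')) (\<lambda>\<eta> p. \<eta> p - v_op d' (z_gen k' j) \<eta> p) \<xi> m)))"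

end

section \<open>Clifford algebras\<close>

text \<open>The complex Clifford algebra on \<open>\<gamma>\<^sub>1, \<dots>, \<gamma>\<^sub>N\<close> with \<open>\<gamma>\<^sub>j\<^sup>2 = -1\<close>, in its basis of ordered monomials
  \<open>\<gamma>\<^sub>I\<close> for \<open>I \<subseteq> {1..N}\<close>; elements are coefficient families. Sorting
  \<open>\<gamma>\<^sub>I \<gamma>\<^sub>J\<close> gives one sign for each pair \<open>(i, j) \<in> I \<times> J\<close> with \<open>j < i\<close>, and one for each
  square \<open>\<gamma>\<^sub>i\<^sup>2\<close> with \<open>i \<in> I \<inter> J\<close>, that is, one for each pair with \<open>j \<le> i\<close>. As \<open>\<gamma>\<^sub>j\<^sup>* = -\<gamma>\<^sub>j\<close>, the adjoint of \<open>\<gamma>\<^sub>I\<close> with \<open>card I = r\<close> is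
  \<open>(-1)\<^sup>r\<close> times the reversed monomial, hence \<open>(-1)\<^sup>r (-1)\<^bsup>r(r-1)/2\<^esup> \<gamma>\<^sub>I = (-1)\<^bsup>r(r+1)/2\<^esup> \<gamma>\<^sub>I\<close>.\<close>

type_synonym clifford = "nat set \<Rightarrow> complex"

definition cliff_carrier :: "nat \<Rightarrow> clifford set" where
  "cliff_carrier N = {a. \<forall>I. \<not> I \<subseteq> {1..N} \<longrightarrow> a I = 0}"

definition cliff_sign :: "nat set \<Rightarrow> nat set \<Rightarrow> complex" where
  "cliff_sign I J = (-1) ^ card {p \<in> I \<times> J. snd p \<le> fst p}"

definition cliff_monom :: "nat set \<Rightarrow> clifford" where
  "cliff_monom I = (\<lambda>K. if K = I then 1 else 0)"

definition cliff_mult :: "nat \<Rightarrow> clifford \<Rightarrow> clifford \<Rightarrow> clifford" where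
  "cliff_mult N a b = (\<lambda>K. \<Sum>I\<in>Pow {1..N}. \<Sum>J\<in>Pow {1..N}.
     a I * b J * cliff_sign I J * cliff_monom (sym_diff I J) K)"

definition cliff_star :: "clifford \<Rightarrow> clifford" where
  "cliff_star a = (\<lambda>I. (-1) ^ (card I * (card I + 1) div 2) * cnj (a I))"

abbreviation cliff_gen :: "nat \<Rightarrow> clifford" where
  "cliff_gen j \<equiv> cliff_monom {j}"

abbreviation cliff_one :: clifford where
  "cliff_one \<equiv> cliff_monom {}"

lemma cliff_monom_mult:
  assumes "I \<subseteq> {1..N}" "J \<subseteq> {1..N}"
  shows "cliff_mult N (cliff_monom I) (cliff_monom J)
    = (\<lambda>K. cliff_sign I J * cliff_monom (sym_diff I J) K)"
proof
  fix K
  have "cliff_mult N (cliff_monom I) (cliff_monom J) K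
    = (\<Sum>I'\<in>Pow {1..N}. \<Sum>J'\<in>Pow {1..N}. if J' = J then if I' = I then
         cliff_sign I J * cliff_monom (sym_diff I J) K else 0 else 0)"
    unfolding cliff_mult_def by (intro sum.cong refl) (simp add: cliff_monom_def)
  also have "\<dots> = cliff_sign I J * cliff_monom (sym_diff I J) K"
    using assms by (simp add: sum.delta)
  finally show "cliff_mult N (cliff_monom I) (cliff_monom J) K
    = cliff_sign I J * cliff_monom (sym_diff I J) K" .
qed

lemma cliff_sign_singleton: "cliff_sign {i} {j} = (if j \<le> i then -1 else 1)"
proof -
  have "{p \<in> {i} \<times> {j}. snd p \<le> fst p} = (if j \<le> i then {(i, j)} else {})"
    by auto
  then show ?thesis
    by (simp add: cliff_sign_def)
qed

lemma cliff_gen_square: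
  assumes "j \<in> {1..N}"
  shows "cliff_mult N (cliff_gen j) (cliff_gen j) = (\<lambda>K. - cliff_one K)"
  using assms by (simp add: cliff_monom_mult cliff_sign_singleton)

lemma cliff_gen_anticommute:
  assumes "j \<in> {1..N}" "s \<in> {1..N}" "j \<noteq> s"
  shows "cliff_mult N (cliff_gen j) (cliff_gen s)
    = (\<lambda>K. - cliff_mult N (cliff_gen s) (cliff_gen j) K)"
  using assms by (auto simp: cliff_monom_mult cliff_sign_singleton insert_commute)

lemma cliff_gen_star: "cliff_star (cliff_gen j) = (\<lambda>K. - cliff_gen j K)"
  by (auto simp: cliff_star_def cliff_monom_def)

lemma cliff_monom_insert:
  assumes "insert i I \<subseteq> {1..N}" "\<forall>l\<in>I. i < l"
  shows "cliff_mult N (cliff_gen i) (cliff_monom I) = cliff_monom (insert i I)"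
proof -
  have *: "{p \<in> {i} \<times> I. snd p \<le> fst p} = {}" and "i \<notin> I"
    using assms(2) by (auto simp: not_le)
  then have "{i} - I \<union> (I - {i}) = insert i I"
    by auto
  then show ?thesis
    using assms(1) by (simp add: cliff_monom_mult cliff_sign_def * del: mem_Sigma_iff)
qed

text \<open>The multiplication is associative: on monomials this is the following identity of signs.\<close>

lemma cliff_sign_prod:
  assumes "finite I" "finite J"
  shows "cliff_sign I J = (\<Prod>i\<in>I. \<Prod>j\<in>J. if j \<le> i then -1 else 1)"
proof -
  have "cliff_sign I J = (\<Prod>x\<in>{x\<in>I \<times> J. snd x \<le> fst x}. -1)"
    by (simp add: cliff_sign_def)
  also have "\<dots> = (\<Prod>x\<in>I \<times> J. if snd x \<le> fst x then -1 else 1)"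
    using assms by (intro prod.inter_filter) auto
  also have "\<dots> = (\<Prod>i\<in>I. \<Prod>j\<in>J. if j \<le> i then -1 else 1)"
    by (simp add: prod.cartesian_product case_prod_unfold)
  finally show ?thesis .
qed

lemma prod_sym_diff:
  fixes g :: "'a \<Rightarrow> complex"
  assumes "finite I" "finite J" "\<And>i. g i * g i = 1"
  shows "prod g (sym_diff I J) = prod g I * prod g J"
proof -
  have "prod g I = prod g (I - J) * prod g (I \<inter> J)" "prod g J = prod g (J - I) * prod g (I \<inter> J)"
    using assms by (simp_all add: prod.Int_Diff[of I g J] prod.Int_Diff[of J g I] Int_commute mult.commute)
  moreover have "prod g (I \<inter> J) * prod g (I \<inter> J) = 1"
    by (simp add: assms(3) flip: prod.distrib)
  moreover have "prod g (sym_diff I J) = prod g (I - J) * prod g (J - I)"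
    using assms by (intro prod.union_disjoint) auto
  ultimately show ?thesis by (simp add: algebra_simps)
qed

lemma cliff_monom_assoc:
  assumes "finite I" "finite J" "finite K"
  shows "cliff_sign I J * cliff_sign (sym_diff I J) K
    = cliff_sign I (sym_diff J K) * cliff_sign J K"
proof -
  have 1: "(\<Prod>j\<in>L. if j \<le> i then -1 else 1) * (\<Prod>j\<in>L. if j \<le> i then -1 else 1) = (1::complex)"
    for L and i :: nat
    by (auto simp flip: prod.distrib intro: prod.neutral)
  have "cliff_sign (sym_diff I J) K = cliff_sign I K * cliff_sign J K"
    using assms by (simp only: cliff_sign_prod finite_Un finite_Diff simp_thms)
      (rule prod_sym_diff; simp add: 1)
  moreover have "cliff_sign I (sym_diff J K) = cliff_sign I J * cliff_sign I K"
    using assms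
    by (simp only: cliff_sign_prod finite_Un finite_Diff simp_thms prod_sym_diff flip: prod.distrib)
      (rule prod.cong[OF refl], rule prod_sym_diff, auto)
  ultimately show ?thesis by simp
qed

text \<open>Faithful unital *-representations of the Clifford algebra on \<^typ>\<open>complex ^ 's\<close>.\<close>

definition faithful_clifford_rep :: "nat \<Rightarrow> (clifford \<Rightarrow> complex ^ 's ^ 's) \<Rightarrow> bool" where
  "faithful_clifford_rep N c \<longleftrightarrow>
     (\<forall>a\<in>cliff_carrier N. \<forall>b\<in>cliff_carrier N. c (\<lambda>I. a I + b I) = c a + c b) \<and>
     (\<forall>z. \<forall>a\<in>cliff_carrier N. c (\<lambda>I. z * a I) = map_matrix ((*) z) (c a)) \<and>
     (\<forall>a\<in>cliff_carrier N. \<forall>b\<in>cliff_carrier N. c (cliff_mult N a b) = c a ** c b) \<and>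
     c cliff_one = mat 1 \<and>
     (\<forall>a\<in>cliff_carrier N. c (cliff_star a) = map_matrix cnj (transpose (c a))) \<and>
     inj_on c (cliff_carrier N)"

section \<open>The Dirac operator\<close>

text \<open>The operator \<open>T \<otimes> M\<close>, where the tensor product with \<^typ>\<open>complex ^ 's\<close> is realized as the
  space of vector-valued square-summable functions.\<close>

definition tensor_op :: "'g op \<Rightarrow> complex ^ 's ^ 's \<Rightarrow> ('g \<Rightarrow> complex ^ 's) \<Rightarrow> ('g \<Rightarrow> complex ^ 's)" where
  "tensor_op T M = (\<lambda>\<xi> m. M *v (\<chi> i. T (\<lambda>p. \<xi> p $ i) m))"

definition inf_form :: "nat \<Rightarrow> (nat \<Rightarrow> enat) \<Rightarrow> (nat \<Rightarrow> int) \<Rightarrow> real" where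
  "inf_form q k m = (\<Sum>j | j \<in> {1..q} \<and> k j = \<infinity>. (of_int (m j))\<^sup>2)"

definition D_dom :: "nat \<Rightarrow> (nat \<Rightarrow> enat) \<Rightarrow> ((nat \<Rightarrow> int) \<Rightarrow> complex ^ 's) set" where
  "D_dom d' k' = {\<xi> \<in> ell2 (carrier (Zk d' k')).
     (\<lambda>m. (1 + inf_form d' k' m) * (norm (\<xi> m))\<^sup>2) summable_on carrier (Zk d' k')}"

definition D_op :: "nat \<Rightarrow> nat \<Rightarrow> (nat \<Rightarrow> nat) \<Rightarrow> (nat \<Rightarrow> enat) \<Rightarrow> (nat \<Rightarrow> enat)
     \<Rightarrow> ((nat \<Rightarrow> int) \<Rightarrow> (nat \<Rightarrow> int) \<Rightarrow> complex) \<Rightarrow> (clifford \<Rightarrow> complex ^ 's ^ 's)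
     \<Rightarrow> ((nat \<Rightarrow> int) \<Rightarrow> complex ^ 's) \<Rightarrow> ((nat \<Rightarrow> int) \<Rightarrow> complex ^ 's)" where
  "D_op d d' f k k' \<sigma>' c = (\<lambda>\<xi> m. \<Sum>l\<in>{1..d + d'}.
     tensor_op (Gamma_op d d' f k k' \<sigma>' l) (c (cliff_gen l)) \<xi> m)"

end

theory Submission
  imports Defs "HOL-Complex_Analysis.Great_Picard"
begin

text \<open>Write \<open>P\<close> for one of \<open>X\<^bsub>n,j\<^esub>\<close>, \<open>Y\<^bsub>n,j\<^esub>\<close> or the identity. For an infinite \<open>k j\<close> the summands are
  \<open>\<Gamma> = P \<partial>\<^sub>j\<close>, where the operators \<open>P\<close> commute with one another and their commutators with derivations
  are bounded; all other summands are bounded and skew. Expanding the square of the unbounded part with the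
  Clifford relations leaves the squares \<open>\<parallel>\<Gamma> \<xi>\<parallel>\<^sup>2\<close>, which add up to \<open>\<Sum>\<^sub>j \<parallel>\<partial>\<^sub>j \<xi>\<parallel>\<^sup>2\<close> since \<open>X\<^sup>2 + Y\<^sup>2 = 1\<close>,
  and commutators \<open>[\<Gamma>, \<Gamma>']\<close>, which are again of first order. Hence the graph norm of \<open>D\<close> controls the weighted
  norm defining the domain. Cutoffs \<open>\<phi>\<close> of finite support with bounded \<open>[D, \<phi>]\<close> then
  show that the adjoint has the same domain, and the resolvent is compact because the weight has
  finite sublevel sets.\<close>

section \<open>Square-summable functions\<close>

text \<open>Three facts about the unitaries drive the estimates. When \<open>k j\<close> is infinite
  the scalar in the relations is 1, so \<open>U (f j)\<close> commutes with every
  \<open>U s\<close>; this makes the coefficients \<open>P\<close> commute. Since \<open>f j\<close>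
  differs from \<open>j\<close>, \<open>U (f j)\<close> also commutes with the \<open>j\<close>-th
  derivation, so a hermitian coefficient times that derivation is skew. Finally, a translation
  changes one coordinate by 1, so its commutator with a derivation is a multiple of the translation
  itself.

  Coercivity alone does not exclude an adjoint with a larger domain. The cutoffs have slope about
  1/n and live where the coordinates are of size at most about n, so the variation of the cutoff
  across one translation step, times a derivation, stays bounded uniformly in n.

  Surjectivity of \<open>T - \<i>\<close> comes from minimising a distance: the compact embedding
  supplies a minimiser, and the residual is an eigenvector of the adjoint for the eigenvalue
  \<open>- \<i>\<close>, hence zero. Estimates are proved on finitely supported vectors, where every
  operator of the principal part can be composed freely, and are then extended by density.\<close>

definition fin_supp :: "'g set \<Rightarrow> ('g \<Rightarrow> 'v::zero) set" where
  "fin_supp A = {\<xi>. finite {m. \<xi> m \<noteq> 0} \<and> {m. \<xi> m \<noteq> 0} \<subseteq> A}"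

definition trunc :: "'g set \<Rightarrow> ('g \<Rightarrow> 'v::zero) \<Rightarrow> 'g \<Rightarrow> 'v" where
  "trunc F \<xi> = (\<lambda>m. if m \<in> F then \<xi> m else 0)"

lemma trunc_in_fin_supp: "finite F \<Longrightarrow> F \<subseteq> A \<Longrightarrow> trunc F \<xi> \<in> fin_supp A"
  by (auto simp: fin_supp_def trunc_def intro: finite_subset)

lemma ell2_outside: "\<xi> \<in> ell2 A \<Longrightarrow> m \<notin> A \<Longrightarrow> \<xi> m = 0"
  by (simp add: ell2_def)

lemma ell2_norm_nonneg [simp]: "0 \<le> ell2_norm A \<xi>"
  by (simp add: ell2_norm_def infsum_nonneg)

lemma ell2_norm_power2: "(ell2_norm A \<xi>)\<^sup>2 = (\<Sum>\<^sub>\<infinity>m\<in>A. (norm (\<xi> m))\<^sup>2)"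
  by (simp add: ell2_norm_def infsum_nonneg)

lemma L2_set_le_ell2_norm:
  assumes "\<xi> \<in> ell2 A" "finite F" "F \<subseteq> A"
  shows "L2_set (\<lambda>m. norm (\<xi> m)) F \<le> ell2_norm A \<xi>"
  using assms unfolding L2_set_def ell2_norm_def ell2_def
  by (intro real_sqrt_le_mono finite_sum_le_infsum) auto

lemma norm_le_ell2_norm: "\<xi> \<in> ell2 A \<Longrightarrow> norm (\<xi> m) \<le> ell2_norm A \<xi>"
  using L2_set_le_ell2_norm[of \<xi> A "{m}"] ell2_outside[of \<xi> A m] by (cases "m \<in> A") auto

text \<open>Nonnegative families with bounded finite partial sums are summable, so membership and
  norm bound both reduce to \<open>L2_set\<close> on finite sets. This is how the Minkowski
  inequality for \<open>L2_set\<close> passes to infinite index sets below.\<close>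

lemma ell2_boundI:
  assumes "\<And>m. m \<notin> A \<Longrightarrow> \<xi> m = 0"
    and bd: "\<And>F. finite F \<Longrightarrow> F \<subseteq> A \<Longrightarrow> L2_set (\<lambda>m. norm (\<xi> m)) F \<le> c"
  shows "\<xi> \<in> ell2 A" and "ell2_norm A \<xi> \<le> c"
proof -
  have c: "0 \<le> c" using bd[of "{}"] by simp
  have fin: "(\<Sum>m\<in>F. (norm (\<xi> m))\<^sup>2) \<le> c\<^sup>2" if "finite F" "F \<subseteq> A" for F
    using bd[OF that] c unfolding L2_set_def by (simp add: sqrt_le_D)
  have s: "(\<lambda>m. (norm (\<xi> m))\<^sup>2) summable_on A"
    by (rule nonneg_bdd_above_summable_on) (auto intro!: bdd_aboveI2 fin)
  then show "\<xi> \<in> ell2 A" using assms(1) by (simp add: ell2_def)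
  have "(\<Sum>\<^sub>\<infinity>m\<in>A. (norm (\<xi> m))\<^sup>2) \<le> c\<^sup>2"
    by (rule infsum_le_finite_sums[OF s]) (use fin in auto)
  then show "ell2_norm A \<xi> \<le> c"
    unfolding ell2_norm_def using c by (simp add: real_le_lsqrt)
qed

lemma
  assumes "\<eta> \<in> ell2 A" "0 \<le> c" "\<And>m. m \<notin> A \<Longrightarrow> \<xi> m = 0"
    and "\<And>m. m \<in> A \<Longrightarrow> norm (\<xi> m) \<le> c * norm (\<eta> m)"
  shows ell2_dominated: "\<xi> \<in> ell2 A" and ell2_norm_dominated: "ell2_norm A \<xi> \<le> c * ell2_norm A \<eta>"
proof -
  have "L2_set (\<lambda>m. norm (\<xi> m)) F \<le> c * ell2_norm A \<eta>" if F: "finite F" "F \<subseteq> A" for F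
  proof -
    have "L2_set (\<lambda>m. norm (\<xi> m)) F \<le> L2_set (\<lambda>m. c * norm (\<eta> m)) F"
      using assms F by (intro L2_set_mono) auto
    also have "\<dots> = c * L2_set (\<lambda>m. norm (\<eta> m)) F"
      using assms by (simp add: L2_set_right_distrib)
    also have "\<dots> \<le> c * ell2_norm A \<eta>"
      using assms F by (intro mult_left_mono L2_set_le_ell2_norm)
    finally show ?thesis .
  qed
  from ell2_boundI[OF assms(3) this] show "\<xi> \<in> ell2 A" "ell2_norm A \<xi> \<le> c * ell2_norm A \<eta>"
    by auto
qed

lemma
  assumes "\<xi> \<in> ell2 A" "\<eta> \<in> ell2 A"
  shows ell2_add: "(\<lambda>m. \<xi> m + \<eta> m) \<in> ell2 A"
    and ell2_norm_triangle: "ell2_norm A (\<lambda>m. \<xi> m + \<eta> m) \<le> ell2_norm A \<xi> + ell2_norm A \<eta>"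
proof -
  have "L2_set (\<lambda>m. norm (\<xi> m + \<eta> m)) F \<le> ell2_norm A \<xi> + ell2_norm A \<eta>"
    if F: "finite F" "F \<subseteq> A" for F
  proof -
    have "L2_set (\<lambda>m. norm (\<xi> m + \<eta> m)) F \<le> L2_set (\<lambda>m. norm (\<xi> m) + norm (\<eta> m)) F"
      by (intro L2_set_mono) (auto simp: norm_triangle_ineq)
    also have "\<dots> \<le> L2_set (\<lambda>m. norm (\<xi> m)) F + L2_set (\<lambda>m. norm (\<eta> m)) F"
      by (rule L2_set_triangle_ineq)
    also have "\<dots> \<le> ell2_norm A \<xi> + ell2_norm A \<eta>"
      using assms F by (intro add_mono L2_set_le_ell2_norm)
    finally show ?thesis .
  qed
  moreover have "\<xi> m + \<eta> m = 0" if "m \<notin> A" for m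
    using that assms by (simp add: ell2_outside)
  ultimately show "(\<lambda>m. \<xi> m + \<eta> m) \<in> ell2 A"
    "ell2_norm A (\<lambda>m. \<xi> m + \<eta> m) \<le> ell2_norm A \<xi> + ell2_norm A \<eta>"
    using ell2_boundI[of A "\<lambda>m. \<xi> m + \<eta> m"] by blast+
qed

lemma ell2_zero [simp]: "(\<lambda>m. 0) \<in> ell2 A"
  by (simp add: ell2_def)

lemma ell2_norm_zero [simp]: "ell2_norm A (\<lambda>m. 0) = 0"
  by (simp add: ell2_norm_def)

lemma ell2_uminus: "\<xi> \<in> ell2 A \<Longrightarrow> (\<lambda>m. - \<xi> m) \<in> ell2 A"
  by (simp add: ell2_def)

lemma ell2_norm_uminus [simp]: "ell2_norm A (\<lambda>m. - \<xi> m) = ell2_norm A \<xi>"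
  by (simp add: ell2_norm_def)

lemma ell2_diff: "\<xi> \<in> ell2 A \<Longrightarrow> \<eta> \<in> ell2 A \<Longrightarrow> (\<lambda>m. \<xi> m - \<eta> m) \<in> ell2 A"
  using ell2_add[of \<xi> A "\<lambda>m. - \<eta> m"] ell2_uminus[of \<eta> A] by simp

lemma ell2_norm_diff_le:
  "\<xi> \<in> ell2 A \<Longrightarrow> \<eta> \<in> ell2 A \<Longrightarrow> ell2_norm A (\<lambda>m. \<xi> m - \<eta> m) \<le> ell2_norm A \<xi> + ell2_norm A \<eta>"
  using ell2_norm_triangle[of \<xi> A "\<lambda>m. - \<eta> m"] ell2_uminus[of \<eta> A] by simp

lemma ell2_norm_diff_commute: "ell2_norm A (\<lambda>m. \<xi> m - \<eta> m) = ell2_norm A (\<lambda>m. \<eta> m - \<xi> m)"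
  by (simp add: ell2_norm_def norm_minus_commute)

lemma ell2_norm_triangle_sub:
  assumes "\<xi> \<in> ell2 A" "\<eta> \<in> ell2 A"
  shows "ell2_norm A \<xi> \<le> ell2_norm A \<eta> + ell2_norm A (\<lambda>m. \<xi> m - \<eta> m)"
  using ell2_norm_triangle[of \<eta> A "\<lambda>m. \<xi> m - \<eta> m"] assms by (simp add: ell2_diff)

lemma
  assumes "\<And>i. i \<in> I \<Longrightarrow> \<xi> i \<in> ell2 A"
  shows ell2_sum: "(\<lambda>m. \<Sum>i\<in>I. \<xi> i m) \<in> ell2 A"
    and ell2_norm_sum: "ell2_norm A (\<lambda>m. \<Sum>i\<in>I. \<xi> i m) \<le> (\<Sum>i\<in>I. ell2_norm A (\<xi> i))"
proof -
  have "(\<lambda>m. \<Sum>i\<in>I. \<xi> i m) \<in> ell2 A \<and> ell2_norm A (\<lambda>m. \<Sum>i\<in>I. \<xi> i m) \<le> (\<Sum>i\<in>I. ell2_norm A (\<xi> i))"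
    using assms
  proof (induction I rule: infinite_finite_induct)
    case (insert i I)
    then have IH: "(\<lambda>m. \<Sum>i\<in>I. \<xi> i m) \<in> ell2 A"
      "ell2_norm A (\<lambda>m. \<Sum>i\<in>I. \<xi> i m) \<le> (\<Sum>i\<in>I. ell2_norm A (\<xi> i))" by auto
    then show ?case
      using insert.hyps insert.prems
        ell2_add[OF insert.prems[of i] IH(1)] ell2_norm_triangle[OF insert.prems[of i] IH(1)]
      by simp
  qed auto
  then show "(\<lambda>m. \<Sum>i\<in>I. \<xi> i m) \<in> ell2 A"
    "ell2_norm A (\<lambda>m. \<Sum>i\<in>I. \<xi> i m) \<le> (\<Sum>i\<in>I. ell2_norm A (\<xi> i))" by auto
qed

lemma fin_supp_ell2:
  assumes "\<xi> \<in> fin_supp A"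
  shows "\<xi> \<in> ell2 A"
proof -
  let ?S = "{m. \<xi> m \<noteq> 0}"
  have "(\<lambda>m. (norm (\<xi> m))\<^sup>2) summable_on ?S" using assms by (simp add: fin_supp_def)
  then have "(\<lambda>m. (norm (\<xi> m))\<^sup>2) summable_on A"
    by (rule summable_on_cong_neutral[THEN iffD1, rotated -1]) (use assms in \<open>auto simp: fin_supp_def\<close>)
  then show ?thesis using assms by (auto simp: ell2_def fin_supp_def)
qed

lemma fin_supp_add:
  fixes \<xi> \<eta> :: "'g \<Rightarrow> 'v::monoid_add"
  assumes "\<xi> \<in> fin_supp A" "\<eta> \<in> fin_supp A"
  shows "(\<lambda>m. \<xi> m + \<eta> m) \<in> fin_supp A"
proof -
  have "{m. \<xi> m + \<eta> m \<noteq> 0} \<subseteq> {m. \<xi> m \<noteq> 0} \<union> {m. \<eta> m \<noteq> 0}"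
    by auto
  then show ?thesis
    using assms finite_subset[of _ "{m. \<xi> m \<noteq> 0} \<union> {m. \<eta> m \<noteq> 0}"] unfolding fin_supp_def by blast
qed

lemma fin_supp_pointwise:
  assumes "\<xi> \<in> fin_supp A" "\<And>m. \<xi> m = 0 \<Longrightarrow> \<eta> m = 0"
  shows "\<eta> \<in> fin_supp A"
  using assms unfolding fin_supp_def by (auto intro: finite_subset[of _ "{m. \<xi> m \<noteq> 0}"])

lemma ell2_trunc:
  assumes "\<xi> \<in> ell2 A" "F \<subseteq> A"
  shows "trunc F \<xi> \<in> ell2 A"
  by (rule ell2_dominated[where c = 1 and \<eta> = \<xi>]) (use assms in \<open>auto simp: trunc_def\<close>)

lemma ell2_approx:
  assumes \<xi>: "\<xi> \<in> ell2 A" and "e > 0"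
  obtains F where "finite F" "F \<subseteq> A" "ell2_norm A (\<lambda>m. \<xi> m - trunc F \<xi> m) < e"
proof -
  have s: "(\<lambda>m. (norm (\<xi> m))\<^sup>2) summable_on A" using \<xi> by (simp add: ell2_def)
  \<comment> \<open>The approximation lemma yields a non-strict bound; half of
    \<open>e\<^sup>2\<close> leaves room for the strict inequality wanted at the end.\<close>
  obtain F where F: "finite F" "F \<subseteq> A"
    "dist (\<Sum>m\<in>F. (norm (\<xi> m))\<^sup>2) (\<Sum>\<^sub>\<infinity>m\<in>A. (norm (\<xi> m))\<^sup>2) \<le> e\<^sup>2 / 2"
    using infsum_finite_approximation[OF s, of "e\<^sup>2 / 2"] \<open>e > 0\<close> by auto
  have 1: "(\<lambda>m. (norm (\<xi> m))\<^sup>2) summable_on F" "(\<lambda>m. (norm (\<xi> m))\<^sup>2) summable_on (A - F)"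
    using F by (auto intro: summable_on_subset_banach[OF s])
  have "(\<Sum>\<^sub>\<infinity>m\<in>A. (norm (\<xi> m - trunc F \<xi> m))\<^sup>2) = (\<Sum>\<^sub>\<infinity>m\<in>A - F. (norm (\<xi> m))\<^sup>2)"
    by (rule infsum_cong_neutral) (auto simp: trunc_def)
  also have "\<dots> = (\<Sum>\<^sub>\<infinity>m\<in>A. (norm (\<xi> m))\<^sup>2) - (\<Sum>m\<in>F. (norm (\<xi> m))\<^sup>2)"
    using infsum_Un_disjoint[OF 1] F by (simp add: Un_absorb1)
  also have "\<dots> \<le> e\<^sup>2 / 2" using F(3) unfolding dist_real_def by linarith
  also have "\<dots> < e\<^sup>2" using \<open>e > 0\<close> by simp
  finally have "ell2_norm A (\<lambda>m. \<xi> m - trunc F \<xi> m) < e"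
    unfolding ell2_norm_def using \<open>e > 0\<close> by (simp add: real_sqrt_less_iff real_less_lsqrt)
  with F that show ?thesis by blast
qed

text \<open>Lower semicontinuity of the norm in the manner of Fatou: norms over a finite set pass to
  the pointwise limit and keep the bound \<open>c\<close>, which does not depend on the set.\<close>

lemma
  assumes "\<And>n. \<xi> n \<in> ell2 A" "\<forall>\<^sub>F n in sequentially. ell2_norm A (\<xi> n) \<le> c"
    and "\<And>m. (\<lambda>n. \<xi> n m) \<longlonglongrightarrow> \<eta> m"
  shows ell2_pointwise_limit: "\<eta> \<in> ell2 A" and ell2_norm_pointwise_limit: "ell2_norm A \<eta> \<le> c"
proof -
  have "L2_set (\<lambda>m. norm (\<eta> m)) F \<le> c" if F: "finite F" "F \<subseteq> A" for F
  proof (rule tendsto_upperbound)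
    show "(\<lambda>n. L2_set (\<lambda>m. norm (\<xi> n m)) F) \<longlonglongrightarrow> L2_set (\<lambda>m. norm (\<eta> m)) F"
      unfolding L2_set_def by (intro tendsto_intros assms(3))
    show "\<forall>\<^sub>F n in sequentially. L2_set (\<lambda>m. norm (\<xi> n m)) F \<le> c"
      using assms(2) by eventually_elim (use L2_set_le_ell2_norm[OF assms(1) F] order_trans in blast)
  qed simp
  moreover have "\<eta> m = 0" if "m \<notin> A" for m
    using assms(3)[of m] ell2_outside[OF assms(1) that] by (simp add: LIMSEQ_const_iff)
  ultimately show "\<eta> \<in> ell2 A" "ell2_norm A \<eta> \<le> c"
    using ell2_boundI[of A \<eta> c] by blast+
qed

lemma ell2_pointwise_subseq:
  fixes \<xi> :: "nat \<Rightarrow> 'g \<Rightarrow> 'v::{real_normed_vector, heine_borel}"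
  assumes "countable A" "\<And>n. \<xi> n \<in> ell2 A" "\<And>n. ell2_norm A (\<xi> n) \<le> c"
  obtains r \<eta> where "strict_mono (r :: nat \<Rightarrow> nat)" "\<And>m. (\<lambda>n. \<xi> (r n) m) \<longlonglongrightarrow> \<eta> m"
    "\<eta> \<in> ell2 A" "ell2_norm A \<eta> \<le> c"
proof -
  have "norm (\<xi> n m) \<le> c" for n m
    using norm_le_ell2_norm[OF assms(2), of n m] assms(3)[of n] by linarith
  \<comment> \<open>\<open>function_convergent_subsequence\<close> is the diagonal argument over the
    countable set \<open>A\<close>; it needs only pointwise boundedness, which the norm bound
    gives.\<close>
  then obtain r :: "nat \<Rightarrow> nat" where r: "strict_mono r"
    and ex: "\<And>m. m \<in> A \<Longrightarrow> \<exists>l. (\<lambda>n. \<xi> (r n) m) \<longlonglongrightarrow> l"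
    using function_convergent_subsequence[OF assms(1), of \<xi> c] by blast
  have ex: "\<exists>l. (\<lambda>n. \<xi> (r n) m) \<longlonglongrightarrow> l" for m
  proof (cases "m \<in> A")
    case False
    then have "\<xi> (r n) m = 0" for n using ell2_outside[OF assms(2)] by simp
    then show ?thesis by auto
  qed (rule ex)
  then obtain \<eta> where \<eta>: "\<And>m. (\<lambda>n. \<xi> (r n) m) \<longlonglongrightarrow> \<eta> m" by metis
  show ?thesis
  proof (rule that[OF r \<eta>])
    have "\<forall>\<^sub>F n in sequentially. ell2_norm A (\<xi> (r n)) \<le> c"
      using assms(3) by simp
    then show "\<eta> \<in> ell2 A" "ell2_norm A \<eta> \<le> c"
      using ell2_pointwise_limit[OF assms(2) _ \<eta>] ell2_norm_pointwise_limit[OF assms(2) _ \<eta>] by auto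
  qed
qed

section \<open>Inner products\<close>

text \<open>One development serves scalar and vector-valued functions. The product \<open>ip\<close>
  is a parameter with an equation, not a definition, so that the two instances are literally
  \<open>ell2_inner\<close> and \<open>ell2_vinner\<close>.\<close>

locale pointwise_inner =
  fixes sm :: "complex \<Rightarrow> 'v::real_normed_vector \<Rightarrow> 'v" and g :: "'v \<Rightarrow> 'v \<Rightarrow> complex"
    and ip :: "'g set \<Rightarrow> ('g \<Rightarrow> 'v) \<Rightarrow> ('g \<Rightarrow> 'v) \<Rightarrow> complex"
  assumes ip_eq: "ip A \<xi> \<eta> = (\<Sum>\<^sub>\<infinity>m\<in>A. g (\<xi> m) (\<eta> m))"
    and g_add: "g x (y + z) = g x y + g x z"
    and g_sm: "g x (sm a y) = a * g x y"
    and g_cnj: "g y x = cnj (g x y)"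
    and g_self: "g x x = of_real ((norm x)\<^sup>2)"
    and g_cs: "norm (g x y) \<le> norm x * norm y"
    and norm_sm: "norm (sm a x) = norm a * norm x"
begin

lemma g_add_left: "g (x + y) z = g x z + g y z"
  by (subst (1 2 3) g_cnj) (simp add: g_add)

lemma g_sm_left: "g (sm a x) y = cnj a * g x y"
  by (subst (1 2) g_cnj) (simp add: g_sm)

lemma g_summable:
  assumes "\<xi> \<in> ell2 A" "\<eta> \<in> ell2 A"
  shows "(\<lambda>m. norm (g (\<xi> m) (\<eta> m))) summable_on A"
proof (rule Infinite_Sum.abs_summable_on_comparison_test')
  show "(\<lambda>m. (norm (\<xi> m))\<^sup>2 + (norm (\<eta> m))\<^sup>2) summable_on A"
    using assms by (intro summable_on_add) (auto simp: ell2_def)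
  show "norm (g (\<xi> m) (\<eta> m)) \<le> (norm (\<xi> m))\<^sup>2 + (norm (\<eta> m))\<^sup>2" for m
  proof -
    have "2 * (norm (\<xi> m) * norm (\<eta> m)) \<le> (norm (\<xi> m))\<^sup>2 + (norm (\<eta> m))\<^sup>2"
      using sum_squares_bound[of "norm (\<xi> m)" "norm (\<eta> m)"] by (simp add: power2_eq_square)
    moreover have "0 \<le> norm (\<xi> m) * norm (\<eta> m)" by simp
    ultimately show ?thesis using g_cs[of "\<xi> m" "\<eta> m"] by linarith
  qed
qed

lemma g_summable': "\<xi> \<in> ell2 A \<Longrightarrow> \<eta> \<in> ell2 A \<Longrightarrow> (\<lambda>m. g (\<xi> m) (\<eta> m)) summable_on A"
  using g_summable by (rule Infinite_Sum.abs_summable_summable)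

lemma ip_add_right:
  "\<xi> \<in> ell2 A \<Longrightarrow> \<eta> \<in> ell2 A \<Longrightarrow> \<zeta> \<in> ell2 A \<Longrightarrow> ip A \<xi> (\<lambda>m. \<eta> m + \<zeta> m) = ip A \<xi> \<eta> + ip A \<xi> \<zeta>"
  by (simp add: ip_eq g_add infsum_add g_summable')

lemma ip_cnj: "ip A \<eta> \<xi> = cnj (ip A \<xi> \<eta>)"
  unfolding ip_eq by (subst infsum_cnj[symmetric]) (simp flip: g_cnj)

lemma ip_add_left:
  "\<xi> \<in> ell2 A \<Longrightarrow> \<eta> \<in> ell2 A \<Longrightarrow> \<zeta> \<in> ell2 A \<Longrightarrow> ip A (\<lambda>m. \<eta> m + \<zeta> m) \<xi> = ip A \<eta> \<xi> + ip A \<zeta> \<xi>"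
  by (simp add: ip_eq g_add_left infsum_add g_summable')

lemma ip_sm_right: "ip A \<xi> (\<lambda>m. sm a (\<eta> m)) = a * ip A \<xi> \<eta>"
  by (simp add: ip_eq g_sm infsum_cmult_right')

lemma ip_sm_left: "ip A (\<lambda>m. sm a (\<xi> m)) \<eta> = cnj a * ip A \<xi> \<eta>"
  by (simp add: ip_eq g_sm_left infsum_cmult_right')

lemma g_zero: "g x 0 = 0" "g 0 x = 0"
  using g_add[of x 0 0] g_add_left[of 0 0 x] by auto

lemma g_uminus: "g x (- y) = - g x y" "g (- x) y = - g x y"
  using g_add[of x y "- y"] g_add_left[of x "- x" y] by (auto simp: g_zero eq_neg_iff_add_eq_0 add.commute)

lemma ip_uminus: "ip A \<xi> (\<lambda>m. - \<eta> m) = - ip A \<xi> \<eta>" "ip A (\<lambda>m. - \<xi> m) \<eta> = - ip A \<xi> \<eta>"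
  by (simp_all add: ip_eq g_uminus infsum_uminus)

lemma ip_diff_right:
  "\<xi> \<in> ell2 A \<Longrightarrow> \<eta> \<in> ell2 A \<Longrightarrow> \<zeta> \<in> ell2 A \<Longrightarrow> ip A \<xi> (\<lambda>m. \<eta> m - \<zeta> m) = ip A \<xi> \<eta> - ip A \<xi> \<zeta>"
  using ip_add_right[of \<xi> A \<eta> "\<lambda>m. - \<zeta> m"] by (simp add: ell2_uminus ip_uminus)

lemma ip_diff_left:
  "\<xi> \<in> ell2 A \<Longrightarrow> \<eta> \<in> ell2 A \<Longrightarrow> \<zeta> \<in> ell2 A \<Longrightarrow> ip A (\<lambda>m. \<eta> m - \<zeta> m) \<xi> = ip A \<eta> \<xi> - ip A \<zeta> \<xi>"
  using ip_add_left[of \<xi> A \<eta> "\<lambda>m. - \<zeta> m"] by (simp add: ell2_uminus ip_uminus)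

lemma ip_zero [simp]: "ip A \<xi> (\<lambda>m. 0) = 0" "ip A (\<lambda>m. 0) \<xi> = 0"
  by (simp_all add: ip_eq g_zero)

lemma ip_sum_right:
  assumes "\<xi> \<in> ell2 A" "\<And>i. i \<in> I \<Longrightarrow> \<eta> i \<in> ell2 A"
  shows "ip A \<xi> (\<lambda>m. \<Sum>i\<in>I. \<eta> i m) = (\<Sum>i\<in>I. ip A \<xi> (\<eta> i))"
  using assms(2)
  by (induction I rule: infinite_finite_induct) (auto simp: ip_add_right ell2_sum assms(1))

lemma ip_sum_left:
  assumes "\<xi> \<in> ell2 A" "\<And>i. i \<in> I \<Longrightarrow> \<eta> i \<in> ell2 A"
  shows "ip A (\<lambda>m. \<Sum>i\<in>I. \<eta> i m) \<xi> = (\<Sum>i\<in>I. ip A (\<eta> i) \<xi>)"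
  using assms(2)
  by (induction I rule: infinite_finite_induct) (auto simp: ip_add_left ell2_sum assms(1))

lemma ip_self: "\<xi> \<in> ell2 A \<Longrightarrow> ip A \<xi> \<xi> = of_real ((ell2_norm A \<xi>)\<^sup>2)"
  unfolding ip_eq g_self ell2_norm_power2 ell2_def by (intro infsumI has_sum_of_real has_sum_infsum) simp

lemma ip_cauchy_schwarz:
  assumes "\<xi> \<in> ell2 A" "\<eta> \<in> ell2 A"
  shows "norm (ip A \<xi> \<eta>) \<le> ell2_norm A \<xi> * ell2_norm A \<eta>"
proof -
  have "norm (ip A \<xi> \<eta>) \<le> (\<Sum>\<^sub>\<infinity>m\<in>A. norm (g (\<xi> m) (\<eta> m)))"
    unfolding ip_eq by (rule norm_infsum_bound[OF g_summable[OF assms]])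
  also have "\<dots> \<le> ell2_norm A \<xi> * ell2_norm A \<eta>"
  proof (rule infsum_le_finite_sums[OF g_summable[OF assms]])
    fix F assume F: "finite F" "F \<subseteq> A"
    have "(\<Sum>m\<in>F. norm (g (\<xi> m) (\<eta> m))) \<le> (\<Sum>m\<in>F. \<bar>norm (\<xi> m)\<bar> * \<bar>norm (\<eta> m)\<bar>)"
      by (intro sum_mono) (simp add: g_cs)
    also have "\<dots> \<le> L2_set (\<lambda>m. norm (\<xi> m)) F * L2_set (\<lambda>m. norm (\<eta> m)) F"
      by (rule L2_set_mult_ineq)
    also have "\<dots> \<le> ell2_norm A \<xi> * ell2_norm A \<eta>"
      using F assms by (intro mult_mono L2_set_le_ell2_norm) auto
    finally show "(\<Sum>m\<in>F. norm (g (\<xi> m) (\<eta> m))) \<le> ell2_norm A \<xi> * ell2_norm A \<eta>" .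
  qed
  finally show ?thesis .
qed

lemma ell2_norm_add_power2:
  assumes "\<xi> \<in> ell2 A" "\<eta> \<in> ell2 A"
  shows "(ell2_norm A (\<lambda>m. \<xi> m + \<eta> m))\<^sup>2 = (ell2_norm A \<xi>)\<^sup>2 + 2 * Re (ip A \<xi> \<eta>) + (ell2_norm A \<eta>)\<^sup>2"
proof -
  have "ip A (\<lambda>m. \<xi> m + \<eta> m) (\<lambda>m. \<xi> m + \<eta> m) = ip A \<xi> \<xi> + ip A \<xi> \<eta> + ip A \<eta> \<xi> + ip A \<eta> \<eta>"
    using assms by (simp add: ip_add_left ip_add_right ell2_add)
  moreover have "ip A \<eta> \<xi> = cnj (ip A \<xi> \<eta>)" by (rule ip_cnj)
  ultimately have "ip A (\<lambda>m. \<xi> m + \<eta> m) (\<lambda>m. \<xi> m + \<eta> m) = ip A \<xi> \<xi> + ip A \<xi> \<eta> + cnj (ip A \<xi> \<eta>) + ip A \<eta> \<eta>"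
    by simp
  from arg_cong[OF this, of Re] show ?thesis
    using assms by (simp add: ip_self ell2_add flip: of_real_power)
qed

lemma sm_zero: "sm a 0 = 0"
  using norm_sm[of a 0] by simp

lemma ell2_sm: "\<xi> \<in> ell2 A \<Longrightarrow> (\<lambda>m. sm a (\<xi> m)) \<in> ell2 A"
  by (rule ell2_dominated[where c = "norm a" and \<eta> = \<xi>])
    (auto simp: norm_sm ell2_outside sm_zero)

lemma ell2_norm_sm: "ell2_norm A (\<lambda>m. sm a (\<xi> m)) = norm a * ell2_norm A \<xi>"
  by (simp add: ell2_norm_def norm_sm power_mult_distrib infsum_cmult_right' real_sqrt_mult)

lemma ip_tendsto:
  assumes "\<xi> \<in> ell2 A" "\<eta> \<in> ell2 A" "\<And>n. x n \<in> ell2 A" "\<And>n. y n \<in> ell2 A"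
    and "(\<lambda>n. ell2_norm A (\<lambda>m. x n m - \<xi> m)) \<longlonglongrightarrow> 0" "(\<lambda>n. ell2_norm A (\<lambda>m. y n m - \<eta> m)) \<longlonglongrightarrow> 0"
  shows "(\<lambda>n. ip A (x n) (y n)) \<longlonglongrightarrow> ip A \<xi> \<eta>"
proof -
  let ?a = "\<lambda>n. ell2_norm A (\<lambda>m. x n m - \<xi> m)" and ?b = "\<lambda>n. ell2_norm A (\<lambda>m. y n m - \<eta> m)"
  have "(\<lambda>n. ip A (x n) (y n) - ip A \<xi> \<eta>) \<longlonglongrightarrow> 0"
  proof (rule Lim_null_comparison)
    show "\<forall>\<^sub>F n in sequentially. norm (ip A (x n) (y n) - ip A \<xi> \<eta>)
      \<le> ?a n * (?b n + ell2_norm A \<eta>) + ell2_norm A \<xi> * ?b n"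
    proof (rule always_eventually, rule allI)
      fix n
      have "ip A (x n) (y n) - ip A \<xi> \<eta> = ip A (\<lambda>m. x n m - \<xi> m) (y n) + ip A \<xi> (\<lambda>m. y n m - \<eta> m)"
        using assms by (simp add: ip_diff_left ip_diff_right)
      then have "norm (ip A (x n) (y n) - ip A \<xi> \<eta>) \<le> ?a n * ell2_norm A (y n) + ell2_norm A \<xi> * ?b n"
        using assms ip_cauchy_schwarz[of "\<lambda>m. x n m - \<xi> m" A "y n"] ip_cauchy_schwarz[of \<xi> A "\<lambda>m. y n m - \<eta> m"]
          norm_triangle_ineq[of "ip A (\<lambda>m. x n m - \<xi> m) (y n)" "ip A \<xi> (\<lambda>m. y n m - \<eta> m)"]
        by (simp add: ell2_diff)
      moreover have "?a n * ell2_norm A (y n) \<le> ?a n * (?b n + ell2_norm A \<eta>)"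
        using ell2_norm_triangle_sub[of "y n" A \<eta>] assms by (intro mult_left_mono) auto
      ultimately show "norm (ip A (x n) (y n) - ip A \<xi> \<eta>)
        \<le> ?a n * (?b n + ell2_norm A \<eta>) + ell2_norm A \<xi> * ?b n" by linarith
    qed
    show "(\<lambda>n. ?a n * (?b n + ell2_norm A \<eta>) + ell2_norm A \<xi> * ?b n) \<longlonglongrightarrow> 0"
      by (auto intro!: tendsto_eq_intros assms(5,6))
  qed
  then show ?thesis by (simp add: LIM_zero_iff)
qed

text \<open>Testing against the truncation of \<open>\<zeta>\<close> to a finite set produces the
  square of the norm of that truncation, so one factor cancels; finite sets then exhaust the norm of
  \<open>\<zeta>\<close>.\<close>

lemma ell2_norm_le_by_duality:
  assumes "\<zeta> \<in> ell2 A" "0 \<le> c"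
    and bd: "\<And>\<xi>. \<xi> \<in> fin_supp A \<Longrightarrow> norm (ip A \<zeta> \<xi>) \<le> c * ell2_norm A \<xi>"
  shows "ell2_norm A \<zeta> \<le> c"
proof (rule ell2_boundI(2))
  fix F assume F: "finite F" "F \<subseteq> A"
  let ?\<xi> = "trunc F \<zeta>"
  have "ip A \<zeta> ?\<xi> = ip A ?\<xi> ?\<xi>"
    unfolding ip_eq by (rule infsum_cong) (simp add: trunc_def g_zero)
  then have *: "(ell2_norm A ?\<xi>)\<^sup>2 \<le> c * ell2_norm A ?\<xi>"
    using bd[OF trunc_in_fin_supp[OF F, of \<zeta>]] 
    by (simp add: ip_self[OF fin_supp_ell2[OF trunc_in_fin_supp[OF F]]] norm_power del: of_real_power)
  then have "ell2_norm A ?\<xi> \<le> c"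
    using assms(2) by (cases "ell2_norm A ?\<xi> = 0") (simp_all add: power2_eq_square order_less_le)
  moreover have "L2_set (\<lambda>m. norm (?\<xi> m)) F \<le> ell2_norm A ?\<xi>"
    by (rule L2_set_le_ell2_norm[OF ell2_trunc[OF assms(1)]]) (use F in auto)
  moreover have "L2_set (\<lambda>m. norm (?\<xi> m)) F = L2_set (\<lambda>m. norm (\<zeta> m)) F"
    by (rule L2_set_cong) (auto simp: trunc_def)
  ultimately show "L2_set (\<lambda>m. norm (\<zeta> m)) F \<le> c" by simp
qed (use assms in \<open>simp add: ell2_outside\<close>)

lemma ip_eq_imp_eq:
  assumes "\<zeta> \<in> ell2 A" "\<eta> \<in> ell2 A" "\<And>\<xi>. \<xi> \<in> fin_supp A \<Longrightarrow> ip A \<zeta> \<xi> = ip A \<eta> \<xi>"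
  shows "\<zeta> = \<eta>"
proof -
  have "ell2_norm A (\<lambda>m. \<zeta> m - \<eta> m) \<le> 0"
    using assms by (intro ell2_norm_le_by_duality) (auto simp: ell2_diff ip_diff_left fin_supp_ell2)
  then have "norm (\<zeta> m - \<eta> m) \<le> 0" for m
    using norm_le_ell2_norm[OF ell2_diff[OF assms(1,2)], of m] by linarith
  then show ?thesis by auto
qed

text \<open>The definite description in \<open>hadjoint\<close> is resolved by uniqueness:
  \<open>E\<close> contains the finitely supported vectors, and these separate the points of
  \<open>ell2 A\<close>.\<close>

lemma hadjoint_eqI:
  assumes "fin_supp A \<subseteq> E" "E \<subseteq> ell2 A" "\<zeta> \<in> ell2 A" "\<And>\<xi>. \<xi> \<in> E \<Longrightarrow> ip A \<zeta> \<xi> = ip A \<eta> (T \<xi>)"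
  shows "hadjoint (ell2 A) (ip A) E T \<eta> = \<zeta>"
  unfolding hadjoint_def
proof (rule the_equality)
  fix \<zeta>' assume "\<zeta>' \<in> ell2 A \<and> (\<forall>\<xi>\<in>E. ip A \<zeta>' \<xi> = ip A \<eta> (T \<xi>))"
  then show "\<zeta>' = \<zeta>"
    using assms by (intro ip_eq_imp_eq) auto
qed (use assms in auto)

end

definition vec_cinner :: "complex ^ 's \<Rightarrow> complex ^ 's \<Rightarrow> complex" where
  "vec_cinner x y = (\<Sum>i\<in>UNIV. cnj (x $ i) * y $ i)"

interpretation scal: pointwise_inner "(*)" "\<lambda>x y. cnj x * y" ell2_inner
  by unfold_locales
    (auto simp: ell2_inner_def algebra_simps norm_mult complex_norm_square mult.commute simp del: of_real_power)

lemma norm_vec_cmult: "norm (a *s x) = cmod a * norm x" for x :: "complex ^ 's"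
  by (simp add: norm_vec_def norm_mult L2_set_right_distrib)

interpretation vect: pointwise_inner "(*s)" vec_cinner ell2_vinner
proof
  fix x y z :: "complex ^ 's" and a
  show "vec_cinner x (a *s y) = a * vec_cinner x y"
    by (simp add: vec_cinner_def sum_distrib_left algebra_simps)
  show "vec_cinner x x = of_real ((norm x)\<^sup>2)"
    by (simp add: vec_cinner_def norm_vec_def L2_set_def sum_nonneg complex_norm_square mult.commute del: of_real_power)
  have "norm (vec_cinner x y) \<le> (\<Sum>i\<in>UNIV. \<bar>norm (x $ i)\<bar> * \<bar>norm (y $ i)\<bar>)"
    unfolding vec_cinner_def by (rule order_trans[OF norm_sum]) (simp add: norm_mult)
  also have "\<dots> \<le> norm x * norm y" unfolding norm_vec_def by (rule L2_set_mult_ineq)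
  finally show "norm (vec_cinner x y) \<le> norm x * norm y" .
qed (auto simp: vec_cinner_def ell2_vinner_def norm_vec_cmult algebra_simps sum.distrib)

section \<open>Self-adjointness and compact resolvent from coercivity and cutoffs\<close>

lemma quadratic_nonneg_imp_linear_zero:
  fixes a b :: real
  assumes "0 \<le> b" "\<And>t. 0 \<le> 2 * t * a + t\<^sup>2 * b"
  shows "a = 0"
proof (rule ccontr)
  assume "a \<noteq> 0"
  \<comment> \<open>The minimum of the quadratic is at \<open>- a / b\<close>; the denominator
    \<open>b + 1\<close> makes the choice legitimate for \<open>b = 0\<close> as well and still
    gives a negative value.\<close>
  have "0 \<le> 2 * (- a / (b + 1)) * a + (- a / (b + 1))\<^sup>2 * b" by (rule assms(2))
  also have "\<dots> = - (a\<^sup>2 * (b + 2)) / (b + 1)\<^sup>2"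
    using assms(1) by (simp add: divide_simps) (simp add: algebra_simps power2_eq_square)
  also have "\<dots> < 0"
    using assms(1) \<open>a \<noteq> 0\<close> by (simp add: divide_neg_pos)
  finally show False by simp
qed

lemma ell2_norm_trunc:
  assumes "finite F" "F \<subseteq> A"
  shows "ell2_norm A (trunc F \<xi>) = L2_set (\<lambda>m. norm (\<xi> m)) F"
proof -
  have "(\<Sum>\<^sub>\<infinity>m\<in>A. (norm (trunc F \<xi> m))\<^sup>2) = (\<Sum>\<^sub>\<infinity>m\<in>F. (norm (\<xi> m))\<^sup>2)"
    by (rule infsum_cong_neutral) (use assms in \<open>auto simp: trunc_def\<close>)
  then show ?thesis using assms by (simp add: ell2_norm_def L2_set_def)
qed

text \<open>The analytic core without any reference to tori. Symmetry, coercivity and the cutoff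
  commutator are required on finitely supported vectors only; \<open>T_bound\<close>, required on
  all of \<open>E\<close>, is what allows the first two to be extended by density. A single constant
  \<open>K\<close> serves for \<open>T_bound\<close> and \<open>T_coercive\<close>.\<close>

locale cutoff_operator =
  fixes A :: "'g set" and w :: "'g \<Rightarrow> real" and E :: "('g \<Rightarrow> complex ^ 's) set"
    and T :: "('g \<Rightarrow> complex ^ 's) \<Rightarrow> 'g \<Rightarrow> complex ^ 's"
    and \<phi> :: "nat \<Rightarrow> 'g \<Rightarrow> real" and K M :: real
  assumes w_ge_1: "m \<in> A \<Longrightarrow> 1 \<le> w m"
    and finite_sublevel: "finite {m \<in> A. w m \<le> r}"
    and E_eq: "E = {\<xi> \<in> ell2 A. (\<lambda>m. w m * (norm (\<xi> m))\<^sup>2) summable_on A}"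
    and K_nonneg: "0 \<le> K" and M_nonneg: "0 \<le> M"
    and T_add: "\<xi> \<in> E \<Longrightarrow> \<eta> \<in> E \<Longrightarrow> T (\<lambda>m. \<xi> m + \<eta> m) = (\<lambda>m. T \<xi> m + T \<eta> m)"
    and T_cmul: "\<xi> \<in> E \<Longrightarrow> T (\<lambda>m. a *s \<xi> m) = (\<lambda>m. a *s T \<xi> m)"
    and T_ell2: "\<xi> \<in> E \<Longrightarrow> T \<xi> \<in> ell2 A"
    and T_bound: "\<xi> \<in> E \<Longrightarrow> ell2_norm A (T \<xi>) \<le> K * ell2_norm A (\<lambda>m. sqrt (w m) *\<^sub>R \<xi> m)"
    and T_sym: "\<xi> \<in> fin_supp A \<Longrightarrow> \<eta> \<in> fin_supp A \<Longrightarrow> ell2_vinner A (T \<xi>) \<eta> = ell2_vinner A \<xi> (T \<eta>)"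
    and T_coercive: "\<xi> \<in> fin_supp A \<Longrightarrow>
      ell2_norm A (\<lambda>m. sqrt (w m) *\<^sub>R \<xi> m) \<le> K * (ell2_norm A (T \<xi>) + ell2_norm A \<xi>)"
    and cutoff_finite: "finite {m \<in> A. \<phi> n m \<noteq> 0}"
    and cutoff_range: "0 \<le> \<phi> n m" "\<phi> n m \<le> 1"
    and cutoff_limit: "m \<in> A \<Longrightarrow> (\<lambda>n. \<phi> n m) \<longlonglongrightarrow> 1"
    and cutoff_commutator: "\<xi> \<in> fin_supp A \<Longrightarrow>
      ell2_norm A (\<lambda>m. T (\<lambda>m. \<phi> n m *\<^sub>R \<xi> m) m - \<phi> n m *\<^sub>R T \<xi> m) \<le> M * ell2_norm A \<xi>"
begin

section \<open>The weighted domain and its core of finitely supported vectors\<close>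

abbreviation wt :: "('g \<Rightarrow> complex ^ 's) \<Rightarrow> 'g \<Rightarrow> complex ^ 's" where
  "wt \<xi> \<equiv> (\<lambda>m. sqrt (w m) *\<^sub>R \<xi> m)"

text \<open>Absorbing the root of the weight into the vector turns facts about \<open>ell2 A\<close>
  into facts about the domain.\<close>

lemma E_iff: "\<xi> \<in> E \<longleftrightarrow> \<xi> \<in> ell2 A \<and> wt \<xi> \<in> ell2 A"
proof -
  have "(\<lambda>m. w m * (norm (\<xi> m))\<^sup>2) summable_on A \<longleftrightarrow> (\<lambda>m. (norm (wt \<xi> m))\<^sup>2) summable_on A"
  proof (rule summable_on_cong)
    fix m assume "m \<in> A"
    then have "0 \<le> w m" using w_ge_1[of m] by simp
    then show "w m * (norm (\<xi> m))\<^sup>2 = (norm (wt \<xi> m))\<^sup>2" by (simp add: power_mult_distrib)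
  qed
  then show ?thesis by (auto simp: E_eq ell2_def)
qed

lemma
  assumes "wt \<xi> \<in> ell2 A" "\<And>m. m \<notin> A \<Longrightarrow> \<xi> m = 0"
  shows E_I: "\<xi> \<in> E" and ell2_norm_le_wt: "ell2_norm A \<xi> \<le> ell2_norm A (wt \<xi>)"
proof -
  have "norm (\<xi> m) \<le> 1 * norm (wt \<xi> m)" if "m \<in> A" for m
    using mult_right_mono[of 1 "sqrt (w m)" "norm (\<xi> m)"] w_ge_1[OF that] by simp
  from ell2_dominated[OF assms(1) _ assms(2) this] ell2_norm_dominated[OF assms(1) _ assms(2) this]
  show "\<xi> \<in> E" "ell2_norm A \<xi> \<le> ell2_norm A (wt \<xi>)"
    using assms(1) by (auto simp: E_iff)
qed

lemma E_norm_le_wt: "\<xi> \<in> E \<Longrightarrow> ell2_norm A \<xi> \<le> ell2_norm A (wt \<xi>)"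
  by (auto simp: E_iff intro: ell2_norm_le_wt ell2_outside)

lemma E_ell2: "\<xi> \<in> E \<Longrightarrow> \<xi> \<in> ell2 A"
  by (simp add: E_iff)

lemma wt_ell2: "\<xi> \<in> E \<Longrightarrow> wt \<xi> \<in> ell2 A"
  by (simp add: E_iff)

lemma E_add: "\<xi> \<in> E \<Longrightarrow> \<eta> \<in> E \<Longrightarrow> (\<lambda>m. \<xi> m + \<eta> m) \<in> E"
  using ell2_add[of "wt \<xi>" A "wt \<eta>"] by (auto simp: E_iff ell2_add scaleR_add_right)

lemma E_cmul: "\<xi> \<in> E \<Longrightarrow> (\<lambda>m. a *s \<xi> m) \<in> E"
proof -
  assume \<xi>: "\<xi> \<in> E"
  have "(\<lambda>m. a *s wt \<xi> m) = wt (\<lambda>m. a *s \<xi> m)"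
    by (auto simp: vec_eq_iff)
  then show ?thesis using vect.ell2_sm[of "wt \<xi>" A a] vect.ell2_sm[of \<xi> A a] \<xi> by (simp add: E_iff)
qed

lemma E_diff: "\<xi> \<in> E \<Longrightarrow> \<eta> \<in> E \<Longrightarrow> (\<lambda>m. \<xi> m - \<eta> m) \<in> E"
  using ell2_diff[of "wt \<xi>" A "wt \<eta>"] by (auto simp: E_iff ell2_diff scaleR_diff_right)

lemma E_zero: "(\<lambda>m. 0) \<in> E"
  by (simp add: E_iff)

lemma fin_supp_E: "\<xi> \<in> fin_supp A \<Longrightarrow> \<xi> \<in> E"
  using fin_supp_ell2[OF fin_supp_pointwise, of \<xi> A "wt \<xi>"] fin_supp_ell2[of \<xi> A] by (auto simp: E_iff)

lemma T_diff:
  assumes "\<xi> \<in> E" "\<eta> \<in> E"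
  shows "T (\<lambda>m. \<xi> m - \<eta> m) = (\<lambda>m. T \<xi> m - T \<eta> m)"
proof -
  have "T (\<lambda>m. \<xi> m + (-1) *s \<eta> m) = (\<lambda>m. T \<xi> m + (-1) *s T \<eta> m)"
    using T_add[OF assms(1) E_cmul[OF assms(2)], of "-1"] T_cmul[OF assms(2), of "-1"] by (simp only:)
  moreover have "x + (-1) *s y = x - y" for x y :: "complex ^ 's" by (simp add: vec_eq_iff)
  ultimately show ?thesis by simp
qed

text \<open>Truncations of \<open>\<xi>\<close> converge in the weighted norm, which dominates both
  the plain norm (as the weight is at least 1) and, by \<open>T_bound\<close>, the norm of the
  images. Finitely supported vectors therefore form a core for \<open>T\<close>.\<close>

lemma E_approx:
  assumes "\<xi> \<in> E"
  obtains x where "\<And>n::nat. x n \<in> fin_supp A" "(\<lambda>n. ell2_norm A (wt (\<lambda>m. x n m - \<xi> m))) \<longlonglongrightarrow> 0"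
    "(\<lambda>n. ell2_norm A (\<lambda>m. x n m - \<xi> m)) \<longlonglongrightarrow> 0"
    "(\<lambda>n. ell2_norm A (\<lambda>m. T (x n) m - T \<xi> m)) \<longlonglongrightarrow> 0"
proof -
  have "\<exists>x. x \<in> fin_supp A \<and> ell2_norm A (wt (\<lambda>m. x m - \<xi> m)) < inverse (real (Suc n))" for n
  proof -
    obtain F where F: "finite F" "F \<subseteq> A" "ell2_norm A (\<lambda>m. wt \<xi> m - trunc F (wt \<xi>) m) < inverse (real (Suc n))"
      using ell2_approx[OF wt_ell2[OF assms], of "inverse (real (Suc n))"] by auto
    have "ell2_norm A (wt (\<lambda>m. trunc F \<xi> m - \<xi> m)) = ell2_norm A (\<lambda>m. trunc F (wt \<xi>) m - wt \<xi> m)"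
      by (rule arg_cong[where f = "ell2_norm A"]) (auto simp: trunc_def algebra_simps)
    then show ?thesis
      using F trunc_in_fin_supp[OF F(1,2), of \<xi>] ell2_norm_diff_commute[of A "wt \<xi>" "trunc F (wt \<xi>)"] by auto
  qed
  then obtain x where x: "\<And>n. x n \<in> fin_supp A"
    "\<And>n. ell2_norm A (wt (\<lambda>m. x n m - \<xi> m)) < inverse (real (Suc n))" by metis
  have d: "(\<lambda>m. x n m - \<xi> m) \<in> E" for n
    by (rule E_diff[OF fin_supp_E[OF x(1)] assms])
  have w0: "(\<lambda>n. ell2_norm A (wt (\<lambda>m. x n m - \<xi> m))) \<longlonglongrightarrow> 0"
    by (rule real_tendsto_sandwich[OF _ _ tendsto_const LIMSEQ_inverse_real_of_nat])
      (intro always_eventually allI, simp, intro always_eventually allI less_imp_le[OF x(2)])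
  show ?thesis
  proof (rule that[OF x(1) w0])
    show "(\<lambda>n. ell2_norm A (\<lambda>m. x n m - \<xi> m)) \<longlonglongrightarrow> 0"
      by (rule real_tendsto_sandwich[OF _ _ tendsto_const w0]) (use E_norm_le_wt[OF d] in auto)
    have "(\<lambda>n. K * ell2_norm A (wt (\<lambda>m. x n m - \<xi> m))) \<longlonglongrightarrow> 0"
      using tendsto_mult_right_zero[OF w0] .
    then show "(\<lambda>n. ell2_norm A (\<lambda>m. T (x n) m - T \<xi> m)) \<longlonglongrightarrow> 0"
      by (rule real_tendsto_sandwich[OF _ _ tendsto_const, rotated 2])
        (use T_bound[OF d] in \<open>auto simp: T_diff assms fin_supp_E x(1)\<close>)
  qed
qed

lemma T_sym_E:
  assumes "\<xi> \<in> E" "\<eta> \<in> E"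
  shows "ell2_vinner A (T \<xi>) \<eta> = ell2_vinner A \<xi> (T \<eta>)"
proof -
  obtain x where xE: "\<And>n::nat. x n \<in> fin_supp A"
    and "(\<lambda>n. ell2_norm A (wt (\<lambda>m. x n m - \<xi> m))) \<longlonglongrightarrow> 0"
    and x: "(\<lambda>n. ell2_norm A (\<lambda>m. x n m - \<xi> m)) \<longlonglongrightarrow> 0"
    "(\<lambda>n. ell2_norm A (\<lambda>m. T (x n) m - T \<xi> m)) \<longlonglongrightarrow> 0" by (rule E_approx[OF assms(1)]) (rule that)
  obtain y where yE: "\<And>n::nat. y n \<in> fin_supp A"
    and "(\<lambda>n. ell2_norm A (wt (\<lambda>m. y n m - \<eta> m))) \<longlonglongrightarrow> 0"
    and y: "(\<lambda>n. ell2_norm A (\<lambda>m. y n m - \<eta> m)) \<longlonglongrightarrow> 0"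
    "(\<lambda>n. ell2_norm A (\<lambda>m. T (y n) m - T \<eta> m)) \<longlonglongrightarrow> 0" by (rule E_approx[OF assms(2)]) (rule that)
  have "(\<lambda>n. ell2_vinner A (T (x n)) (y n)) \<longlonglongrightarrow> ell2_vinner A (T \<xi>) \<eta>"
    using assms x y xE yE by (intro vect.ip_tendsto) (auto intro: T_ell2 E_ell2 fin_supp_E)
  moreover have "(\<lambda>n. ell2_vinner A (x n) (T (y n))) \<longlonglongrightarrow> ell2_vinner A \<xi> (T \<eta>)"
    using assms x y xE yE by (intro vect.ip_tendsto) (auto intro: T_ell2 E_ell2 fin_supp_E)
  ultimately show ?thesis
    using xE yE by (simp add: T_sym LIMSEQ_unique)
qed

lemma T_coercive_E:
  assumes "\<xi> \<in> E"
  shows "ell2_norm A (wt \<xi>) \<le> K * (ell2_norm A (T \<xi>) + ell2_norm A \<xi>)"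
proof -
  obtain x where x: "\<And>n::nat. x n \<in> fin_supp A" "(\<lambda>n. ell2_norm A (wt (\<lambda>m. x n m - \<xi> m))) \<longlonglongrightarrow> 0"
    "(\<lambda>n. ell2_norm A (\<lambda>m. x n m - \<xi> m)) \<longlonglongrightarrow> 0"
    "(\<lambda>n. ell2_norm A (\<lambda>m. T (x n) m - T \<xi> m)) \<longlonglongrightarrow> 0"
    by (rule E_approx[OF assms(1)]) (rule that)
  let ?a = "\<lambda>n. ell2_norm A (wt (\<lambda>m. x n m - \<xi> m))" and ?b = "\<lambda>n. ell2_norm A (\<lambda>m. x n m - \<xi> m)"
    and ?c = "\<lambda>n. ell2_norm A (\<lambda>m. T (x n) m - T \<xi> m)"
  have xE: "x n \<in> E" for n by (simp add: fin_supp_E x(1))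
  have "ell2_norm A (wt \<xi>) \<le> K * ((ell2_norm A (T \<xi>) + ?c n) + (ell2_norm A \<xi> + ?b n)) + ?a n" for n
  proof -
    have "ell2_norm A (wt \<xi>) \<le> ell2_norm A (wt (x n)) + ell2_norm A (\<lambda>m. wt \<xi> m - wt (x n) m)"
      by (rule ell2_norm_triangle_sub) (use wt_ell2 assms xE in auto)
    also have "ell2_norm A (\<lambda>m. wt \<xi> m - wt (x n) m) = ?a n"
      by (subst ell2_norm_diff_commute) (simp add: scaleR_diff_right)
    also have "ell2_norm A (wt (x n)) \<le> K * (ell2_norm A (T (x n)) + ell2_norm A (x n))"
      by (rule T_coercive[OF x(1)])
    also have "\<dots> \<le> K * ((ell2_norm A (T \<xi>) + ?c n) + (ell2_norm A \<xi> + ?b n))"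
      using ell2_norm_triangle_sub[of "T (x n)" A "T \<xi>"] ell2_norm_triangle_sub[of "x n" A \<xi>]
      by (intro mult_left_mono add_mono K_nonneg) (auto simp: T_ell2 E_ell2 assms xE)
    finally show ?thesis by simp
  qed
  moreover have "(\<lambda>n. K * ((ell2_norm A (T \<xi>) + ?c n) + (ell2_norm A \<xi> + ?b n)) + ?a n)
    \<longlonglongrightarrow> K * ((ell2_norm A (T \<xi>) + 0) + (ell2_norm A \<xi> + 0)) + 0"
    by (intro tendsto_intros x)
  ultimately show ?thesis by (auto intro: LIMSEQ_le_const)
qed

section \<open>Compactness of the embedding of the weighted domain\<close>

lemma countable_A: "countable A"
proof -
  have "A = (\<Union>n::nat. {m \<in> A. w m \<le> real n})"
    using real_arch_simple by auto
  moreover have "countable (\<Union>n::nat. {m \<in> A. w m \<le> real n})"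
    using finite_sublevel by (intro countable_UN) (auto intro: countable_finite)
  ultimately show ?thesis by simp
qed

text \<open>A Rellich argument: a subsequence converges pointwise, hence in norm on each finite
  sublevel set of the weight, while off the set where the weight is at most \<open>s\<^sup>2\<close>
  the plain norm is at most \<open>1 / s\<close> times the weighted norm.\<close>

lemma E_compact_embedding:
  assumes "\<And>n. x n \<in> E" "\<And>n. ell2_norm A (wt (x n)) \<le> c"
  obtains r \<xi> where "strict_mono (r :: nat \<Rightarrow> nat)" "\<xi> \<in> E"
    "(\<lambda>n. ell2_norm A (\<lambda>m. x (r n) m - \<xi> m)) \<longlonglongrightarrow> 0"
proof -
  obtain r \<eta> where r: "strict_mono (r :: nat \<Rightarrow> nat)" and lim: "\<And>m. (\<lambda>n. wt (x (r n)) m) \<longlonglongrightarrow> \<eta> m"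
    and \<eta>: "\<eta> \<in> ell2 A" "ell2_norm A \<eta> \<le> c"
    by (rule ell2_pointwise_subseq[where \<xi> = "\<lambda>n. wt (x n)", OF countable_A wt_ell2[OF assms(1)] assms(2)])
      (rule that)
  \<comment> \<open>The diagonal argument was applied to the weighted vectors, so that the limit is
    known to lie in \<open>E\<close>; dividing by the weight recovers the limit of the original
    ones.\<close>
  define \<xi> where "\<xi> m = (if m \<in> A then (1 / sqrt (w m)) *\<^sub>R \<eta> m else 0)" for m
  have pos: "sqrt (w m) > 0" if "m \<in> A" for m using w_ge_1[OF that] by simp
  have wt\<xi>: "wt \<xi> = \<eta>"
  proof
    fix m
    have "m \<in> A \<Longrightarrow> sqrt (w m) * (1 / sqrt (w m)) = 1"
      using pos[of m] by simp
    then show "wt \<xi> m = \<eta> m" using ell2_outside[OF \<eta>(1)] by (auto simp: \<xi>_def simp del: real_sqrt_gt_0_iff)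
  qed
  have \<xi>: "\<xi> \<in> E" by (rule E_I) (use \<eta> in \<open>auto simp: wt\<xi>, simp add: \<xi>_def\<close>)
  have plim: "(\<lambda>n. x (r n) m) \<longlonglongrightarrow> \<xi> m" for m
  proof (cases "m \<in> A")
    case True
    have "(\<lambda>n. (1 / sqrt (w m)) *\<^sub>R wt (x (r n)) m) \<longlonglongrightarrow> (1 / sqrt (w m)) *\<^sub>R \<eta> m"
      by (intro tendsto_intros lim)
    then show ?thesis using True pos[OF True] by (simp add: \<xi>_def)
  next
    case False
    then have "x (r n) m = 0" for n using ell2_outside[OF E_ell2[OF assms(1)]] by simp
    then show ?thesis using False by (simp add: \<xi>_def)
  qed
  let ?y = "\<lambda>n m. x (r n) m - \<xi> m"
  have y: "?y n \<in> E" for n by (intro E_diff assms(1) \<xi>)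
  have yc: "ell2_norm A (wt (?y n)) \<le> 2 * c" for n
  proof -
    have "ell2_norm A (wt (?y n)) = ell2_norm A (\<lambda>m. wt (x (r n)) m - wt \<xi> m)"
      by (simp add: scaleR_diff_right)
    also have "\<dots> \<le> ell2_norm A (wt (x (r n))) + ell2_norm A (wt \<xi>)"
      by (rule ell2_norm_diff_le) (use assms(1) \<xi> wt_ell2 in auto)
    finally show ?thesis using assms(2)[of "r n"] \<eta>(2) wt\<xi> by simp
  qed
  have c: "0 \<le> c" using \<eta>(2) ell2_norm_nonneg[of A \<eta>] by linarith
  have "(\<lambda>n. ell2_norm A (?y n)) \<longlonglongrightarrow> 0"
  proof (rule LIMSEQ_I)
    fix e :: real assume e: "0 < e"
    \<comment> \<open>With this \<open>s\<close> the tail bound \<open>2 * c / s\<close> is below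
      \<open>e / 2\<close>. The summand 1 keeps \<open>s\<close> positive when
      \<open>c = 0\<close>.\<close>
    define s where "s = (4 * c + 1) / e"
    have s: "s > 0" using c e by (simp add: s_def)
    define F where "F = {m \<in> A. w m \<le> s\<^sup>2}"
    have F: "finite F" "F \<subseteq> A" using finite_sublevel by (auto simp: F_def)
    have "(\<lambda>n. L2_set (\<lambda>m. norm (?y n m)) F) \<longlonglongrightarrow> L2_set (\<lambda>m. norm (\<xi> m - \<xi> m)) F"
      unfolding L2_set_def by (intro tendsto_intros plim)
    then have "(\<lambda>n. L2_set (\<lambda>m. norm (?y n m)) F) \<longlonglongrightarrow> 0" by (simp add: L2_set_def)
    then have "\<forall>\<^sub>F n in sequentially. L2_set (\<lambda>m. norm (?y n m)) F < e / 2"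
      using e by (intro order_tendstoD) auto
    then obtain N where N: "\<And>n. n \<ge> N \<Longrightarrow> L2_set (\<lambda>m. norm (?y n m)) F < e / 2"
      by (auto simp: eventually_sequentially)
    have "ell2_norm A (?y n) < e" if "n \<ge> N" for n
    proof -
      have tr: "trunc F (?y n) \<in> ell2 A" by (rule ell2_trunc[OF E_ell2[OF y] F(2)])
      have "ell2_norm A (\<lambda>m. ?y n m - trunc F (?y n) m) \<le> (1 / s) * ell2_norm A (wt (?y n))"
      proof (rule ell2_norm_dominated[OF wt_ell2[OF y]])
        fix m assume m: "m \<in> A"
        show "norm (?y n m - trunc F (?y n) m) \<le> (1 / s) * norm (wt (?y n) m)"
        proof (cases "m \<in> F")
          case False
          then have "s\<^sup>2 \<le> w m" using m by (auto simp: F_def)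
          then have "s \<le> sqrt (w m)" by (rule real_le_rsqrt)
          then have "s * norm (?y n m) \<le> norm (wt (?y n) m)"
            using w_ge_1[OF m] by (simp add: mult_right_mono)
          then show ?thesis using False s by (simp add: trunc_def field_simps)
        qed (use s in \<open>simp add: trunc_def\<close>)
      qed (use s ell2_outside[OF E_ell2[OF y]] F in \<open>auto simp: trunc_def\<close>)
      also have "\<dots> \<le> (1 / s) * (2 * c)" using s yc[of n] by (intro mult_left_mono) auto
      also have "\<dots> < e / 2" using e c by (simp add: s_def field_simps)
      finally have "ell2_norm A (\<lambda>m. ?y n m - trunc F (?y n) m) < e / 2" .
      moreover have "ell2_norm A (trunc F (?y n)) < e / 2"
        using N[OF that] by (simp add: ell2_norm_trunc[OF F])
      ultimately show ?thesis
        using ell2_norm_triangle_sub[OF E_ell2[OF y[of n]] tr] by linarith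
    qed
    then show "\<exists>no. \<forall>n\<ge>no. norm (ell2_norm A (?y n) - 0) < e" by auto
  qed
  then show ?thesis using that[OF r \<xi>] by blast
qed

text \<open>For \<eta> in the adjoint domain with adjoint value \<zeta>, the inner product of
  \<open>T (\<phi> \<eta>)\<close> with \<xi> equals that of \<zeta> with
  \<open>\<phi> \<xi>\<close> minus that of \<eta> with the commutator
  \<open>[T, \<phi>] \<xi>\<close>. By duality \<open>T (\<phi> \<eta>)\<close> is bounded uniformly
  in the cutoff; coercivity then bounds the weighted norms of \<open>\<phi> \<eta>\<close>, and
  lower semicontinuity carries this bound to \<eta>.\<close>

lemma hadjoint_dom_eq: "hadjoint_dom (ell2 A) (ell2_vinner A) E T = E"
proof (intro equalityI subsetI)
  fix \<eta> assume "\<eta> \<in> E"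
  then show "\<eta> \<in> hadjoint_dom (ell2 A) (ell2_vinner A) E T"
    unfolding hadjoint_dom_def using T_sym_E T_ell2 E_ell2 by blast
next
  fix \<eta> assume "\<eta> \<in> hadjoint_dom (ell2 A) (ell2_vinner A) E T"
  then obtain \<zeta> where \<eta>: "\<eta> \<in> ell2 A" and \<zeta>: "\<zeta> \<in> ell2 A"
    and eq: "\<And>\<xi>. \<xi> \<in> E \<Longrightarrow> ell2_vinner A \<zeta> \<xi> = ell2_vinner A \<eta> (T \<xi>)"
    by (auto simp: hadjoint_dom_def)
  let ?y = "\<lambda>n m. \<phi> n m *\<^sub>R \<eta> m"
  have y: "?y n \<in> fin_supp A" for n
  proof -
    have "{m. ?y n m \<noteq> 0} \<subseteq> {m \<in> A. \<phi> n m \<noteq> 0}" using ell2_outside[OF \<eta>] by auto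
    then show ?thesis using cutoff_finite[of n] finite_subset by (auto simp: fin_supp_def)
  qed
  \<comment> \<open>The first summand pays for the pairing with \<zeta>, the second for the
    commutator of \<open>T\<close> with the cutoff.\<close>
  define c where "c = ell2_norm A \<zeta> + M * ell2_norm A \<eta>"
  have Ty: "ell2_norm A (T (?y n)) \<le> c" for n
  proof (rule vect.ell2_norm_le_by_duality)
    show "T (?y n) \<in> ell2 A" by (intro T_ell2 fin_supp_E y)
    show "0 \<le> c" using M_nonneg by (simp add: c_def)
    fix \<xi> :: "'g \<Rightarrow> complex ^ 's" assume \<xi>: "\<xi> \<in> fin_supp A"
    let ?f = "\<lambda>\<xi> m. \<phi> n m *\<^sub>R \<xi> m :: complex ^ 's"
    have f\<xi>: "?f \<xi> \<in> fin_supp A" by (rule fin_supp_pointwise[OF \<xi>]) simp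
    have f_ell2: "?f \<zeta> \<in> ell2 A" and f_norm: "ell2_norm A (?f \<zeta>) \<le> ell2_norm A \<zeta>" if "\<zeta> \<in> ell2 A" for \<zeta>
      using ell2_dominated[OF that, of 1 "?f \<zeta>"] ell2_norm_dominated[OF that, of 1 "?f \<zeta>"] cutoff_range
        ell2_outside[OF that]
      by (auto simp: mult_left_le_one_le)
    let ?C = "\<lambda>m. T (?f \<xi>) m - ?f (T \<xi>) m"
    have T\<xi>: "T \<xi> \<in> ell2 A" "T (?f \<xi>) \<in> ell2 A" using \<xi> f\<xi> by (auto intro: T_ell2 fin_supp_E)
    have C: "?C \<in> ell2 A" by (intro ell2_diff T\<xi> f_ell2)
    have "ell2_vinner A (T (?y n)) \<xi> = ell2_vinner A (?y n) (T \<xi>)"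
      by (rule T_sym[OF y \<xi>])
    also have "\<dots> = ell2_vinner A \<eta> (?f (T \<xi>))"
      by (simp add: ell2_vinner_def)
    also have "\<dots> = ell2_vinner A \<eta> (\<lambda>m. T (?f \<xi>) m - ?C m)" by simp
    also have "\<dots> = ell2_vinner A \<eta> (T (?f \<xi>)) - ell2_vinner A \<eta> ?C"
      by (rule vect.ip_diff_right[OF \<eta> T\<xi>(2) C])
    also have "ell2_vinner A \<eta> (T (?f \<xi>)) = ell2_vinner A \<zeta> (?f \<xi>)"
      by (simp add: eq fin_supp_E f\<xi>)
    finally have "norm (ell2_vinner A (T (?y n)) \<xi>) \<le>
        norm (ell2_vinner A \<zeta> (?f \<xi>)) + norm (ell2_vinner A \<eta> ?C)"
      using norm_triangle_ineq4 by simp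
    also have "norm (ell2_vinner A \<zeta> (?f \<xi>)) \<le> ell2_norm A \<zeta> * ell2_norm A (?f \<xi>)"
      by (rule vect.ip_cauchy_schwarz[OF \<zeta> fin_supp_ell2[OF f\<xi>]])
    also have "\<dots> \<le> ell2_norm A \<zeta> * ell2_norm A \<xi>"
      by (intro mult_left_mono f_norm fin_supp_ell2[OF \<xi>]) simp
    also have "norm (ell2_vinner A \<eta> ?C) \<le> ell2_norm A \<eta> * ell2_norm A ?C"
      by (rule vect.ip_cauchy_schwarz[OF \<eta> C])
    also have "\<dots> \<le> ell2_norm A \<eta> * (M * ell2_norm A \<xi>)"
      by (intro mult_left_mono cutoff_commutator \<xi>) simp
    finally show "norm (ell2_vinner A (T (?y n)) \<xi>) \<le> c * ell2_norm A \<xi>"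
      by (simp add: c_def algebra_simps)
  qed
  have yn: "ell2_norm A (?y n) \<le> ell2_norm A \<eta>" for n
    using ell2_norm_dominated[OF \<eta>, of 1 "?y n"] cutoff_range ell2_outside[OF \<eta>]
    by (auto simp: mult_left_le_one_le)
  have "ell2_norm A (wt (?y n)) \<le> K * (c + ell2_norm A \<eta>)" for n
    using T_coercive[OF y[of n]] mult_left_mono[OF add_mono[OF Ty yn] K_nonneg, of n n] by linarith
  then have ev: "\<forall>\<^sub>F n in sequentially. ell2_norm A (wt (?y n)) \<le> K * (c + ell2_norm A \<eta>)" by simp
  have "(\<lambda>n. wt (?y n) m) \<longlonglongrightarrow> wt \<eta> m" for m
  proof (cases "m \<in> A")
    case True
    have "(\<lambda>n. wt (?y n) m) \<longlonglongrightarrow> sqrt (w m) *\<^sub>R (1 *\<^sub>R \<eta> m)"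
      by (intro tendsto_intros cutoff_limit True)
    then show ?thesis by simp
  qed (simp add: ell2_outside[OF \<eta>])
  with ev have "wt \<eta> \<in> ell2 A"
    by (rule ell2_pointwise_limit[OF wt_ell2[OF fin_supp_E[OF y]]])
  then show "\<eta> \<in> E" using \<eta> by (simp add: E_iff)
qed

lemma self_adjoint_T: "self_adjoint A E T"
  unfolding self_adjoint_def densely_defined_def
proof (intro conjI ballI allI impI)
  show "hadjoint (ell2 A) (ell2_vinner A) E T \<eta> = T \<eta>" if "\<eta> \<in> E" for \<eta>
    by (rule vect.hadjoint_eqI) (use that T_sym_E T_ell2 E_ell2 fin_supp_E in auto)
  fix \<eta> :: "'g \<Rightarrow> complex ^ 's" and e :: real assume "\<eta> \<in> ell2 A" "0 < e"
  then obtain F where "finite F" "F \<subseteq> A" "ell2_norm A (\<lambda>m. \<eta> m - trunc F \<eta> m) < e"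
    using ell2_approx by blast
  then show "\<exists>\<xi>\<in>E. ell2_norm A (\<lambda>m. \<eta> m - \<xi> m) < e"
    using fin_supp_E[OF trunc_in_fin_supp] by blast
qed (use hadjoint_dom_eq T_add T_cmul T_ell2 E_ell2 E_zero E_add E_cmul in auto)

section \<open>The resolvent at the imaginary unit\<close>

lemma norm_T_plus_imaginary:
  assumes "\<xi> \<in> E"
  shows "(ell2_norm A (\<lambda>m. T \<xi> m + (\<i> * of_real t) *s \<xi> m))\<^sup>2 = (ell2_norm A (T \<xi>))\<^sup>2 + t\<^sup>2 * (ell2_norm A \<xi>)\<^sup>2"
proof -
  \<comment> \<open>By symmetry this number is real, so its product with an imaginary scalar
    contributes nothing to the real cross term.\<close>
  have "ell2_vinner A (T \<xi>) \<xi> = cnj (ell2_vinner A (T \<xi>) \<xi>)"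
    using T_sym_E[OF assms assms] vect.ip_cnj[of A \<xi> "T \<xi>"] by simp
  then have "Im (ell2_vinner A (T \<xi>) \<xi>) = 0" by (simp add: complex_eq_iff)
  then have "Re (ell2_vinner A (T \<xi>) (\<lambda>m. (\<i> * of_real t) *s \<xi> m)) = 0"
    by (subst vect.ip_sm_right) simp
  then show ?thesis
    using vect.ell2_norm_add_power2[OF T_ell2[OF assms] vect.ell2_sm[OF E_ell2[OF assms]], of "\<i> * of_real t"]
    by (simp add: vect.ell2_norm_sm power_mult_distrib norm_mult)
qed

lemma norm_T_minus_i:
  "\<xi> \<in> E \<Longrightarrow> (ell2_norm A (\<lambda>m. T \<xi> m - \<i> *s \<xi> m))\<^sup>2 = (ell2_norm A (T \<xi>))\<^sup>2 + (ell2_norm A \<xi>)\<^sup>2"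
  using norm_T_plus_imaginary[of \<xi> "-1"] by (simp add: vector_scalar_mult_def)
    (simp add: minus_vec_def plus_vec_def)

text \<open>\<open>T\<close> is unbounded for the plain norm, but each coordinate of
  \<open>T \<xi>\<close> is the inner product of \<xi> with the fixed vector
  \<open>T \<delta>\<close>, where \<delta> is a coordinate vector. That is continuous in
  \<xi>.\<close>

lemma T_pointwise_tendsto:
  assumes "\<And>n. x n \<in> E" "\<xi> \<in> E" "(\<lambda>n. ell2_norm A (\<lambda>m. x n m - \<xi> m)) \<longlonglongrightarrow> 0"
  shows "(\<lambda>n. T (x n) m) \<longlonglongrightarrow> T \<xi> m"
proof (cases "m \<in> A")
  case True
  show ?thesis
  proof (rule vec_tendstoI)
    fix i
    define \<delta> :: "'g \<Rightarrow> complex ^ 's" where "\<delta> = (\<lambda>p. if p = m then axis i 1 else 0)"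
    have \<delta>: "\<delta> \<in> fin_supp A" using True by (auto simp: fin_supp_def \<delta>_def)
    have eval: "ell2_vinner A \<delta> \<zeta> = \<zeta> m $ i" for \<zeta>
    proof -
      have *: "(\<Sum>j\<in>UNIV. cnj (axis i 1 $ j) * \<zeta> m $ j) = \<zeta> m $ i"
        by (simp add: axis_def if_distrib[of cnj] if_distrib[of "\<lambda>x. x * _"] cong: if_cong)
      have "ell2_vinner A \<delta> \<zeta> = (\<Sum>\<^sub>\<infinity>p\<in>{m}. \<Sum>j\<in>UNIV. cnj (\<delta> p $ j) * \<zeta> p $ j)"
        unfolding ell2_vinner_def using True by (intro infsum_cong_neutral) (auto simp: \<delta>_def)
      then show ?thesis using * by (simp add: \<delta>_def)
    qed
    have "(\<lambda>n. ell2_vinner A (T \<delta>) (x n)) \<longlonglongrightarrow> ell2_vinner A (T \<delta>) \<xi>"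
      using assms \<delta> by (intro vect.ip_tendsto) (auto intro: T_ell2 E_ell2 fin_supp_E)
    then show "(\<lambda>n. T (x n) m $ i) \<longlonglongrightarrow> T \<xi> m $ i"
      by (simp add: T_sym_E fin_supp_E \<delta> assms eval)
  qed
qed (simp add: ell2_outside[OF T_ell2] assms)

text \<open>The distance from \<eta> to the range of \<open>T - \<i>\<close> is attained, because
  minimising sequences are bounded in the weighted norm and hence precompact. The residual at a
  minimiser is orthogonal to the range, so it lies in the adjoint domain, which is \<open>E\<close>,
  and is annihilated by the injective operator \<open>T + \<i>\<close>.\<close>

lemma T_minus_i_surj:
  assumes \<eta>: "\<eta> \<in> ell2 A"
  shows "\<exists>\<xi>\<in>E. (\<lambda>m. T \<xi> m - \<i> *s \<xi> m) = \<eta>"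
proof -
  define L where "L \<xi> = (\<lambda>m. T \<xi> m - \<i> *s \<xi> m)" for \<xi>
  have L: "L \<xi> \<in> ell2 A" if "\<xi> \<in> E" for \<xi>
    unfolding L_def using that by (intro ell2_diff vect.ell2_sm T_ell2 E_ell2)
  have L_add: "L (\<lambda>m. \<xi> m + \<zeta> m) = (\<lambda>m. L \<xi> m + L \<zeta> m)" if "\<xi> \<in> E" "\<zeta> \<in> E" for \<xi> \<zeta>
    using that by (simp add: L_def T_add add_diff_add)
  have L_cmul: "L (\<lambda>m. a *s \<xi> m) = (\<lambda>m. a *s L \<xi> m)" if "\<xi> \<in> E" for \<xi> a
    using that by (simp add: L_def T_cmul vector_ssub_ldistrib vector_smult_assoc mult.commute)
  define N where "N \<xi> = ell2_norm A (\<lambda>m. L \<xi> m - \<eta> m)" for \<xi>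
  define \<mu> where "\<mu> = (INF \<xi>\<in>E. N \<xi>)"
  have bdd: "bdd_below (N ` E)" by (rule bdd_belowI2[of _ 0]) (simp add: N_def)
  have \<mu>_le: "\<mu> \<le> N \<xi>" if "\<xi> \<in> E" for \<xi>
    unfolding \<mu>_def by (rule cINF_lower[OF bdd that])
  have \<mu>_nonneg: "0 \<le> \<mu>"
    unfolding \<mu>_def using E_zero by (intro cINF_greatest) (auto simp: N_def)
  have "\<exists>x\<in>E. N x < \<mu> + inverse (real (Suc n))" for n
  proof -
    have "Inf (N ` E) < \<mu> + inverse (real (Suc n))" by (simp add: \<mu>_def)
    then show ?thesis using cInf_lessD[of "N ` E"] E_zero by blast
  qed
  then obtain x where xE: "\<And>n. x n \<in> E" and xN: "\<And>n. N (x n) < \<mu> + inverse (real (Suc n))" by metis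
  \<comment> \<open>The squared norm of \<open>L x\<close> is the sum of the squared norms of
    \<open>T x\<close> and \<open>x\<close>; both are therefore bounded along the minimising
    sequence, and coercivity applies.\<close>
  have wb: "ell2_norm A (wt (x n)) \<le> K * (2 * (\<mu> + 1 + ell2_norm A \<eta>))" for n
  proof -
    have "ell2_norm A (L (x n)) \<le> ell2_norm A \<eta> + N (x n)"
      unfolding N_def by (rule ell2_norm_triangle_sub[OF L[OF xE] \<eta>])
    moreover have "inverse (real (Suc n)) \<le> 1" by (simp add: inverse_le_1_iff)
    ultimately have Lb: "ell2_norm A (L (x n)) \<le> \<mu> + 1 + ell2_norm A \<eta>" using xN[of n] by linarith
    have sq: "(ell2_norm A (L (x n)))\<^sup>2 = (ell2_norm A (T (x n)))\<^sup>2 + (ell2_norm A (x n))\<^sup>2"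
      unfolding L_def by (rule norm_T_minus_i[OF xE])
    have "ell2_norm A (T (x n)) \<le> ell2_norm A (L (x n))" "ell2_norm A (x n) \<le> ell2_norm A (L (x n))"
      by (rule power2_le_imp_le; simp add: sq)+
    then have "ell2_norm A (T (x n)) + ell2_norm A (x n) \<le> 2 * (\<mu> + 1 + ell2_norm A \<eta>)"
      unfolding mult_2 by (intro add_mono) (rule order_trans[OF _ Lb], assumption)+
    from mult_left_mono[OF this K_nonneg] T_coercive_E[OF xE[of n]] show ?thesis by linarith
  qed
  obtain r \<xi> where r: "strict_mono (r :: nat \<Rightarrow> nat)" and \<xi>: "\<xi> \<in> E"
    and lim: "(\<lambda>n. ell2_norm A (\<lambda>m. x (r n) m - \<xi> m)) \<longlonglongrightarrow> 0"
    by (rule E_compact_embedding[of x, OF xE wb])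
  have plim: "(\<lambda>n. x (r n) m) \<longlonglongrightarrow> \<xi> m" for m
  proof -
    have "(\<lambda>n. x (r n) m - \<xi> m) \<longlonglongrightarrow> 0"
      by (rule Lim_null_comparison[OF _ lim])
        (intro always_eventually allI norm_le_ell2_norm[of "\<lambda>m. x (r _) m - \<xi> m"] E_ell2 E_diff xE \<xi>)
    then show ?thesis by (simp add: LIM_zero_iff)
  qed
  have "(\<lambda>n. L (x (r n)) m - \<eta> m) \<longlonglongrightarrow> L \<xi> m - \<eta> m" for m
    unfolding L_def vector_scalar_mult_def
    by (intro tendsto_intros T_pointwise_tendsto[OF xE \<xi> lim] plim)
  note Llim = this
  \<comment> \<open>The images \<open>L (x (r n))\<close> are known to converge only pointwise.
    Lower semicontinuity of the norm is enough, since only an upper bound for the distance at \<xi>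
    is wanted.\<close>
  have "N \<xi> \<le> \<mu> + e" if "e > 0" for e
    unfolding N_def
  proof (rule ell2_norm_pointwise_limit[OF ell2_diff[OF L[OF xE] \<eta>] _ Llim])
    obtain n0 where n0: "inverse (real (Suc n0)) < e" using reals_Archimedean[OF \<open>e > 0\<close>] by blast
    have "ell2_norm A (\<lambda>m. L (x (r n)) m - \<eta> m) \<le> \<mu> + e" if "n \<ge> n0" for n
    proof -
      have "r n \<ge> n0" using seq_suble[OF r, of n] that by linarith
      then have "inverse (real (Suc (r n))) \<le> inverse (real (Suc n0))" by (intro le_imp_inverse_le) auto
      then show ?thesis using xN[of "r n"] n0 unfolding N_def by linarith
    qed
    then show "\<forall>\<^sub>F n in sequentially. ell2_norm A (\<lambda>m. L (x (r n)) m - \<eta> m) \<le> \<mu> + e"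
      by (auto simp: eventually_sequentially)
  qed
  then have N\<xi>: "N \<xi> \<le> \<mu>" by (rule field_le_epsilon)
  define \<rho> where "\<rho> = (\<lambda>m. L \<xi> m - \<eta> m)"
  have \<rho>: "\<rho> \<in> ell2 A" unfolding \<rho>_def by (intro ell2_diff L \<xi> \<eta>)
  \<comment> \<open>The first variation at the minimiser: the distance cannot decrease along the
    line from \<xi> in the direction \<zeta>.\<close>
  have Re0: "Re (ell2_vinner A \<rho> (L \<zeta>)) = 0" if \<zeta>: "\<zeta> \<in> E" for \<zeta>
  proof (rule quadratic_nonneg_imp_linear_zero)
    show "0 \<le> (ell2_norm A (L \<zeta>))\<^sup>2" by simp
    fix t :: real
    have E: "(\<lambda>m. \<xi> m + of_real t *s \<zeta> m) \<in> E" by (intro E_add E_cmul \<xi> \<zeta>)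
    have "L (\<lambda>m. \<xi> m + of_real t *s \<zeta> m) = (\<lambda>m. L \<xi> m + of_real t *s L \<zeta> m)"
      using L_add[OF \<xi> E_cmul[OF \<zeta>]] L_cmul[OF \<zeta>] by simp
    then have "N (\<lambda>m. \<xi> m + of_real t *s \<zeta> m) = ell2_norm A (\<lambda>m. \<rho> m + of_real t *s L \<zeta> m)"
      by (simp add: N_def \<rho>_def algebra_simps)
    moreover have "ell2_norm A \<rho> = N \<xi>" by (simp add: N_def \<rho>_def)
    ultimately have "ell2_norm A \<rho> \<le> ell2_norm A (\<lambda>m. \<rho> m + of_real t *s L \<zeta> m)"
      using \<mu>_le[OF E] N\<xi> by simp
    then have "(ell2_norm A \<rho>)\<^sup>2 \<le> (ell2_norm A (\<lambda>m. \<rho> m + of_real t *s L \<zeta> m))\<^sup>2"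
      by (rule power_mono) simp
    also have "\<dots> = (ell2_norm A \<rho>)\<^sup>2 + 2 * Re (ell2_vinner A \<rho> (\<lambda>m. of_real t *s L \<zeta> m))
        + (ell2_norm A (\<lambda>m. of_real t *s L \<zeta> m))\<^sup>2"
      by (rule vect.ell2_norm_add_power2[OF \<rho> vect.ell2_sm[OF L[OF \<zeta>]]])
    finally show "0 \<le> 2 * t * Re (ell2_vinner A \<rho> (L \<zeta>)) + t\<^sup>2 * (ell2_norm A (L \<zeta>))\<^sup>2"
      by (simp add: vect.ip_sm_right vect.ell2_norm_sm power_mult_distrib)
  qed
  \<comment> \<open>Real variations see only the real part; the direction
    \<open>\<i> *s \<zeta>\<close> supplies the imaginary part.\<close>
  have orth: "ell2_vinner A \<rho> (L \<zeta>) = 0" if \<zeta>: "\<zeta> \<in> E" for \<zeta>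
    using Re0[OF \<zeta>] Re0[OF E_cmul[OF \<zeta>], of \<i>] by (simp add: L_cmul[OF \<zeta>] vect.ip_sm_right complex_eq_iff)
  have adj: "ell2_vinner A (\<lambda>m. (- \<i>) *s \<rho> m) \<zeta> = ell2_vinner A \<rho> (T \<zeta>)" if \<zeta>: "\<zeta> \<in> E" for \<zeta>
  proof -
    have "ell2_vinner A \<rho> (L \<zeta>) = ell2_vinner A \<rho> (T \<zeta>) - \<i> * ell2_vinner A \<rho> \<zeta>"
      unfolding L_def using \<zeta> \<rho>
      by (simp add: vect.ip_diff_right T_ell2 E_ell2 vect.ell2_sm vect.ip_sm_right)
    then have "ell2_vinner A \<rho> (T \<zeta>) = \<i> * ell2_vinner A \<rho> \<zeta>" using orth[OF \<zeta>] by simp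
    then show ?thesis by (simp only: vect.ip_sm_left) simp
  qed
  \<comment> \<open>Orthogonality says that the adjoint sends \<rho> to \<open>- \<i>\<close> times
    \<rho>. Equality of the domains makes this an eigenvalue equation for \<open>T\<close> itself,
    which the norm identity for \<open>T + \<i>\<close> rules out unless \<rho> vanishes.\<close>
  have "\<rho> \<in> hadjoint_dom (ell2 A) (ell2_vinner A) E T"
    unfolding hadjoint_dom_def using \<rho> adj vect.ell2_sm[OF \<rho>, of "- \<i>"] by blast
  then have \<rho>E: "\<rho> \<in> E" by (simp add: hadjoint_dom_eq)
  have "T \<rho> = (\<lambda>m. (- \<i>) *s \<rho> m)"
    by (rule vect.ip_eq_imp_eq[of _ A])
      (use adj fin_supp_E T_sym_E[OF \<rho>E] T_ell2[OF \<rho>E] vect.ell2_sm[OF \<rho>, of "- \<i>"] in auto)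
  then have "(ell2_norm A (\<lambda>m. T \<rho> m + (\<i> * of_real 1) *s \<rho> m))\<^sup>2 = 0"
    by (simp add: vector_scalar_mult_def) (simp add: zero_vec_def plus_vec_def flip: zero_vec_def)
  then have "ell2_norm A \<rho> = 0"
    unfolding norm_T_plus_imaginary[OF \<rho>E] by (simp add: sum_power2_eq_zero_iff)
  then have "\<rho> m = 0" for m using norm_le_ell2_norm[OF \<rho>, of m] by simp
  then have "L \<xi> m = \<eta> m" for m by (simp add: \<rho>_def)
  then have "L \<xi> = \<eta>" by (rule ext)
  with \<xi> show ?thesis unfolding L_def by blast
qed

lemma i_in_resolvent_set: "\<i> \<in> resolvent_set A E T"
proof -
  have b: "ell2_norm A \<xi> \<le> 1 * ell2_norm A (\<lambda>m. T \<xi> m - \<i> *s \<xi> m)" if "\<xi> \<in> E" for \<xi>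
    using power2_le_imp_le[of "ell2_norm A \<xi>" "ell2_norm A (\<lambda>m. T \<xi> m - \<i> *s \<xi> m)"]
    by (simp add: norm_T_minus_i[OF that])
  have "inj_on (\<lambda>\<xi> m. T \<xi> m - \<i> *s \<xi> m) E"
  proof (rule inj_onI)
    fix x y assume xy: "x \<in> E" "y \<in> E" "(\<lambda>m. T x m - \<i> *s x m) = (\<lambda>m. T y m - \<i> *s y m)"
    let ?z = "\<lambda>m. x m - y m"
    have "(\<lambda>m. T ?z m - \<i> *s ?z m) = (\<lambda>m. (T x m - \<i> *s x m) - (T y m - \<i> *s y m))"
      using xy(1,2) by (simp add: T_diff vector_ssub_ldistrib algebra_simps)
    also have "\<dots> = (\<lambda>m. 0)" using fun_cong[OF xy(3)] by simp
    finally have "ell2_norm A ?z \<le> 0" using b[OF E_diff[OF xy(1,2)]] by simp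
    then have "norm (x m - y m) \<le> 0" for m
      using norm_le_ell2_norm[OF E_ell2[OF E_diff[OF xy(1,2)]], of m] by linarith
    then show "x = y" by auto
  qed
  moreover have "(\<lambda>\<xi> m. T \<xi> m - \<i> *s \<xi> m) ` E = ell2 A"
  proof (intro equalityI subsetI)
    fix \<eta> :: "'g \<Rightarrow> complex ^ 's" assume "\<eta> \<in> ell2 A"
    then show "\<eta> \<in> (\<lambda>\<xi> m. T \<xi> m - \<i> *s \<xi> m) ` E" using T_minus_i_surj by blast
  qed (auto intro: ell2_diff[OF T_ell2 vect.ell2_sm[OF E_ell2]])
  ultimately show ?thesis
    unfolding resolvent_set_def bij_betw_def using b by blast
qed

text \<open>For any \<open>z\<close> in the resolvent set, the preimages of a bounded sequence under
  \<open>T - z\<close> are bounded, hence so are their images under \<open>T\<close>. Coercivity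
  bounds them in the weighted norm and the compact embedding gives the subsequence.\<close>

lemma compact_resolvent_T: "compact_resolvent A E T"
  unfolding compact_resolvent_def
proof (intro conjI ballI)
  show "resolvent_set A E T \<noteq> {}" using i_in_resolvent_set by blast
  fix z assume z: "z \<in> resolvent_set A E T"
  let ?L = "\<lambda>\<xi> m. T \<xi> m - z *s \<xi> m"
  obtain C where bij: "bij_betw ?L E (ell2 A)" and C: "\<And>\<xi>. \<xi> \<in> E \<Longrightarrow> ell2_norm A \<xi> \<le> C * ell2_norm A (?L \<xi>)"
    using z by (auto simp: resolvent_set_def)
  show "compact_operator A (resolvent E T z)"
    unfolding compact_operator_def
  proof (intro allI impI)
    fix \<zeta> :: "nat \<Rightarrow> 'g \<Rightarrow> complex ^ 's"
    assume \<zeta>: "\<forall>n. \<zeta> n \<in> ell2 A \<and> ell2_norm A (\<zeta> n) \<le> 1"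
    let ?x = "\<lambda>n. resolvent E T z (\<zeta> n)"
    have x: "?x n \<in> E" and Lx: "?L (?x n) = \<zeta> n" for n
      using bij \<zeta> unfolding resolvent_def bij_betw_def
      by (auto intro: inv_into_into f_inv_into_f[where f = ?L])
    \<comment> \<open>The constant in \<open>resolvent_set\<close> comes without a sign, hence the
      absolute value.\<close>
    have xb: "ell2_norm A (?x n) \<le> \<bar>C\<bar>" for n
    proof -
      have "ell2_norm A (?x n) \<le> C * ell2_norm A (\<zeta> n)" using C[OF x, of n] by (simp add: Lx)
      also have "\<dots> \<le> \<bar>C\<bar> * 1" using \<zeta> by (intro mult_mono) auto
      finally show ?thesis by simp
    qed
    have Tb: "ell2_norm A (T (?x n)) \<le> 1 + norm z * \<bar>C\<bar>" for n
    proof -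
      have "T (?x n) = (\<lambda>m. \<zeta> n m + z *s ?x n m)" using Lx[of n] by (auto simp: fun_eq_iff algebra_simps)
      then have "ell2_norm A (T (?x n)) \<le> ell2_norm A (\<zeta> n) + ell2_norm A (\<lambda>m. z *s ?x n m)"
        using ell2_norm_triangle[of "\<zeta> n" A "\<lambda>m. z *s ?x n m"] \<zeta> vect.ell2_sm[OF E_ell2[OF x]] by simp
      also have "ell2_norm A (\<lambda>m. z *s ?x n m) = norm z * ell2_norm A (?x n)" by (rule vect.ell2_norm_sm)
      finally show ?thesis using \<zeta> mult_left_mono[OF xb[of n], of "norm z"] by (smt (verit) norm_ge_zero)
    qed
    have "ell2_norm A (wt (?x n)) \<le> K * (1 + norm z * \<bar>C\<bar> + \<bar>C\<bar>)" for n
      using T_coercive_E[OF x[of n]] mult_left_mono[OF add_mono[OF Tb xb] K_nonneg, of n n] by linarith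
    note wb = this
    obtain r \<xi> where "strict_mono (r :: nat \<Rightarrow> nat)" "\<xi> \<in> E"
      "(\<lambda>n. ell2_norm A (\<lambda>m. ?x (r n) m - \<xi> m)) \<longlonglongrightarrow> 0"
      by (rule E_compact_embedding[of ?x, OF x wb])
    then show "\<exists>r \<eta>. strict_mono r \<and> \<eta> \<in> ell2 A \<and>
      (\<lambda>n. ell2_norm A (\<lambda>m. resolvent E T z (\<zeta> (r n)) m - \<eta> m)) \<longlonglongrightarrow> 0"
      by (intro exI[of _ r] exI[of _ \<xi>]) (simp add: E_ell2)
  qed
qed

end

section \<open>Vector-valued lifts of scalar operators\<close>

definition coord :: "'s \<Rightarrow> ('g \<Rightarrow> complex ^ 's) \<Rightarrow> 'g \<Rightarrow> complex" where
  "coord i \<xi> = (\<lambda>m. \<xi> m $ i)"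

text \<open>This is \<open>T\<close> tensored with the identity. By \<open>tensor_op_eq\<close> the
  matrix acts afterwards and pointwise, so the two tensor factors can be treated separately.\<close>

definition lift :: "'g op \<Rightarrow> ('g \<Rightarrow> complex ^ 's) \<Rightarrow> 'g \<Rightarrow> complex ^ 's" where
  "lift T \<xi> = (\<lambda>m. \<chi> i. T (coord i \<xi>) m)"

lemma tensor_op_eq: "tensor_op T M \<xi> = (\<lambda>m. M *v lift T \<xi> m)"
  by (simp add: tensor_op_def lift_def coord_def)

lemma coord_lift: "coord i (lift T \<xi>) = T (coord i \<xi>)"
  by (simp add: coord_def lift_def)

lemma coord_ell2:
  assumes "\<xi> \<in> ell2 A"
  shows "coord i \<xi> \<in> ell2 A"
  by (rule ell2_dominated[OF assms, of 1])
    (use ell2_outside[OF assms] Finite_Cartesian_Product.norm_nth_le in \<open>auto simp: coord_def\<close>)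

lemma has_sum_finite_sum:
  fixes f :: "'i \<Rightarrow> 'a \<Rightarrow> 'b::topological_comm_monoid_add"
  assumes "\<And>i. i \<in> I \<Longrightarrow> (f i has_sum s i) A"
  shows "((\<lambda>m. \<Sum>i\<in>I. f i m) has_sum (\<Sum>i\<in>I. s i)) A"
  using assms by (induction I rule: infinite_finite_induct) (auto intro: has_sum_add)

lemma summable_on_finite_sum:
  fixes f :: "'i \<Rightarrow> 'a \<Rightarrow> 'b::topological_comm_monoid_add"
  assumes "\<And>i. i \<in> I \<Longrightarrow> f i summable_on A"
  shows "(\<lambda>m. \<Sum>i\<in>I. f i m) summable_on A"
  using assms by (induction I rule: infinite_finite_induct) (auto intro: summable_on_add)

lemma infsum_finite_sum:
  fixes f :: "'i \<Rightarrow> 'a \<Rightarrow> 'b::{topological_comm_monoid_add, t2_space}"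
  assumes "\<And>i. i \<in> I \<Longrightarrow> f i summable_on A"
  shows "(\<Sum>\<^sub>\<infinity>m\<in>A. \<Sum>i\<in>I. f i m) = (\<Sum>i\<in>I. \<Sum>\<^sub>\<infinity>m\<in>A. f i m)"
  using assms by (intro infsumI has_sum_finite_sum has_sum_infsum)

lemma matrix_uminus_mult: "(- M) *v v = - (M *v v)" for M :: "'a::ring_1 ^ 'n ^ 'm"
  by (simp add: matrix_vector_mult_def vec_eq_iff sum_negf)

lemma matrix_mult_scaleR: "M *v (r *\<^sub>R v) = r *\<^sub>R (M *v v)" for M :: "complex ^ 'n ^ 'm"
  by (simp add: matrix_vector_mult_def vec_eq_iff scaleR_sum_right)

lemma norm_vec_power2: "(norm (v :: complex ^ 's))\<^sup>2 = (\<Sum>i\<in>UNIV. (norm (v $ i))\<^sup>2)"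
  by (simp add: norm_vec_def L2_set_def sum_nonneg)

lemma ell2_coordI:
  assumes "\<And>i. coord i \<xi> \<in> ell2 A"
  shows "\<xi> \<in> ell2 A"
proof -
  have "\<xi> m = 0" if "m \<notin> A" for m
    using ell2_outside[OF assms that] by (simp add: coord_def vec_eq_iff)
  moreover have "(\<lambda>m. (norm (\<xi> m))\<^sup>2) summable_on A"
    unfolding norm_vec_power2
    by (rule summable_on_finite_sum) (use assms in \<open>auto simp: ell2_def coord_def\<close>)
  ultimately show ?thesis by (simp add: ell2_def)
qed

lemma ell2_norm_power2_coord:
  assumes "\<xi> \<in> ell2 A"
  shows "(ell2_norm A \<xi>)\<^sup>2 = (\<Sum>i\<in>UNIV. (ell2_norm A (coord i \<xi>))\<^sup>2)"
  unfolding ell2_norm_power2 norm_vec_power2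
  using coord_ell2[OF assms] by (subst infsum_finite_sum) (auto simp: ell2_def coord_def)

lemma ell2_vinner_coord:
  assumes "\<xi> \<in> ell2 A" "\<eta> \<in> ell2 A"
  shows "ell2_vinner A \<xi> \<eta> = (\<Sum>i\<in>UNIV. ell2_inner A (coord i \<xi>) (coord i \<eta>))"
  unfolding ell2_vinner_def ell2_inner_def coord_def
  by (rule infsum_finite_sum) (use scal.g_summable'[OF coord_ell2[OF assms(1)] coord_ell2[OF assms(2)]] in \<open>simp add: coord_def\<close>)

lemma
  assumes "\<zeta> \<in> ell2 A" "0 \<le> c" "\<And>i. coord i \<eta> \<in> ell2 A"
    and "\<And>i. ell2_norm A (coord i \<eta>) \<le> c * ell2_norm A (coord i \<zeta>)"
  shows ell2_norm_coord_le: "ell2_norm A \<eta> \<le> c * ell2_norm A \<zeta>"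
proof (rule power2_le_imp_le)
  have "(ell2_norm A \<eta>)\<^sup>2 = (\<Sum>i\<in>UNIV. (ell2_norm A (coord i \<eta>))\<^sup>2)"
    by (intro ell2_norm_power2_coord ell2_coordI assms)
  also have "\<dots> \<le> (\<Sum>i\<in>UNIV. (c * ell2_norm A (coord i \<zeta>))\<^sup>2)"
    by (intro sum_mono power_mono assms) simp
  also have "\<dots> = (c * ell2_norm A \<zeta>)\<^sup>2"
    by (simp add: power_mult_distrib ell2_norm_power2_coord[OF assms(1)] sum_distrib_left)
  finally show "(ell2_norm A \<eta>)\<^sup>2 \<le> (c * ell2_norm A \<zeta>)\<^sup>2" .
qed (use assms in simp)

definition madj :: "complex ^ 's ^ 's \<Rightarrow> complex ^ 's ^ 's" where
  "madj M = map_matrix cnj (transpose M)"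

lemma vec_cinner_mult: "vec_cinner (M *v u) v = vec_cinner u (madj M *v v)"
proof -
  have "vec_cinner (M *v u) v = (\<Sum>i\<in>UNIV. \<Sum>k\<in>UNIV. cnj (M $ i $ k) * cnj (u $ k) * v $ i)"
    by (simp add: vec_cinner_def matrix_vector_mult_def sum_distrib_right)
  also have "\<dots> = (\<Sum>k\<in>UNIV. \<Sum>i\<in>UNIV. cnj (M $ i $ k) * cnj (u $ k) * v $ i)"
    by (rule sum.swap)
  also have "\<dots> = vec_cinner u (madj M *v v)"
    by (simp add: vec_cinner_def madj_def matrix_vector_mult_def map_matrix_def transpose_def
        sum_distrib_left mult_ac)
  finally show ?thesis .
qed

lemma ell2_vinner_mat: "ell2_vinner A (\<lambda>m. M *v \<xi> m) \<eta> = ell2_vinner A \<xi> (\<lambda>m. madj M *v \<eta> m)"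
  by (simp add: vect.ip_eq vec_cinner_mult)

text \<open>Linearity is relative to a set because operators built from \<open>hadjoint\<close> are
  given by a definite description and have controlled values only on the Hilbert space or on a
  domain.\<close>

definition lin_on :: "('g \<Rightarrow> complex) set \<Rightarrow> 'g op \<Rightarrow> bool" where
  "lin_on S T \<longleftrightarrow> (\<forall>\<xi>\<in>S. \<forall>\<eta>\<in>S. T (\<lambda>m. \<xi> m + \<eta> m) = (\<lambda>m. T \<xi> m + T \<eta> m)) \<and>
     (\<forall>a. \<forall>\<xi>\<in>S. T (\<lambda>m. a * \<xi> m) = (\<lambda>m. a * T \<xi> m))"

definition csubspace :: "('g \<Rightarrow> complex) set \<Rightarrow> bool" where
  "csubspace S \<longleftrightarrow> (\<lambda>m. 0) \<in> S \<and> (\<forall>\<xi>\<in>S. \<forall>\<eta>\<in>S. (\<lambda>m. \<xi> m + \<eta> m) \<in> S) \<and>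
     (\<forall>a. \<forall>\<xi>\<in>S. (\<lambda>m. a * \<xi> m) \<in> S)"

lemma lin_on_sum:
  assumes "csubspace S" "lin_on S T" "finite K" "\<And>k. k \<in> K \<Longrightarrow> \<xi> k \<in> S"
  shows "(\<lambda>m. \<Sum>k\<in>K. a k * \<xi> k m) \<in> S \<and>
    T (\<lambda>m. \<Sum>k\<in>K. a k * \<xi> k m) = (\<lambda>m. \<Sum>k\<in>K. a k * T (\<xi> k) m)"
  using assms(3,4)
proof (induction K)
  case empty
  have z: "(\<lambda>m. 0) \<in> S" using assms(1) by (simp add: csubspace_def)
  have "\<And>a \<xi>. \<xi> \<in> S \<Longrightarrow> T (\<lambda>m. a * \<xi> m) = (\<lambda>m. a * T \<xi> m)"
    using assms(2) by (simp add: lin_on_def)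
  from this[OF z, of 0] show ?case by (simp add: z)
next
  case (insert k K)
  let ?r = "\<lambda>m. \<Sum>k\<in>K. a k * \<xi> k m" and ?s = "\<lambda>m. a k * \<xi> k m"
  have r: "?r \<in> S" "T ?r = (\<lambda>m. \<Sum>k\<in>K. a k * T (\<xi> k) m)" using insert by auto
  have s: "?s \<in> S" "T ?s = (\<lambda>m. a k * T (\<xi> k) m)"
    using assms(1,2) insert.prems[of k] by (auto simp: csubspace_def lin_on_def)
  have "(\<lambda>m. ?s m + ?r m) \<in> S" using assms(1) r s by (auto simp: csubspace_def)
  moreover have "T (\<lambda>m. ?s m + ?r m) = (\<lambda>m. T ?s m + T ?r m)"
    using assms(2) r s by (auto simp: lin_on_def)
  ultimately show ?case using insert.hyps by (simp add: r s)
qed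

text \<open>The coordinates of \<open>M *v \<xi> m\<close> are finite linear combinations of those
  of \<xi>, and these stay in the subspace on which \<open>T\<close> is linear.\<close>

lemma lift_mat:
  assumes "csubspace S" "lin_on S T" "\<And>i. coord i \<xi> \<in> S"
  shows "lift T (\<lambda>m. M *v \<xi> m) = (\<lambda>m. M *v lift T \<xi> m)"
proof -
  have "coord i (\<lambda>m. M *v \<xi> m) = (\<lambda>m. \<Sum>k\<in>UNIV. M $ i $ k * coord k \<xi> m)" for i
    by (simp add: coord_def matrix_vector_mult_def)
  then show ?thesis
    using lin_on_sum[OF assms(1,2), of UNIV "\<lambda>k. coord k \<xi>"] assms(3)
    by (simp add: lift_def matrix_vector_mult_def)
qed

lemma lift_add:
  assumes "lin_on S T" "\<And>i. coord i \<xi> \<in> S" "\<And>i. coord i \<eta> \<in> S"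
  shows "lift T (\<lambda>m. \<xi> m + \<eta> m) = (\<lambda>m. lift T \<xi> m + lift T \<eta> m)"
proof -
  have "coord i (\<lambda>m. \<xi> m + \<eta> m) = (\<lambda>m. coord i \<xi> m + coord i \<eta> m)" for i by (simp add: coord_def)
  then show ?thesis using assms by (auto simp: lift_def lin_on_def vec_eq_iff fun_eq_iff[of "\<lambda>m. \<chi> i. _ i m"])
qed

lemma lift_cmul:
  assumes "lin_on S T" "\<And>i. coord i \<xi> \<in> S"
  shows "lift T (\<lambda>m. a *s \<xi> m) = (\<lambda>m. a *s lift T \<xi> m)"
proof -
  have "coord i (\<lambda>m. a *s \<xi> m) = (\<lambda>m. a * coord i \<xi> m)" for i by (simp add: coord_def)
  then show ?thesis using assms by (auto simp: lift_def lin_on_def vec_eq_iff fun_eq_iff[of "\<lambda>m. \<chi> i. _ i m"])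
qed

section \<open>First-order operators with Clifford coefficients\<close>

definition deriv_op :: "('g \<Rightarrow> real) \<Rightarrow> 'g op" where
  "deriv_op y = (\<lambda>\<xi> m. \<i> * of_real (y m) * \<xi> m)"

text \<open>A hat function of the l1-length of the coordinates: slope \<open>1 / (n + 1)\<close>,
  vanishing from length \<open>n + 1\<close> on. Both numbers matter in
  \<open>cutoff_difference_bound\<close>, where they compensate each other.\<close>

definition cutoff :: "nat set \<Rightarrow> (nat \<Rightarrow> 'g \<Rightarrow> real) \<Rightarrow> nat \<Rightarrow> 'g \<Rightarrow> real" where
  "cutoff J x n m = max 0 (1 - (\<Sum>j\<in>J. \<bar>x j m\<bar>) / real (Suc n))"

definition sobolev :: "'g set \<Rightarrow> ('g \<Rightarrow> real) \<Rightarrow> ('g \<Rightarrow> complex) set" where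
  "sobolev A w = {\<xi> \<in> ell2 A. (\<lambda>m. sqrt (w m) *\<^sub>R \<xi> m) \<in> ell2 A}"

lemma csubspace_sobolev: "csubspace (sobolev A w)"
  unfolding csubspace_def
proof (intro conjI ballI allI)
  fix \<xi> \<eta> assume "\<xi> \<in> sobolev A w" "\<eta> \<in> sobolev A w"
  then show "(\<lambda>m. \<xi> m + \<eta> m) \<in> sobolev A w"
    using ell2_add[of "\<lambda>m. sqrt (w m) *\<^sub>R \<xi> m" A "\<lambda>m. sqrt (w m) *\<^sub>R \<eta> m"]
    by (simp add: sobolev_def ell2_add scaleR_add_right)
next
  fix a \<xi> assume "\<xi> \<in> sobolev A w"
  then show "(\<lambda>m. a * \<xi> m) \<in> sobolev A w"
    using scal.ell2_sm[of "\<lambda>m. sqrt (w m) *\<^sub>R \<xi> m" A a]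
    by (simp add: sobolev_def scal.ell2_sm)
qed (simp add: sobolev_def)

lemma coord_fin_supp: "\<xi> \<in> fin_supp A \<Longrightarrow> coord i \<xi> \<in> fin_supp A"
  unfolding fin_supp_def coord_def
  by (auto intro: finite_subset[of _ "{m. \<xi> m \<noteq> 0}"])

text \<open>\<open>Ls\<close> indexes all summands and \<open>L\<close> the unbounded ones;
  \<open>C l\<close> bounds \<open>\<Gamma> l\<close> in the weighted norm, its commutators with
  cutoffs and, for \<open>l\<close> outside \<open>L\<close>, \<open>\<Gamma> l\<close> itself. The
  two decisive hypotheses are \<open>Gamma_commutator\<close>, by which commutators of principal
  terms lose one order, and \<open>Gamma_elliptic\<close>. The factor 4 comes from
  \<open>first_order_commutator\<close>.\<close>

locale first_order_family =
  fixes A :: "'g set" and J :: "nat set" and x :: "nat \<Rightarrow> 'g \<Rightarrow> real"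
    and Ls L :: "nat set" and \<Gamma> :: "nat \<Rightarrow> 'g op" and \<gamma> :: "nat \<Rightarrow> complex ^ 's ^ 's"
    and C :: "nat \<Rightarrow> real" and w :: "'g \<Rightarrow> real"
  assumes w_eq: "w = (\<lambda>m. 1 + (\<Sum>j\<in>J. (x j m)\<^sup>2))"
    and finite_sublevel: "finite {m \<in> A. w m \<le> r}"
    and finite_J: "finite J" and finite_Ls: "finite Ls" and L_subset: "L \<subseteq> Ls"
    and C_nonneg: "l \<in> Ls \<Longrightarrow> 0 \<le> C l"
    and Gamma_lin: "l \<in> Ls \<Longrightarrow> lin_on (sobolev A w) (\<Gamma> l)"
    and Gamma_ell2: "l \<in> Ls \<Longrightarrow> \<xi> \<in> sobolev A w \<Longrightarrow> \<Gamma> l \<xi> \<in> ell2 A"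
    and Gamma_bound: "l \<in> Ls \<Longrightarrow> \<xi> \<in> sobolev A w \<Longrightarrow>
      ell2_norm A (\<Gamma> l \<xi>) \<le> C l * ell2_norm A (\<lambda>m. sqrt (w m) *\<^sub>R \<xi> m)"
    and Gamma_skew: "l \<in> Ls \<Longrightarrow> \<xi> \<in> fin_supp A \<Longrightarrow> \<eta> \<in> fin_supp A \<Longrightarrow>
      ell2_inner A (\<Gamma> l \<xi>) \<eta> = - ell2_inner A \<xi> (\<Gamma> l \<eta>)"
    and Gamma_cutoff: "l \<in> Ls \<Longrightarrow> \<xi> \<in> fin_supp A \<Longrightarrow>
      ell2_norm A (\<lambda>m. \<Gamma> l (\<lambda>m. cutoff J x n m *\<^sub>R \<xi> m) m - cutoff J x n m *\<^sub>R \<Gamma> l \<xi> m)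
        \<le> C l * ell2_norm A \<xi>"
    and Gamma_lower_order: "l \<in> Ls - L \<Longrightarrow> \<xi> \<in> fin_supp A \<Longrightarrow> ell2_norm A (\<Gamma> l \<xi>) \<le> C l * ell2_norm A \<xi>"
    and Gamma_fin_supp: "l \<in> L \<Longrightarrow> \<xi> \<in> fin_supp A \<Longrightarrow> \<Gamma> l \<xi> \<in> fin_supp A"
    and Gamma_commutator: "l \<in> L \<Longrightarrow> l' \<in> L \<Longrightarrow> \<xi> \<in> fin_supp A \<Longrightarrow>
      (ell2_norm A (\<lambda>m. \<Gamma> l (\<Gamma> l' \<xi>) m - \<Gamma> l' (\<Gamma> l \<xi>) m))\<^sup>2
        \<le> 4 * (\<Sum>j\<in>J. (ell2_norm A (deriv_op (x j) \<xi>))\<^sup>2)"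
    and Gamma_elliptic: "\<xi> \<in> fin_supp A \<Longrightarrow>
      (\<Sum>j\<in>J. (ell2_norm A (deriv_op (x j) \<xi>))\<^sup>2) \<le> (\<Sum>l\<in>L. (ell2_norm A (\<Gamma> l \<xi>))\<^sup>2)"
    and gamma_skew: "l \<in> Ls \<Longrightarrow> madj (\<gamma> l) = - \<gamma> l"
    and gamma_square: "l \<in> Ls \<Longrightarrow> \<gamma> l ** \<gamma> l = - mat 1"
    and gamma_anticommute: "l \<in> Ls \<Longrightarrow> l' \<in> Ls \<Longrightarrow> l \<noteq> l' \<Longrightarrow> \<gamma> l ** \<gamma> l' = - (\<gamma> l' ** \<gamma> l)"
begin

section \<open>Symmetry and boundedness of the Dirac sum\<close>

definition dirac :: "('g \<Rightarrow> complex ^ 's) \<Rightarrow> 'g \<Rightarrow> complex ^ 's" where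
  "dirac \<xi> = (\<lambda>m. \<Sum>l\<in>Ls. tensor_op (\<Gamma> l) (\<gamma> l) \<xi> m)"

definition vdom :: "('g \<Rightarrow> complex ^ 's) set" where
  "vdom = {\<xi> \<in> ell2 A. (\<lambda>m. w m * (norm (\<xi> m))\<^sup>2) summable_on A}"

abbreviation wgt :: "('g \<Rightarrow> 'v::real_vector) \<Rightarrow> 'g \<Rightarrow> 'v" where
  "wgt \<xi> \<equiv> (\<lambda>m. sqrt (w m) *\<^sub>R \<xi> m)"

lemma w_ge_1: "1 \<le> w m"
  by (simp add: w_eq sum_nonneg)

lemma vdom_iff: "\<xi> \<in> vdom \<longleftrightarrow> \<xi> \<in> ell2 A \<and> wgt \<xi> \<in> ell2 A"
proof -
  have "0 \<le> w m" for m using w_ge_1[of m] by linarith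
  then have "w m * (norm (\<xi> m))\<^sup>2 = (norm (wgt \<xi> m))\<^sup>2" for m
    by (simp add: power_mult_distrib)
  then show ?thesis by (auto simp: vdom_def ell2_def)
qed

lemma coord_wt: "coord i (wgt \<xi>) = wgt (coord i \<xi>)"
  by (simp add: coord_def)

lemma coord_sobolev: "\<xi> \<in> vdom \<Longrightarrow> coord i \<xi> \<in> sobolev A w"
  using coord_ell2[of "wgt \<xi>" A i] by (simp add: sobolev_def vdom_iff coord_ell2 coord_wt)

lemma fin_supp_vdom: "\<xi> \<in> fin_supp A \<Longrightarrow> \<xi> \<in> vdom"
  using fin_supp_pointwise[of \<xi> A "wgt \<xi>"] by (auto simp: vdom_iff intro!: fin_supp_ell2)

text \<open>A skew matrix of square -1 is unitary: moving one factor across the inner product gives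
  minus its square.\<close>

lemma gamma_isometry:
  assumes "l \<in> Ls"
  shows "norm (\<gamma> l *v v) = norm v"
proof -
  have "vec_cinner (\<gamma> l *v v) (\<gamma> l *v v) = vec_cinner v (- (\<gamma> l *v (\<gamma> l *v v)))"
    by (simp add: vec_cinner_mult gamma_skew assms matrix_uminus_mult)
  also have "- (\<gamma> l *v (\<gamma> l *v v)) = v"
    by (simp add: matrix_vector_mul_assoc gamma_square assms matrix_uminus_mult)
  finally have "complex_of_real ((norm (\<gamma> l *v v))\<^sup>2) = of_real ((norm v)\<^sup>2)"
    by (simp only: vect.g_self)
  then show ?thesis by (simp add: of_real_eq_iff del: of_real_power)
qed

lemma
  assumes "l \<in> Ls"
  shows gamma_ell2: "\<xi> \<in> ell2 A \<Longrightarrow> (\<lambda>m. \<gamma> l *v \<xi> m) \<in> ell2 A"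
    and gamma_ell2_norm: "ell2_norm A (\<lambda>m. \<gamma> l *v \<xi> m) = ell2_norm A \<xi>"
  using gamma_isometry[OF assms, of "\<xi> _"] gamma_isometry[OF assms]
  by (auto simp: ell2_def ell2_norm_def)

lemma gamma_fin_supp: "\<xi> \<in> fin_supp A \<Longrightarrow> (\<lambda>m. M *v \<xi> m) \<in> fin_supp A"
  by (erule fin_supp_pointwise) simp

lemma vinner_gamma:
  assumes "l \<in> Ls"
  shows "ell2_vinner A (\<lambda>m. \<gamma> l *v \<xi> m) \<eta> = - ell2_vinner A \<xi> (\<lambda>m. \<gamma> l *v \<eta> m)"
  by (simp add: ell2_vinner_mat gamma_skew assms matrix_uminus_mult vect.ip_uminus)

lemma lift_Gamma_ell2: "l \<in> Ls \<Longrightarrow> \<xi> \<in> vdom \<Longrightarrow> lift (\<Gamma> l) \<xi> \<in> ell2 A"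
  by (rule ell2_coordI) (simp add: coord_lift Gamma_ell2 coord_sobolev)

lemma lift_Gamma_fin_supp:
  assumes "l \<in> L" "\<xi> \<in> fin_supp A"
  shows "lift (\<Gamma> l) \<xi> \<in> fin_supp A"
proof -
  have c: "coord i (lift (\<Gamma> l) \<xi>) \<in> fin_supp A" for i
    using assms by (simp add: coord_lift Gamma_fin_supp coord_fin_supp)
  have "{m. lift (\<Gamma> l) \<xi> m \<noteq> 0} = (\<Union>i. {m. coord i (lift (\<Gamma> l) \<xi>) m \<noteq> 0})"
    by (auto simp: coord_def vec_eq_iff)
  then show ?thesis using c by (auto simp: fin_supp_def)
qed

lemma lift_Gamma_skew:
  fixes \<xi> \<eta> :: "'g \<Rightarrow> complex ^ 's"
  assumes "l \<in> Ls" "\<xi> \<in> fin_supp A" "\<eta> \<in> fin_supp A"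
  shows "ell2_vinner A (lift (\<Gamma> l) \<xi>) \<eta> = - ell2_vinner A \<xi> (lift (\<Gamma> l) \<eta>)"
proof -
  have G: "lift (\<Gamma> l) \<xi> \<in> ell2 A" "lift (\<Gamma> l) \<eta> \<in> ell2 A"
    using assms by (auto intro: lift_Gamma_ell2 fin_supp_vdom)
  have "ell2_vinner A (lift (\<Gamma> l) \<xi>) \<eta> = (\<Sum>i\<in>UNIV. ell2_inner A (\<Gamma> l (coord i \<xi>)) (coord i \<eta>))"
    using G assms by (simp add: ell2_vinner_coord fin_supp_ell2 coord_lift)
  also have "\<dots> = (\<Sum>i\<in>UNIV. - ell2_inner A (coord i \<xi>) (\<Gamma> l (coord i \<eta>)))"
    using assms by (intro sum.cong refl Gamma_skew coord_fin_supp)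
  also have "\<dots> = - ell2_vinner A \<xi> (lift (\<Gamma> l) \<eta>)"
    using G assms by (simp add: ell2_vinner_coord fin_supp_ell2 coord_lift sum_negf)
  finally show ?thesis .
qed

lemma lift_Gamma_mat:
  assumes "l \<in> Ls" "\<xi> \<in> vdom"
  shows "lift (\<Gamma> l) (\<lambda>m. M *v \<xi> m) = (\<lambda>m. M *v lift (\<Gamma> l) \<xi> m)"
  by (rule lift_mat[OF csubspace_sobolev Gamma_lin[OF assms(1)] coord_sobolev[OF assms(2)]])

lemma tensor_Gamma_ell2: "l \<in> Ls \<Longrightarrow> \<xi> \<in> vdom \<Longrightarrow> tensor_op (\<Gamma> l) (\<gamma> l) \<xi> \<in> ell2 A"
  by (simp add: tensor_op_eq gamma_ell2 lift_Gamma_ell2)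

lemma dirac_ell2: "\<xi> \<in> vdom \<Longrightarrow> dirac \<xi> \<in> ell2 A"
  unfolding dirac_def by (intro ell2_sum tensor_Gamma_ell2)

lemma dirac_add:
  assumes "\<xi> \<in> vdom" "\<eta> \<in> vdom"
  shows "dirac (\<lambda>m. \<xi> m + \<eta> m) = (\<lambda>m. dirac \<xi> m + dirac \<eta> m)"
  unfolding dirac_def sum.distrib[symmetric] tensor_op_eq
  by (intro ext sum.cong refl)
    (simp add: lift_add[OF Gamma_lin coord_sobolev coord_sobolev] assms matrix_vector_right_distrib)

lemma dirac_cmul:
  assumes "\<xi> \<in> vdom"
  shows "dirac (\<lambda>m. a *s \<xi> m) = (\<lambda>m. a *s dirac \<xi> m)"
  unfolding dirac_def tensor_op_eq vector_space_over_itself.scale_sum_right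
proof (rule ext)
  fix m
  have "(\<Sum>l\<in>Ls. \<gamma> l *v lift (\<Gamma> l) (\<lambda>m. a *s \<xi> m) m) = (\<Sum>l\<in>Ls. a *s (\<gamma> l *v lift (\<Gamma> l) \<xi> m))"
    by (intro sum.cong refl)
      (simp add: lift_cmul[OF Gamma_lin coord_sobolev] assms vector_scalar_commute)
  also have "\<dots> = a *s (\<Sum>l\<in>Ls. \<gamma> l *v lift (\<Gamma> l) \<xi> m)"
    by (simp add: vec_eq_iff sum_distrib_left)
  finally show "(\<Sum>l\<in>Ls. \<gamma> l *v lift (\<Gamma> l) (\<lambda>m. a *s \<xi> m) m) = a *s (\<Sum>l\<in>Ls. \<gamma> l *v lift (\<Gamma> l) \<xi> m)" .
qed

lemma norm_tensor_le:
  assumes "l \<in> Ls" "\<xi> \<in> vdom" "\<zeta> \<in> ell2 A" "0 \<le> c"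
    and "\<And>i. ell2_norm A (\<Gamma> l (coord i \<xi>)) \<le> c * ell2_norm A (coord i \<zeta>)"
  shows "ell2_norm A (tensor_op (\<Gamma> l) (\<gamma> l) \<xi>) \<le> c * ell2_norm A \<zeta>"
  unfolding tensor_op_eq gamma_ell2_norm[OF assms(1)]
  by (rule ell2_norm_coord_le) (use assms in \<open>auto simp: coord_lift Gamma_ell2 coord_sobolev\<close>)

lemma dirac_bound:
  assumes "\<xi> \<in> vdom"
  shows "ell2_norm A (dirac \<xi>) \<le> (\<Sum>l\<in>Ls. C l) * ell2_norm A (wgt \<xi>)"
proof -
  have "ell2_norm A (dirac \<xi>) \<le> (\<Sum>l\<in>Ls. ell2_norm A (tensor_op (\<Gamma> l) (\<gamma> l) \<xi>))"
    unfolding dirac_def by (intro ell2_norm_sum tensor_Gamma_ell2 assms)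
  also have "\<dots> \<le> (\<Sum>l\<in>Ls. C l * ell2_norm A (wgt \<xi>))"
  proof (intro sum_mono norm_tensor_le)
    fix l i assume "l \<in> Ls"
    then show "ell2_norm A (\<Gamma> l (coord i \<xi>)) \<le> C l * ell2_norm A (coord i (wgt \<xi>))"
      unfolding coord_wt by (intro Gamma_bound coord_sobolev assms)
  qed (use assms C_nonneg in \<open>auto simp: vdom_iff\<close>)
  finally show ?thesis by (simp add: sum_distrib_right)
qed

text \<open>The operator and its Clifford matrix are both skew and act on different tensor factors,
  so they commute and the two signs cancel.\<close>

lemma dirac_sym:
  assumes "\<xi> \<in> fin_supp A" "\<eta> \<in> fin_supp A"
  shows "ell2_vinner A (dirac \<xi>) \<eta> = ell2_vinner A \<xi> (dirac \<eta>)"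
proof -
  have "ell2_vinner A (tensor_op (\<Gamma> l) (\<gamma> l) \<xi>) \<eta> = ell2_vinner A \<xi> (tensor_op (\<Gamma> l) (\<gamma> l) \<eta>)"
    if l: "l \<in> Ls" for l
    using lift_Gamma_skew[OF l assms(1) gamma_fin_supp[OF assms(2), of "\<gamma> l"]]
    by (simp add: tensor_op_eq vinner_gamma l lift_Gamma_mat fin_supp_vdom assms)
  then show ?thesis
    unfolding dirac_def
    by (simp add: vect.ip_sum_left vect.ip_sum_right fin_supp_ell2 assms tensor_Gamma_ell2 fin_supp_vdom)
qed

section \<open>Coercivity\<close>

lemma finite_L: "finite L"
  using finite_subset[OF L_subset finite_Ls] .

definition energy :: "('g \<Rightarrow> complex ^ 's) \<Rightarrow> real" where
  "energy \<xi> = (\<Sum>j\<in>J. \<Sum>i\<in>UNIV. (ell2_norm A (deriv_op (x j) (coord i \<xi>)))\<^sup>2)"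

lemma energy_nonneg: "0 \<le> energy \<xi>"
  by (simp add: energy_def sum_nonneg)

text \<open>Since the weight is 1 plus the sum of the squares of the coordinates, this is a
  pointwise identity, summed over the group and over the vector components.\<close>

lemma norm_wt_power2:
  assumes "\<xi> \<in> fin_supp A"
  shows "(ell2_norm A (wgt \<xi>))\<^sup>2 = (ell2_norm A \<xi>)\<^sup>2 + energy \<xi>"
proof -
  have scalar: "(ell2_norm A (wgt \<eta>))\<^sup>2
      = (ell2_norm A \<eta>)\<^sup>2 + (\<Sum>j\<in>J. (ell2_norm A (deriv_op (x j) \<eta>))\<^sup>2)"
    if \<eta>: "\<eta> \<in> fin_supp A" for \<eta> :: "'g \<Rightarrow> complex"
  proof -
    have s: "(\<lambda>m. (norm (\<eta> m))\<^sup>2) summable_on A" "(\<lambda>m. (norm (deriv_op y \<eta> m))\<^sup>2) summable_on A" for y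
      using fin_supp_ell2[OF \<eta>] fin_supp_ell2[OF fin_supp_pointwise[OF \<eta>, of "deriv_op y \<eta>"]]
      by (auto simp: ell2_def deriv_op_def)
    have "(norm (wgt \<eta> m))\<^sup>2 = (norm (\<eta> m))\<^sup>2 + (\<Sum>j\<in>J. (norm (deriv_op (x j) \<eta> m))\<^sup>2)" for m
    proof -
      have "(norm (wgt \<eta> m))\<^sup>2 = w m * (norm (\<eta> m))\<^sup>2"
        using w_ge_1[of m] by (simp add: power_mult_distrib)
      then show ?thesis
        by (simp add: w_eq deriv_op_def norm_mult power_mult_distrib distrib_right sum_distrib_right)
    qed
    then have "(ell2_norm A (wgt \<eta>))\<^sup>2 = (\<Sum>\<^sub>\<infinity>m\<in>A. (norm (\<eta> m))\<^sup>2 + (\<Sum>j\<in>J. (norm (deriv_op (x j) \<eta> m))\<^sup>2))"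
      by (simp add: ell2_norm_power2)
    also have "\<dots> = (\<Sum>\<^sub>\<infinity>m\<in>A. (norm (\<eta> m))\<^sup>2) + (\<Sum>\<^sub>\<infinity>m\<in>A. \<Sum>j\<in>J. (norm (deriv_op (x j) \<eta> m))\<^sup>2)"
      by (intro infsum_add summable_on_finite_sum s)
    also have "(\<Sum>\<^sub>\<infinity>m\<in>A. \<Sum>j\<in>J. (norm (deriv_op (x j) \<eta> m))\<^sup>2)
        = (\<Sum>j\<in>J. \<Sum>\<^sub>\<infinity>m\<in>A. (norm (deriv_op (x j) \<eta> m))\<^sup>2)"
      by (intro infsum_finite_sum s)
    finally show ?thesis by (simp add: ell2_norm_power2)
  qed
  have "(ell2_norm A (wgt \<xi>))\<^sup>2 = (\<Sum>i\<in>UNIV. (ell2_norm A (wgt (coord i \<xi>)))\<^sup>2)"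
    using ell2_norm_power2_coord[of "wgt \<xi>" A] fin_supp_vdom[OF assms]
    by (simp add: vdom_iff coord_wt)
  also have "\<dots> = (\<Sum>i\<in>UNIV. (ell2_norm A (coord i \<xi>))\<^sup>2)
      + (\<Sum>i\<in>UNIV. \<Sum>j\<in>J. (ell2_norm A (deriv_op (x j) (coord i \<xi>)))\<^sup>2)"
    by (simp add: scalar coord_fin_supp assms sum.distrib)
  finally show ?thesis
    using ell2_norm_power2_coord[OF fin_supp_ell2[OF assms]]
    unfolding energy_def by (subst sum.swap) simp
qed

definition principal :: "('g \<Rightarrow> complex ^ 's) \<Rightarrow> 'g \<Rightarrow> complex ^ 's" where
  "principal \<xi> = (\<lambda>m. \<Sum>l\<in>L. tensor_op (\<Gamma> l) (\<gamma> l) \<xi> m)"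

text \<open>Pairing the terms \<open>(l, l')\<close> and \<open>(l', l)\<close> of the square of the principal part turns the
  product of two first-order operators into their commutator, which is again of first order.\<close>

lemma principal_lower_bound:
  assumes \<xi>: "\<xi> \<in> fin_supp A"
  shows "energy \<xi> \<le> (ell2_norm A (principal \<xi>))\<^sup>2 + (real (card L))\<^sup>2 * (ell2_norm A \<xi> * sqrt (energy \<xi>))"
proof -
  let ?t = "\<lambda>l. tensor_op (\<Gamma> l) (\<gamma> l) \<xi>"
  let ?G = "\<lambda>l. lift (\<Gamma> l)"
  define a where "a l l' = Re (ell2_vinner A (?t l) (?t l'))" for l l'
  have LLs: "l \<in> Ls" if "l \<in> L" for l using that L_subset by blast
  have t: "?t l \<in> ell2 A" if "l \<in> L" for l
    by (intro tensor_Gamma_ell2 fin_supp_vdom \<xi> LLs that)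
  have diag: "a l l = (ell2_norm A (?G l \<xi>))\<^sup>2" if "l \<in> L" for l
    by (simp add: a_def vect.ip_self t that del: of_real_power)
      (simp add: tensor_op_eq gamma_ell2_norm LLs that)
  have off: "- 2 * (ell2_norm A \<xi> * sqrt (energy \<xi>)) \<le> a l l' + a l' l"
    if ll: "l \<in> L" "l' \<in> L" "l \<noteq> l'" for l l'
  proof -
    \<comment> \<open>Moving the \<open>p\<close>-th term across costs one sign for the matrix and
      one for the operator. Both products now act on the right-hand vector, so the terms for
      \<open>(p, q)\<close> and \<open>(q, p)\<close> can be compared through anticommutation of the
      matrices.\<close>
    have term_eq: "ell2_vinner A (?t p) (?t q) = ell2_vinner A \<xi> (\<lambda>m. (\<gamma> p ** \<gamma> q) *v ?G p (?G q \<xi>) m)"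
      if "p \<in> L" "q \<in> L" for p q
    proof -
      have G: "?G q \<xi> \<in> fin_supp A" by (rule lift_Gamma_fin_supp[OF that(2) \<xi>])
      have "ell2_vinner A (?t p) (?t q) = - ell2_vinner A (?G p \<xi>) (\<lambda>m. (\<gamma> p ** \<gamma> q) *v ?G q \<xi> m)"
        by (simp add: tensor_op_eq vinner_gamma LLs that matrix_vector_mul_assoc)
      also have "\<dots> = ell2_vinner A \<xi> (?G p (\<lambda>m. (\<gamma> p ** \<gamma> q) *v ?G q \<xi> m))"
        by (simp add: lift_Gamma_skew LLs that \<xi> gamma_fin_supp G)
      also have "?G p (\<lambda>m. (\<gamma> p ** \<gamma> q) *v ?G q \<xi> m) = (\<lambda>m. (\<gamma> p ** \<gamma> q) *v ?G p (?G q \<xi>) m)"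
        by (intro lift_Gamma_mat LLs that fin_supp_vdom G)
      finally show ?thesis .
    qed
    let ?K = "\<lambda>m. ?G l (?G l' \<xi>) m - ?G l' (?G l \<xi>) m"
    have GG: "?G p (?G q \<xi>) \<in> fin_supp A" if "p \<in> L" "q \<in> L" for p q
      by (intro lift_Gamma_fin_supp that \<xi>)
    have mG: "(\<lambda>m. M *v ?G p (?G q \<xi>) m) \<in> ell2 A" if "p \<in> L" "q \<in> L" for p q M
      by (intro fin_supp_ell2 gamma_fin_supp GG that)
    have K: "?K \<in> ell2 A" by (intro ell2_diff fin_supp_ell2 GG ll)
    have "ell2_vinner A (?t l) (?t l') + ell2_vinner A (?t l') (?t l)
        = ell2_vinner A \<xi> (\<lambda>m. (\<gamma> l ** \<gamma> l') *v ?G l (?G l' \<xi>) m)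
        + ell2_vinner A \<xi> (\<lambda>m. - ((\<gamma> l ** \<gamma> l') *v ?G l' (?G l \<xi>) m))"
      using gamma_anticommute[of l' l] ll
      by (simp add: term_eq LLs matrix_uminus_mult)
    also have "\<dots> = ell2_vinner A \<xi> (\<lambda>m. (\<gamma> l ** \<gamma> l') *v ?G l (?G l' \<xi>) m
        + - ((\<gamma> l ** \<gamma> l') *v ?G l' (?G l \<xi>) m))"
      by (intro vect.ip_add_right[symmetric] ell2_uminus mG ll fin_supp_ell2 \<xi>)
    also have "(\<lambda>m. (\<gamma> l ** \<gamma> l') *v ?G l (?G l' \<xi>) m + - ((\<gamma> l ** \<gamma> l') *v ?G l' (?G l \<xi>) m))
        = (\<lambda>m. \<gamma> l *v (\<gamma> l' *v ?K m))"
      by (simp add: matrix_vector_mul_assoc matrix_vector_mult_diff_distrib)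
    finally have "norm (ell2_vinner A (?t l) (?t l') + ell2_vinner A (?t l') (?t l))
        \<le> ell2_norm A \<xi> * ell2_norm A ?K"
      using vect.ip_cauchy_schwarz[OF fin_supp_ell2[OF \<xi>] gamma_ell2[OF LLs gamma_ell2[OF LLs K]], of l l'] ll
      by (simp add: gamma_ell2_norm LLs)
    moreover have "ell2_norm A ?K \<le> 2 * sqrt (energy \<xi>)"
    proof -
      have "(ell2_norm A ?K)\<^sup>2 = (\<Sum>i\<in>UNIV. (ell2_norm A (coord i ?K))\<^sup>2)"
        by (rule ell2_norm_power2_coord[OF K])
      also have "\<dots> \<le> (\<Sum>i\<in>UNIV. 4 * (\<Sum>j\<in>J. (ell2_norm A (deriv_op (x j) (coord i \<xi>)))\<^sup>2))"
      proof (intro sum_mono)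
        fix i
        have "coord i ?K = (\<lambda>m. \<Gamma> l (\<Gamma> l' (coord i \<xi>)) m - \<Gamma> l' (\<Gamma> l (coord i \<xi>)) m)"
          by (simp add: coord_def lift_def)
        then show "(ell2_norm A (coord i ?K))\<^sup>2 \<le> 4 * (\<Sum>j\<in>J. (ell2_norm A (deriv_op (x j) (coord i \<xi>)))\<^sup>2)"
          using Gamma_commutator[OF ll(1,2) coord_fin_supp[OF \<xi>]] by simp
      qed
      also have "\<dots> = 4 * energy \<xi>"
        unfolding energy_def sum_distrib_left[symmetric] by (subst sum.swap) simp
      also have "\<dots> = (2 * sqrt (energy \<xi>))\<^sup>2"
        by (simp add: power_mult_distrib energy_nonneg)
      finally show ?thesis
        by (rule power2_le_imp_le) (simp add: energy_nonneg)
    qed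
    ultimately have "norm (ell2_vinner A (?t l) (?t l') + ell2_vinner A (?t l') (?t l))
        \<le> ell2_norm A \<xi> * (2 * sqrt (energy \<xi>))"
      using mult_left_mono[of "ell2_norm A ?K" "2 * sqrt (energy \<xi>)" "ell2_norm A \<xi>"] by simp
    then show ?thesis
      using abs_Re_le_cmod[of "ell2_vinner A (?t l) (?t l') + ell2_vinner A (?t l') (?t l)"]
      by (simp add: a_def)
  qed
  have "energy \<xi> = (\<Sum>i\<in>UNIV. \<Sum>j\<in>J. (ell2_norm A (deriv_op (x j) (coord i \<xi>)))\<^sup>2)"
    unfolding energy_def by (rule sum.swap)
  also have "\<dots> \<le> (\<Sum>i\<in>UNIV. \<Sum>l\<in>L. (ell2_norm A (\<Gamma> l (coord i \<xi>)))\<^sup>2)"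
    by (intro sum_mono Gamma_elliptic coord_fin_supp \<xi>)
  also have "\<dots> = (\<Sum>l\<in>L. \<Sum>i\<in>UNIV. (ell2_norm A (\<Gamma> l (coord i \<xi>)))\<^sup>2)"
    by (rule sum.swap)
  also have "\<dots> = (\<Sum>l\<in>L. a l l)"
    by (intro sum.cong refl)
      (simp add: diag ell2_norm_power2_coord lift_Gamma_ell2 LLs fin_supp_vdom \<xi> coord_lift)
  finally have e1: "energy \<xi> \<le> (\<Sum>l\<in>L. a l l)" .
  let ?s = "ell2_norm A \<xi> * sqrt (energy \<xi>)"
  have "(ell2_norm A (principal \<xi>))\<^sup>2 = Re (ell2_vinner A (principal \<xi>) (principal \<xi>))"
    by (simp add: vect.ip_self principal_def ell2_sum t del: of_real_power)
  also have "\<dots> = (\<Sum>l\<in>L. \<Sum>l'\<in>L. a l l')"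
    unfolding principal_def
    by (simp add: vect.ip_sum_left vect.ip_sum_right ell2_sum t a_def)
  finally have "2 * (ell2_norm A (principal \<xi>))\<^sup>2 = (\<Sum>l\<in>L. \<Sum>l'\<in>L. a l l' + a l' l)"
    by (simp add: sum.distrib) (rule sum.swap)
  \<comment> \<open>The loss \<open>2 * ?s\<close> is granted to every ordered pair, the diagonal
    included, where it is harmless. This is the source of the factor
    \<open>(card L)\<^sup>2\<close>.\<close>
  moreover have "(\<Sum>l\<in>L. \<Sum>l'\<in>L. (if l = l' then 2 * a l l else 0) - 2 * ?s) \<le> (\<Sum>l\<in>L. \<Sum>l'\<in>L. a l l' + a l' l)"
  proof (intro sum_mono)
    fix l l' assume ll: "l \<in> L" "l' \<in> L"
    have "0 \<le> ?s" by (intro mult_nonneg_nonneg) (simp_all add: energy_nonneg)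
    then show "(if l = l' then 2 * a l l else 0) - 2 * ?s \<le> a l l' + a l' l"
      using off[OF ll] by (cases "l = l'") simp_all
  qed
  moreover have "(\<Sum>l\<in>L. \<Sum>l'\<in>L. (if l = l' then 2 * a l l else 0) - 2 * ?s)
      = 2 * (\<Sum>l\<in>L. a l l) - 2 * ((real (card L))\<^sup>2 * ?s)"
    using finite_L by (simp add: sum_subtractf power2_eq_square sum_distrib_left mult_ac)
  ultimately show ?thesis using e1 by linarith
qed

text \<open>With \<open>S\<close> the sum of the \<open>C l\<close> and \<open>c\<close> the square
  of \<open>card L\<close>, the estimates require \<open>1 + S + c\<close>. The chosen value leaves
  some slack and also exceeds \<open>S\<close>, because \<open>cutoff_operator\<close> uses the same
  constant in \<open>T_bound\<close>.\<close>

definition coercivity_const :: real where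
  "coercivity_const = 2 + (real (card L))\<^sup>2 + 2 * (\<Sum>l\<in>Ls. C l)"

lemma dirac_coercive:
  assumes \<xi>: "\<xi> \<in> fin_supp A"
  shows "ell2_norm A (wgt \<xi>) \<le> coercivity_const * (ell2_norm A (dirac \<xi>) + ell2_norm A \<xi>)"
proof -
  define S where "S = (\<Sum>l\<in>Ls. C l)"
  define c where "c = (real (card L))\<^sup>2"
  define q where "q = sqrt (energy \<xi>)"
  define n where "n = ell2_norm A \<xi>"
  define p where "p = ell2_norm A (principal \<xi>)"
  have S: "0 \<le> S" unfolding S_def by (intro sum_nonneg C_nonneg)
  have nn: "0 \<le> n" "0 \<le> p" "0 \<le> c" "0 \<le> q" by (auto simp: n_def p_def c_def q_def energy_nonneg)
  have t: "tensor_op (\<Gamma> l) (\<gamma> l) \<xi> \<in> ell2 A" if "l \<in> Ls" for l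
    by (intro tensor_Gamma_ell2 that fin_supp_vdom \<xi>)
  have rest: "ell2_norm A (\<lambda>m. \<Sum>l\<in>Ls - L. tensor_op (\<Gamma> l) (\<gamma> l) \<xi> m) \<le> S * n"
  proof -
    have "ell2_norm A (\<lambda>m. \<Sum>l\<in>Ls - L. tensor_op (\<Gamma> l) (\<gamma> l) \<xi> m)
        \<le> (\<Sum>l\<in>Ls - L. ell2_norm A (tensor_op (\<Gamma> l) (\<gamma> l) \<xi>))"
      by (intro ell2_norm_sum t) auto
    also have "\<dots> \<le> (\<Sum>l\<in>Ls - L. C l * n)"
      unfolding n_def
      by (intro sum_mono norm_tensor_le Gamma_lower_order fin_supp_vdom coord_fin_supp fin_supp_ell2 C_nonneg \<xi>) auto
    also have "\<dots> \<le> (\<Sum>l\<in>Ls. C l * n)"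
      using finite_Ls C_nonneg nn by (intro sum_mono2) auto
    finally show ?thesis by (simp add: S_def sum_distrib_right)
  qed
  have split: "dirac \<xi> = (\<lambda>m. principal \<xi> m + (\<Sum>l\<in>Ls - L. tensor_op (\<Gamma> l) (\<gamma> l) \<xi> m))"
    unfolding dirac_def principal_def using sum.subset_diff[OF L_subset finite_Ls] by (auto simp: add.commute)
  have pe: "principal \<xi> \<in> ell2 A" unfolding principal_def using L_subset by (intro ell2_sum t) auto
  have "p \<le> ell2_norm A (dirac \<xi>) + ell2_norm A (\<lambda>m. principal \<xi> m - dirac \<xi> m)"
    unfolding p_def by (intro ell2_norm_triangle_sub pe dirac_ell2 fin_supp_vdom \<xi>)
  also have "ell2_norm A (\<lambda>m. principal \<xi> m - dirac \<xi> m) \<le> S * n"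
    using rest by (simp add: split)
  finally have p: "p \<le> ell2_norm A (dirac \<xi>) + S * n" by simp
  have "q\<^sup>2 \<le> p\<^sup>2 + c * (n * q)"
    using principal_lower_bound[OF \<xi>] energy_nonneg[of \<xi>] by (simp add: q_def n_def p_def c_def)
  then have "q * (q - c * n) \<le> p * p" by (simp add: power2_eq_square algebra_simps)
  \<comment> \<open>Solves the quadratic inequality for \<open>q\<close> without roots: if
    \<open>q\<close> exceeded \<open>p + c * n\<close>, both \<open>q\<close> and
    \<open>q - c * n\<close> would exceed \<open>p\<close>, and so their product would exceed
    \<open>p * p\<close>.\<close>
  have q: "q \<le> p + c * n"
  proof (rule ccontr)
    assume "\<not> q \<le> p + c * n"
    then have "p < q - c * n" by simp
    moreover have "p < q" using \<open>p < q - c * n\<close> nn by (smt (verit) mult_nonneg_nonneg)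
    ultimately have "p * p < q * (q - c * n)" using nn by (intro mult_strict_mono') auto
    with \<open>q * (q - c * n) \<le> p * p\<close> show False by simp
  qed
  have "(ell2_norm A (wgt \<xi>))\<^sup>2 = n\<^sup>2 + q\<^sup>2"
    using norm_wt_power2[OF \<xi>] energy_nonneg[of \<xi>] by (simp add: n_def q_def)
  also have "\<dots> \<le> (n + q)\<^sup>2" using nn by (simp add: power2_sum)
  finally have "ell2_norm A (wgt \<xi>) \<le> n + q" by (rule power2_le_imp_le) (use nn in simp)
  also have "\<dots> \<le> n + (ell2_norm A (dirac \<xi>) + S * n) + c * n" using p q by linarith
  also have "\<dots> \<le> coercivity_const * (ell2_norm A (dirac \<xi>) + n)"
  proof -
    have "0 \<le> S * ell2_norm A (dirac \<xi>)" "0 \<le> c * ell2_norm A (dirac \<xi>)" "0 \<le> S * n" "0 \<le> ell2_norm A (dirac \<xi>)"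
      using S nn by auto
    then show ?thesis using nn by (simp add: coercivity_const_def S_def[symmetric] c_def[symmetric] algebra_simps)
  qed
  finally show ?thesis by (simp add: n_def)
qed

section \<open>Cutoff functions and their commutators with the Dirac sum\<close>

lemma cutoff_range: "0 \<le> cutoff J x n m" "cutoff J x n m \<le> 1"
  by (auto simp: cutoff_def sum_nonneg)

lemma cutoff_fin_supp: "\<xi> \<in> fin_supp A \<Longrightarrow> (\<lambda>m. cutoff J x n m *\<^sub>R (\<xi> m :: 'v::real_vector)) \<in> fin_supp A"
  by (erule fin_supp_pointwise) simp

text \<open>Where the cutoff is nonzero every coordinate is at most \<open>n + 1\<close> in absolute
  value, which confines the point to a sublevel set of the weight.\<close>

lemma cutoff_finite: "finite {m \<in> A. cutoff J x n m \<noteq> 0}"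
proof (rule finite_subset[OF _ finite_sublevel])
  show "{m \<in> A. cutoff J x n m \<noteq> 0} \<subseteq> {m \<in> A. w m \<le> 1 + (\<Sum>j\<in>J. (real (Suc n))\<^sup>2)}"
  proof clarify
    fix m assume "m \<in> A" "cutoff J x n m \<noteq> 0"
    then have s: "(\<Sum>j\<in>J. \<bar>x j m\<bar>) \<le> real (Suc n)"
      by (auto simp: cutoff_def max_def divide_simps split: if_splits)
    have "\<bar>x j m\<bar> \<le> real (Suc n)" if "j \<in> J" for j
      using member_le_sum[OF that, of "\<lambda>j. \<bar>x j m\<bar>"] finite_J s by simp
    then have "(x j m)\<^sup>2 \<le> (real (Suc n))\<^sup>2" if "j \<in> J" for j
      using that by (simp add: abs_le_square_iff[symmetric])
    then show "w m \<le> 1 + (\<Sum>j\<in>J. (real (Suc n))\<^sup>2)"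
      unfolding w_eq by (intro add_left_mono sum_mono)
  qed
qed

lemma cutoff_limit: "(\<lambda>n. cutoff J x n m) \<longlonglongrightarrow> 1"
proof -
  have "(\<lambda>n. (\<Sum>j\<in>J. \<bar>x j m\<bar>) / real (Suc n)) \<longlonglongrightarrow> 0"
    using tendsto_mult_right_zero[OF LIMSEQ_inverse_real_of_nat, of "\<Sum>j\<in>J. \<bar>x j m\<bar>"]
    by (simp add: divide_inverse)
  then have "(\<lambda>n. max 0 (1 - (\<Sum>j\<in>J. \<bar>x j m\<bar>) / real (Suc n))) \<longlonglongrightarrow> max 0 (1 - 0)"
    by (intro tendsto_max tendsto_intros)
  then show ?thesis by (simp add: cutoff_def)
qed

text \<open>A real function commutes with the pointwise action of the matrices, so only the scalar
  commutators remain; these are controlled coordinate by coordinate.\<close>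

lemma dirac_cutoff:
  assumes \<xi>: "\<xi> \<in> fin_supp A"
  shows "ell2_norm A (\<lambda>m. dirac (\<lambda>m. cutoff J x n m *\<^sub>R \<xi> m) m - cutoff J x n m *\<^sub>R dirac \<xi> m)
    \<le> (\<Sum>l\<in>Ls. C l) * ell2_norm A \<xi>"
proof -
  let ?f = "\<lambda>(\<xi> :: 'g \<Rightarrow> complex ^ 's) m. cutoff J x n m *\<^sub>R \<xi> m"
  let ?K = "\<lambda>l m. lift (\<Gamma> l) (?f \<xi>) m - ?f (lift (\<Gamma> l) \<xi>) m"
  have coordK: "coord i (?K l) = (\<lambda>m. \<Gamma> l (\<lambda>m. cutoff J x n m *\<^sub>R coord i \<xi> m) m - cutoff J x n m *\<^sub>R \<Gamma> l (coord i \<xi>) m)"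
    for i l by (simp add: coord_def lift_def)
  have f_ell2: "?f \<zeta> \<in> ell2 A" if "\<zeta> \<in> ell2 A" for \<zeta>
    by (rule ell2_dominated[OF that, of 1]) (use cutoff_range ell2_outside[OF that] in \<open>auto simp: mult_left_le_one_le\<close>)
  have K: "?K l \<in> ell2 A" if "l \<in> Ls" for l
    by (intro ell2_diff f_ell2 lift_Gamma_ell2 fin_supp_vdom cutoff_fin_supp \<xi> that)
  have "(\<lambda>m. dirac (?f \<xi>) m - ?f (dirac \<xi>) m) = (\<lambda>m. \<Sum>l\<in>Ls. \<gamma> l *v ?K l m)"
    by (simp add: dirac_def tensor_op_eq matrix_vector_mult_diff_distrib sum_subtractf scaleR_sum_right
        matrix_mult_scaleR)
  then have "ell2_norm A (\<lambda>m. dirac (?f \<xi>) m - ?f (dirac \<xi>) m) \<le> (\<Sum>l\<in>Ls. ell2_norm A (\<lambda>m. \<gamma> l *v ?K l m))"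
    using ell2_norm_sum[of Ls "\<lambda>l m. \<gamma> l *v ?K l m" A] gamma_ell2[OF _ K] by simp
  also have "\<dots> \<le> (\<Sum>l\<in>Ls. C l * ell2_norm A \<xi>)"
  proof (rule sum_mono)
    fix l assume l: "l \<in> Ls"
    have "ell2_norm A (?K l) \<le> C l * ell2_norm A \<xi>"
    proof (rule ell2_norm_coord_le[OF fin_supp_ell2[OF \<xi>] C_nonneg[OF l] coord_ell2[OF K[OF l]]])
      fix i show "ell2_norm A (coord i (?K l)) \<le> C l * ell2_norm A (coord i \<xi>)"
        unfolding coordK by (rule Gamma_cutoff[OF l coord_fin_supp[OF \<xi>]])
    qed
    then show "ell2_norm A (\<lambda>m. \<gamma> l *v ?K l m) \<le> C l * ell2_norm A \<xi>"
      by (simp add: gamma_ell2_norm l)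
  qed
  finally show ?thesis by (simp add: sum_distrib_right)
qed

lemma dirac_self_adjoint_compact_resolvent:
  "self_adjoint A vdom dirac \<and> compact_resolvent A vdom dirac"
proof -
  have S: "0 \<le> (\<Sum>l\<in>Ls. C l)" by (intro sum_nonneg C_nonneg)
  then have K: "(\<Sum>l\<in>Ls. C l) \<le> coercivity_const" "0 \<le> coercivity_const"
    by (auto simp: coercivity_const_def)
  interpret cutoff_operator A w vdom dirac "cutoff J x" coercivity_const "\<Sum>l\<in>Ls. C l"
  proof
    fix \<xi> assume "\<xi> \<in> vdom"
    then show "ell2_norm A (dirac \<xi>) \<le> coercivity_const * ell2_norm A (wgt \<xi>)"
      by (rule order_trans[OF dirac_bound]) (intro mult_right_mono K, simp)
  qed (rule w_ge_1 finite_sublevel vdom_def K(2) S dirac_add dirac_cmul dirac_ell2 dirac_sym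
      dirac_coercive cutoff_finite cutoff_range cutoff_limit dirac_cutoff; assumption)+
  show ?thesis using self_adjoint_T compact_resolvent_T by simp
qed

end

section \<open>Bounded operators and their adjoints\<close>

definition bdd_op :: "'g set \<Rightarrow> 'g op \<Rightarrow> bool" where
  "bdd_op A T \<longleftrightarrow> (\<forall>\<xi>\<in>ell2 A. T \<xi> \<in> ell2 A) \<and> lin_on (ell2 A) T \<and>
     (\<exists>C\<ge>0. \<forall>\<xi>\<in>ell2 A. ell2_norm A (T \<xi>) \<le> C * ell2_norm A \<xi>)"

text \<open>Adjoints are exhibited explicitly. The value of \<open>bounded_adjoint\<close> then
  follows from uniqueness alone (\<open>bounded_adjoint_eq\<close>), and no general existence
  theorem enters.\<close>

definition adjoint_pair :: "'g set \<Rightarrow> 'g op \<Rightarrow> 'g op \<Rightarrow> bool" where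
  "adjoint_pair A T S \<longleftrightarrow> bdd_op A T \<and> bdd_op A S \<and>
     (\<forall>\<xi>\<in>ell2 A. \<forall>\<eta>\<in>ell2 A. ell2_inner A (S \<xi>) \<eta> = ell2_inner A \<xi> (T \<eta>))"

abbreviation hermitian :: "'g set \<Rightarrow> 'g op \<Rightarrow> bool" where
  "hermitian A T \<equiv> adjoint_pair A T T"

lemma bdd_op_ell2: "bdd_op A T \<Longrightarrow> \<xi> \<in> ell2 A \<Longrightarrow> T \<xi> \<in> ell2 A"
  by (simp add: bdd_op_def)

lemma bdd_op_add:
  "bdd_op A T \<Longrightarrow> \<xi> \<in> ell2 A \<Longrightarrow> \<eta> \<in> ell2 A \<Longrightarrow> T (\<lambda>m. \<xi> m + \<eta> m) = (\<lambda>m. T \<xi> m + T \<eta> m)"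
  by (simp add: bdd_op_def lin_on_def)

lemma bdd_op_cmul: "bdd_op A T \<Longrightarrow> \<xi> \<in> ell2 A \<Longrightarrow> T (\<lambda>m. a * \<xi> m) = (\<lambda>m. a * T \<xi> m)"
  by (simp add: bdd_op_def lin_on_def)

lemma bdd_op_diff:
  assumes "bdd_op A T" "\<xi> \<in> ell2 A" "\<eta> \<in> ell2 A"
  shows "T (\<lambda>m. \<xi> m - \<eta> m) = (\<lambda>m. T \<xi> m - T \<eta> m)"
  using bdd_op_add[OF assms(1,2) scal.ell2_sm[OF assms(3)], of "-1"] bdd_op_cmul[OF assms(1,3), of "-1"]
  by simp

lemma bdd_op_bound:
  assumes "bdd_op A T"
  obtains C where "0 \<le> C" "\<And>\<xi>. \<xi> \<in> ell2 A \<Longrightarrow> ell2_norm A (T \<xi>) \<le> C * ell2_norm A \<xi>"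
  using assms unfolding bdd_op_def by blast

text \<open>Operators such as \<open>Re_op A T\<close> agree with the expected linear combinations
  only on \<open>ell2 A\<close>, so boundedness has to be transferred along equality on that
  set.\<close>

lemma bdd_op_cong:
  assumes "\<And>\<xi>. \<xi> \<in> ell2 A \<Longrightarrow> T' \<xi> = T \<xi>" "bdd_op A T"
  shows "bdd_op A T'"
proof -
  have "lin_on (ell2 A) T'"
    using assms unfolding lin_on_def
    by (auto simp: ell2_add scal.ell2_sm bdd_op_add bdd_op_cmul)
  then show ?thesis using assms unfolding bdd_op_def by auto
qed

lemma bdd_op_comb:
  assumes "bdd_op A T" "bdd_op A S"
  shows "bdd_op A (\<lambda>\<xi> m. a * T \<xi> m + b * S \<xi> m)"
proof -
  obtain C where C: "0 \<le> C" "\<And>\<xi>. \<xi> \<in> ell2 A \<Longrightarrow> ell2_norm A (T \<xi>) \<le> C * ell2_norm A \<xi>"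
    using bdd_op_bound[OF assms(1)] by blast
  obtain D where D: "0 \<le> D" "\<And>\<xi>. \<xi> \<in> ell2 A \<Longrightarrow> ell2_norm A (S \<xi>) \<le> D * ell2_norm A \<xi>"
    using bdd_op_bound[OF assms(2)] by blast
  have ell2: "(\<lambda>m. a * T \<xi> m) \<in> ell2 A" "(\<lambda>m. b * S \<xi> m) \<in> ell2 A" if "\<xi> \<in> ell2 A" for \<xi>
    by (rule scal.ell2_sm[OF bdd_op_ell2[OF assms(1) that]], rule scal.ell2_sm[OF bdd_op_ell2[OF assms(2) that]])
  have "ell2_norm A (\<lambda>m. a * T \<xi> m + b * S \<xi> m) \<le> (norm a * C + norm b * D) * ell2_norm A \<xi>"
    if \<xi>: "\<xi> \<in> ell2 A" for \<xi>
  proof -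
    have "ell2_norm A (\<lambda>m. a * T \<xi> m + b * S \<xi> m) \<le> norm a * ell2_norm A (T \<xi>) + norm b * ell2_norm A (S \<xi>)"
      using ell2_norm_triangle[OF ell2[OF \<xi>]] by (simp add: scal.ell2_norm_sm)
    also have "\<dots> \<le> norm a * (C * ell2_norm A \<xi>) + norm b * (D * ell2_norm A \<xi>)"
      by (intro add_mono mult_left_mono C D \<xi>) auto
    finally show ?thesis by (simp add: algebra_simps)
  qed
  moreover have "0 \<le> norm a * C + norm b * D" using C(1) D(1) by simp
  moreover have "lin_on (ell2 A) (\<lambda>\<xi> m. a * T \<xi> m + b * S \<xi> m)"
    unfolding lin_on_def
    by (auto simp: bdd_op_add[OF assms(1)] bdd_op_add[OF assms(2)] bdd_op_cmul[OF assms(1)]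
        bdd_op_cmul[OF assms(2)] algebra_simps)
  moreover have "(\<lambda>m. a * T \<xi> m + b * S \<xi> m) \<in> ell2 A" if "\<xi> \<in> ell2 A" for \<xi>
    by (rule ell2_add[OF ell2[OF that]])
  ultimately show ?thesis
    unfolding bdd_op_def by (intro conjI ballI exI[of _ "norm a * C + norm b * D"]) simp_all
qed

lemma adjoint_pair_bdd: "adjoint_pair A T S \<Longrightarrow> bdd_op A T" "adjoint_pair A T S \<Longrightarrow> bdd_op A S"
  by (simp_all add: adjoint_pair_def)

lemma adjoint_pairD:
  "adjoint_pair A T S \<Longrightarrow> \<xi> \<in> ell2 A \<Longrightarrow> \<eta> \<in> ell2 A \<Longrightarrow> ell2_inner A (S \<xi>) \<eta> = ell2_inner A \<xi> (T \<eta>)"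
  by (simp add: adjoint_pair_def)

lemma adjoint_pair_sym: "adjoint_pair A T S \<Longrightarrow> adjoint_pair A S T"
  unfolding adjoint_pair_def by (intro conjI ballI; (elim conjE)?) (assumption | metis scal.ip_cnj)+

lemma adjoint_pair_comb:
  assumes "adjoint_pair A T S" "adjoint_pair A T' S'"
  shows "adjoint_pair A (\<lambda>\<xi> m. a * T \<xi> m + b * T' \<xi> m) (\<lambda>\<xi> m. cnj a * S \<xi> m + cnj b * S' \<xi> m)"
  unfolding adjoint_pair_def
proof (intro conjI ballI bdd_op_comb adjoint_pair_bdd(1)[OF assms(1)] adjoint_pair_bdd(1)[OF assms(2)]
    adjoint_pair_bdd(2)[OF assms(1)] adjoint_pair_bdd(2)[OF assms(2)])
  fix \<xi> \<eta> :: "_ \<Rightarrow> complex" assume \<xi>\<eta>: "\<xi> \<in> ell2 A" "\<eta> \<in> ell2 A"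
  note e = adjoint_pair_bdd[OF assms(1), THEN bdd_op_ell2] adjoint_pair_bdd[OF assms(2), THEN bdd_op_ell2]
  show "ell2_inner A (\<lambda>m. cnj a * S \<xi> m + cnj b * S' \<xi> m) \<eta> = ell2_inner A \<xi> (\<lambda>m. a * T \<eta> m + b * T' \<eta> m)"
    using \<xi>\<eta> adjoint_pairD[OF assms(1) \<xi>\<eta>] adjoint_pairD[OF assms(2) \<xi>\<eta>]
    by (simp add: scal.ip_add_left scal.ip_add_right scal.ip_sm_left scal.ip_sm_right scal.ell2_sm e)
qed

lemma adjoint_pair_cong:
  assumes "\<And>\<xi>. \<xi> \<in> ell2 A \<Longrightarrow> T' \<xi> = T \<xi>" "\<And>\<xi>. \<xi> \<in> ell2 A \<Longrightarrow> S' \<xi> = S \<xi>" "adjoint_pair A T S"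
  shows "adjoint_pair A T' S'"
  using assms bdd_op_cong[of A T' T] bdd_op_cong[of A S' S] by (simp add: adjoint_pair_def)

lemma bounded_adjoint_eq:
  assumes "adjoint_pair A T S" "\<eta> \<in> ell2 A"
  shows "bounded_adjoint A T \<eta> = S \<eta>"
  by (rule scal.hadjoint_eqI)
    (use assms in \<open>auto simp: fin_supp_ell2 adjoint_pairD bdd_op_ell2[OF adjoint_pair_bdd(2)]\<close>)

lemma Re_op_eq:
  assumes "adjoint_pair A T S" "\<xi> \<in> ell2 A"
  shows "Re_op A T \<xi> = (\<lambda>m. 1 / 2 * T \<xi> m + 1 / 2 * S \<xi> m)"
  by (simp add: Re_op_def bounded_adjoint_eq[OF assms] add_divide_distrib)

lemma Im_op_eq:
  assumes "adjoint_pair A T S" "\<xi> \<in> ell2 A"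
  shows "Im_op A T \<xi> = (\<lambda>m. (1 / (2 * \<i>)) * T \<xi> m + (- 1 / (2 * \<i>)) * S \<xi> m)"
  by (simp add: Im_op_def bounded_adjoint_eq[OF assms] diff_divide_distrib right_diff_distrib)

lemma hermitian_Re_op:
  assumes "adjoint_pair A T S"
  shows "hermitian A (Re_op A T)"
proof -
  have "adjoint_pair A (\<lambda>\<xi> m. 1 / 2 * T \<xi> m + 1 / 2 * S \<xi> m)
      (\<lambda>\<xi> m. cnj (1 / 2) * S \<xi> m + cnj (1 / 2) * T \<xi> m)"
    by (rule adjoint_pair_comb[OF assms adjoint_pair_sym[OF assms]])
  then show ?thesis
    by (rule adjoint_pair_cong[rotated 2]) (simp_all add: Re_op_eq[OF assms] add.commute)
qed

lemma hermitian_Im_op: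
  assumes "adjoint_pair A T S"
  shows "hermitian A (Im_op A T)"
proof -
  have "adjoint_pair A (\<lambda>\<xi> m. (1 / (2 * \<i>)) * T \<xi> m + (- 1 / (2 * \<i>)) * S \<xi> m)
      (\<lambda>\<xi> m. cnj (1 / (2 * \<i>)) * S \<xi> m + cnj (- 1 / (2 * \<i>)) * T \<xi> m)"
    by (rule adjoint_pair_comb[OF assms adjoint_pair_sym[OF assms]])
  then show ?thesis
    by (rule adjoint_pair_cong[rotated 2]) (simp_all add: Im_op_eq[OF assms] add.commute)
qed

lemma hermitian_scale_real:
  assumes "hermitian A T" "cnj r = r"
  shows "hermitian A (\<lambda>\<xi> m. r * T \<xi> m)"
  using adjoint_pair_comb[OF assms(1) assms(1), of r 0] assms(2) by simp

lemma hermitian_diff: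
  assumes "hermitian A T" "hermitian A S"
  shows "hermitian A (\<lambda>\<xi> m. T \<xi> m - S \<xi> m)"
  using adjoint_pair_comb[OF assms, of 1 "-1"] by simp

lemma adjoint_pair_diagonal:
  assumes h: "\<And>m. m \<in> A \<Longrightarrow> norm (h m) \<le> C"
  shows "adjoint_pair A (\<lambda>\<xi> m. h m * \<xi> m) (\<lambda>\<xi> m. cnj (h m) * \<xi> m)"
proof -
  have bdd: "bdd_op A (\<lambda>\<xi> m. g m * \<xi> m)" if "\<And>m. m \<in> A \<Longrightarrow> norm (g m) \<le> C" for g
  proof -
    have *: "norm (g m * \<xi> m) \<le> \<bar>C\<bar> * norm (\<xi> m)" if "m \<in> A" for m \<xi>
      using \<open>\<And>m. m \<in> A \<Longrightarrow> norm (g m) \<le> C\<close>[OF that] by (simp add: norm_mult mult_right_mono)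
    have "(\<lambda>m. g m * \<xi> m) \<in> ell2 A" "ell2_norm A (\<lambda>m. g m * \<xi> m) \<le> \<bar>C\<bar> * ell2_norm A \<xi>"
      if "\<xi> \<in> ell2 A" for \<xi>
      using ell2_dominated[OF that, of "\<bar>C\<bar>" "\<lambda>m. g m * \<xi> m"] ell2_norm_dominated[OF that, of "\<bar>C\<bar>" "\<lambda>m. g m * \<xi> m"]
        * ell2_outside[OF that] by auto
    then show ?thesis
      unfolding bdd_op_def lin_on_def by (auto simp: algebra_simps intro!: exI[of _ "\<bar>C\<bar>"])
  qed
  have "ell2_inner A (\<lambda>m. cnj (h m) * \<xi> m) \<eta> = ell2_inner A \<xi> (\<lambda>m. h m * \<eta> m)" for \<xi> \<eta>
    by (simp add: ell2_inner_def mult_ac)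
  then show ?thesis
    unfolding adjoint_pair_def using bdd[of h] bdd[of "\<lambda>m. cnj (h m)"] h by simp
qed

definition commute_on :: "'g set \<Rightarrow> 'g op \<Rightarrow> 'g op \<Rightarrow> bool" where
  "commute_on A T S \<longleftrightarrow> (\<forall>\<xi>\<in>ell2 A. T (S \<xi>) = S (T \<xi>))"

lemma commute_on_sym: "commute_on A T S \<Longrightarrow> commute_on A S T"
  by (simp add: commute_on_def)

lemma commute_on_comb:
  assumes "bdd_op A T" "bdd_op A S" "bdd_op A S'" "commute_on A T S" "commute_on A T S'"
    and "\<And>\<xi>. \<xi> \<in> ell2 A \<Longrightarrow> R \<xi> = (\<lambda>m. a * S \<xi> m + b * S' \<xi> m)"
  shows "commute_on A T R"
  unfolding commute_on_def
proof
  fix \<xi> :: "_ \<Rightarrow> complex" assume \<xi>: "\<xi> \<in> ell2 A"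
  have "T (R \<xi>) = (\<lambda>m. a * T (S \<xi>) m + b * T (S' \<xi>) m)"
    using bdd_op_add[OF assms(1) scal.ell2_sm[OF bdd_op_ell2[OF assms(2) \<xi>], of a]
        scal.ell2_sm[OF bdd_op_ell2[OF assms(3) \<xi>], of b]]
    by (simp add: assms(6)[OF \<xi>] bdd_op_cmul[OF assms(1)] bdd_op_ell2[OF assms(2) \<xi>] bdd_op_ell2[OF assms(3) \<xi>])
  also have "\<dots> = R (T \<xi>)"
    using assms(1,4,5) \<xi> by (simp add: commute_on_def assms(6) bdd_op_ell2)
  finally show "T (R \<xi>) = R (T \<xi>)" .
qed

text \<open>This is applied to a unitary, whose inverse is its adjoint: inserting
  \<open>S' S\<close> in front of \<open>T S'\<close> and moving \<open>S\<close> through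
  \<open>T\<close> leaves \<open>S' T\<close>.\<close>

lemma commute_on_inverse:
  assumes "bdd_op A T" "bdd_op A S" "bdd_op A S'" "commute_on A T S"
    and "\<And>\<xi>. \<xi> \<in> ell2 A \<Longrightarrow> S (S' \<xi>) = \<xi>" "\<And>\<xi>. \<xi> \<in> ell2 A \<Longrightarrow> S' (S \<xi>) = \<xi>"
  shows "commute_on A T S'"
  unfolding commute_on_def
proof
  fix \<xi> :: "_ \<Rightarrow> complex" assume \<xi>: "\<xi> \<in> ell2 A"
  have "T (S' \<xi>) = S' (S (T (S' \<xi>)))" using assms \<xi> by (simp add: bdd_op_ell2)
  also have "S (T (S' \<xi>)) = T (S (S' \<xi>))" using assms(3,4) \<xi> by (simp add: commute_on_def bdd_op_ell2)
  finally show "T (S' \<xi>) = S' (T \<xi>)" using assms(5) \<xi> by simp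
qed

section \<open>Twisted translations\<close>

text \<open>A twisted translation and its adjoint both have this form, with \<tau> a translation and
  \<open>a\<close> a unimodular factor, so norm, support and cutoff estimates are proved once for
  both.\<close>

definition wshift :: "'g set \<Rightarrow> ('g \<Rightarrow> complex) \<Rightarrow> ('g \<Rightarrow> 'g) \<Rightarrow> 'g op" where
  "wshift A a \<tau> = (\<lambda>\<xi> p. if p \<in> A then a p * \<xi> (\<tau> p) else 0)"

lemma
  assumes \<tau>: "bij_betw \<tau> A A" and a: "\<And>p. p \<in> A \<Longrightarrow> norm (a p) = 1" and \<xi>: "\<xi> \<in> ell2 A"
  shows wshift_ell2: "wshift A a \<tau> \<xi> \<in> ell2 A"
    and ell2_norm_wshift: "ell2_norm A (wshift A a \<tau> \<xi>) = ell2_norm A \<xi>"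
proof -
  have *: "(norm (wshift A a \<tau> \<xi> p))\<^sup>2 = (norm (\<xi> (\<tau> p)))\<^sup>2" if "p \<in> A" for p
    using a[OF that] that by (simp add: wshift_def norm_mult)
  have "(\<lambda>p. (norm (\<xi> (\<tau> p)))\<^sup>2) summable_on A"
    using summable_on_reindex_bij_betw[OF \<tau>, of "\<lambda>p. (norm (\<xi> p))\<^sup>2"] \<xi> by (simp add: ell2_def)
  then have "(\<lambda>p. (norm (wshift A a \<tau> \<xi> p))\<^sup>2) summable_on A"
    by (subst summable_on_cong[OF *])
  then show "wshift A a \<tau> \<xi> \<in> ell2 A" by (simp add: ell2_def wshift_def)
  show "ell2_norm A (wshift A a \<tau> \<xi>) = ell2_norm A \<xi>"
    unfolding ell2_norm_def
    using infsum_cong[of A "\<lambda>p. (norm (wshift A a \<tau> \<xi> p))\<^sup>2" "\<lambda>p. (norm (\<xi> (\<tau> p)))\<^sup>2", OF *]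
      infsum_reindex_bij_betw[OF \<tau>, of "\<lambda>p. (norm (\<xi> p))\<^sup>2"] by simp
qed

lemma wshift_bdd_op:
  assumes "bij_betw \<tau> A A" "\<And>p. p \<in> A \<Longrightarrow> norm (a p) = 1"
  shows "bdd_op A (wshift A a \<tau>)"
  unfolding bdd_op_def
proof (intro conjI)
  show "\<exists>C\<ge>0. \<forall>\<xi>\<in>ell2 A. ell2_norm A (wshift A a \<tau> \<xi>) \<le> C * ell2_norm A \<xi>"
    by (intro exI[of _ 1]) (simp add: ell2_norm_wshift assms)
  show "lin_on (ell2 A) (wshift A a \<tau>)"
    by (auto simp: lin_on_def wshift_def algebra_simps)
qed (use wshift_ell2 assms in blast)

lemma wshift_fin_supp:
  assumes "inj_on \<tau> A" "\<xi> \<in> fin_supp A"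
  shows "wshift A a \<tau> \<xi> \<in> fin_supp A"
proof -
  have "{p. wshift A a \<tau> \<xi> p \<noteq> 0} \<subseteq> \<tau> -` {p. \<xi> p \<noteq> 0} \<inter> A"
    by (auto simp: wshift_def split: if_splits)
  moreover have "finite (\<tau> -` {p. \<xi> p \<noteq> 0} \<inter> A)"
    using assms by (intro finite_vimage_IntI) (auto simp: fin_supp_def)
  ultimately have "finite {p. wshift A a \<tau> \<xi> p \<noteq> 0}" by (rule finite_subset)
  then show ?thesis by (auto simp: fin_supp_def wshift_def split: if_splits)
qed

text \<open>If \<open>b\<close> is at least \<open>R + 1\<close>, then \<open>a\<close> is at least
  \<open>R\<close> and both cutoffs vanish. Otherwise the difference is at most \<open>1 / R\<close>
  while \<open>y\<close> is below \<open>R + 1\<close>, and \<open>(R + 1) / R\<close> is at most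
  2.\<close>

lemma cutoff_difference_bound:
  fixes a b y R :: real
  assumes "1 \<le> R" "0 \<le> y" "y \<le> b" "\<bar>a - b\<bar> \<le> 1"
  shows "\<bar>max 0 (1 - b / R) - max 0 (1 - a / R)\<bar> * y \<le> 2"
proof (cases "b \<ge> R + 1")
  case True
  then have "a \<ge> R" "b \<ge> R" using assms by auto
  then have "1 - b / R \<le> 0" "1 - a / R \<le> 0" using assms(1) by (simp_all add: field_simps)
  then show ?thesis by simp
next
  case False
  have "\<bar>max 0 (1 - b / R) - max 0 (1 - a / R)\<bar> \<le> \<bar>(1 - b / R) - (1 - a / R)\<bar>" by linarith
  also have "\<dots> = \<bar>a - b\<bar> / R" using assms(1) by (simp add: diff_divide_distrib[symmetric])
  also have "\<dots> \<le> 1 / R" using assms by (simp add: divide_right_mono)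
  finally have "\<bar>max 0 (1 - b / R) - max 0 (1 - a / R)\<bar> * y \<le> 1 / R * (R + 1)"
    using assms False by (intro mult_mono) auto
  also have "\<dots> \<le> 2" using assms(1) by (simp add: field_simps)
  finally show ?thesis .
qed

text \<open>At \<open>p\<close> the commutator is the difference of the cutoff at \<open>p\<close>
  and \<open>\<tau> p\<close> times the coordinate at \<open>\<tau> p\<close>. The hypothesis
  \<open>near\<close> changes the l1-length by at most 1, so the growth of the coordinate is
  absorbed by the small slope of the cutoff.\<close>

lemma wshift_cutoff:
  fixes n :: nat
  assumes \<tau>: "bij_betw \<tau> A A" and a: "\<And>p. p \<in> A \<Longrightarrow> norm (a p) = 1" and \<xi>: "\<xi> \<in> ell2 A"
    and J: "finite J" "j \<in> J"
    and near: "\<And>p. p \<in> A \<Longrightarrow> (\<Sum>j\<in>J. \<bar>x j p - x j (\<tau> p)\<bar>) \<le> 1"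
  defines "K \<equiv> \<lambda>p. wshift A a \<tau> (\<lambda>m. cutoff J x n m *\<^sub>R deriv_op (x j) \<xi> m) p
    - cutoff J x n p *\<^sub>R wshift A a \<tau> (deriv_op (x j) \<xi>) p"
  shows "K \<in> ell2 A" and "ell2_norm A K \<le> 2 * ell2_norm A \<xi>"
proof -
  have "norm (K p) \<le> 2 * norm (wshift A a \<tau> \<xi> p)" if p: "p \<in> A" for p
  proof -
    let ?N = "\<lambda>p. \<Sum>j\<in>J. \<bar>x j p\<bar>"
    have "K p = a p * (of_real (cutoff J x n (\<tau> p) - cutoff J x n p) * (\<i> * of_real (x j (\<tau> p)) * \<xi> (\<tau> p)))"
      using p by (simp add: K_def wshift_def deriv_op_def scaleR_conv_of_real algebra_simps)
    then have "norm (K p) = (\<bar>cutoff J x n (\<tau> p) - cutoff J x n p\<bar> * \<bar>x j (\<tau> p)\<bar>) * norm (wshift A a \<tau> \<xi> p)"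
      using p a by (simp add: norm_mult wshift_def del: of_real_diff)
    moreover have "\<bar>cutoff J x n (\<tau> p) - cutoff J x n p\<bar> * \<bar>x j (\<tau> p)\<bar> \<le> 2"
      unfolding cutoff_def
    proof (rule cutoff_difference_bound)
      show "\<bar>x j (\<tau> p)\<bar> \<le> ?N (\<tau> p)" by (rule member_le_sum) (use J in auto)
      have "\<bar>?N p - ?N (\<tau> p)\<bar> \<le> (\<Sum>j\<in>J. \<bar>\<bar>x j p\<bar> - \<bar>x j (\<tau> p)\<bar>\<bar>)"
        unfolding sum_subtractf[symmetric] by (rule sum_abs)
      also have "\<dots> \<le> (\<Sum>j\<in>J. \<bar>x j p - x j (\<tau> p)\<bar>)" by (intro sum_mono) linarith
      finally show "\<bar>?N p - ?N (\<tau> p)\<bar> \<le> 1" using near[OF p] by linarith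
    qed auto
    ultimately show ?thesis by (simp add: mult_right_mono)
  qed
  moreover have "K p = 0" if "p \<notin> A" for p using that by (simp add: K_def wshift_def)
  ultimately show "K \<in> ell2 A" "ell2_norm A K \<le> 2 * ell2_norm A \<xi>"
    using ell2_dominated[OF wshift_ell2[OF \<tau> a \<xi>], where c = 2 and \<xi> = K]
      ell2_norm_dominated[OF wshift_ell2[OF \<tau> a \<xi>], where c = 2 and \<xi> = K]
    by (auto simp: ell2_norm_wshift[OF \<tau> a \<xi>])
qed

locale twisted_group = comm_group G for G :: "('g, 'b) monoid_scheme" (structure) +
  fixes \<sigma> :: "'g \<Rightarrow> 'g \<Rightarrow> complex"
  assumes norm_sigma: "x \<in> carrier G \<Longrightarrow> y \<in> carrier G \<Longrightarrow> norm (\<sigma> x y) = 1"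
begin

text \<open>The adjoint of \<open>W_op G \<sigma> u\<close>, which is also its inverse since
  \<sigma> is unimodular.\<close>

definition Wadj :: "'g \<Rightarrow> 'g op" where
  "Wadj u = wshift (carrier G) (\<lambda>p. cnj (\<sigma> u p)) (\<lambda>p. p \<otimes> u)"

lemma W_op_eq_wshift: "W_op G \<sigma> u = wshift (carrier G) (\<lambda>p. \<sigma> u (p \<otimes> inv u)) (\<lambda>p. p \<otimes> inv u)"
  by (simp add: W_op_def wshift_def)

lemma translation_bij: "u \<in> carrier G \<Longrightarrow> bij_betw (\<lambda>p. p \<otimes> u) (carrier G) (carrier G)"
  by (rule bij_betw_byWitness[where f' = "\<lambda>p. p \<otimes> inv u"]) (auto simp: m_assoc)

context
  fixes u assumes u: "u \<in> carrier G"
begin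

lemma W_shift: "bij_betw (\<lambda>p. p \<otimes> inv u) (carrier G) (carrier G)"
    "\<And>p. p \<in> carrier G \<Longrightarrow> norm (\<sigma> u (p \<otimes> inv u)) = 1"
  using u by (auto intro!: translation_bij norm_sigma)

lemma Wadj_shift: "bij_betw (\<lambda>p. p \<otimes> u) (carrier G) (carrier G)"
    "\<And>p. p \<in> carrier G \<Longrightarrow> norm (cnj (\<sigma> u p)) = 1"
  using u by (auto intro!: translation_bij norm_sigma)

lemma adjoint_pair_W: "adjoint_pair (carrier G) (W_op G \<sigma> u) (Wadj u)"
  unfolding adjoint_pair_def
proof (intro conjI ballI)
  show "bdd_op (carrier G) (W_op G \<sigma> u)"
    unfolding W_op_eq_wshift by (rule wshift_bdd_op[OF W_shift])
  show "bdd_op (carrier G) (Wadj u)"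
    unfolding Wadj_def by (rule wshift_bdd_op[OF Wadj_shift])
  fix \<xi> \<eta>
  have "ell2_inner (carrier G) \<xi> (W_op G \<sigma> u \<eta>)
      = (\<Sum>\<^sub>\<infinity>p\<in>carrier G. cnj (\<xi> p) * (\<sigma> u (p \<otimes> inv u) * \<eta> (p \<otimes> inv u)))"
    unfolding ell2_inner_def by (rule infsum_cong) (simp add: W_op_def)
  \<comment> \<open>The substitution of \<open>p \<otimes> u\<close> for \<open>p\<close> moves the
    translation onto the other argument.\<close>
  also have "\<dots> = (\<Sum>\<^sub>\<infinity>p\<in>carrier G. cnj (\<xi> (p \<otimes> u)) * (\<sigma> u (p \<otimes> u \<otimes> inv u) * \<eta> (p \<otimes> u \<otimes> inv u)))"
    by (rule infsum_reindex_bij_betw[OF translation_bij[OF u], symmetric])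
  also have "\<dots> = ell2_inner (carrier G) (Wadj u \<xi>) \<eta>"
    unfolding ell2_inner_def by (rule infsum_cong) (simp add: Wadj_def wshift_def m_assoc u)
  finally show "ell2_inner (carrier G) (Wadj u \<xi>) \<eta> = ell2_inner (carrier G) \<xi> (W_op G \<sigma> u \<eta>)" by simp
qed

lemma sigma_cnj: "p \<in> carrier G \<Longrightarrow> \<sigma> u p * cnj (\<sigma> u p) = 1"
  using norm_sigma[OF u, of p] by (simp add: complex_norm_square[symmetric])

lemma W_Wadj: "\<xi> \<in> ell2 (carrier G) \<Longrightarrow> W_op G \<sigma> u (Wadj u \<xi>) = \<xi>"
  using sigma_cnj ell2_outside[of \<xi> "carrier G"]
  by (auto simp: W_op_def Wadj_def wshift_def m_assoc u simp flip: mult.assoc)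

lemma Wadj_W: "\<xi> \<in> ell2 (carrier G) \<Longrightarrow> Wadj u (W_op G \<sigma> u \<xi>) = \<xi>"
  using sigma_cnj ell2_outside[of \<xi> "carrier G"]
  by (auto simp: W_op_def Wadj_def wshift_def m_assoc u mult.commute[of "cnj _"] simp flip: mult.assoc)

lemma ell2_norm_W: "\<xi> \<in> ell2 (carrier G) \<Longrightarrow> ell2_norm (carrier G) (W_op G \<sigma> u \<xi>) = ell2_norm (carrier G) \<xi>"
  unfolding W_op_eq_wshift by (rule ell2_norm_wshift[OF W_shift])

lemma ell2_norm_Wadj: "\<xi> \<in> ell2 (carrier G) \<Longrightarrow> ell2_norm (carrier G) (Wadj u \<xi>) = ell2_norm (carrier G) \<xi>"
  unfolding Wadj_def by (rule ell2_norm_wshift[OF Wadj_shift])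

text \<open>Real and imaginary part are half the sum and half the difference of a unitary and its
  adjoint, up to a unimodular factor; the parallelogram identity does the rest. This is the form in
  which \<open>X\<^sup>2 + Y\<^sup>2 = 1\<close> is used.\<close>

lemma ell2_norm_Re_Im_W:
  assumes \<xi>: "\<xi> \<in> ell2 (carrier G)"
  shows "(ell2_norm (carrier G) (Re_op (carrier G) (W_op G \<sigma> u) \<xi>))\<^sup>2
    + (ell2_norm (carrier G) (Im_op (carrier G) (W_op G \<sigma> u) \<xi>))\<^sup>2 = (ell2_norm (carrier G) \<xi>)\<^sup>2"
proof -
  let ?A = "carrier G" and ?u = "W_op G \<sigma> u \<xi>" and ?v = "Wadj u \<xi>"
  note p = adjoint_pair_W
  have uv: "?u \<in> ell2 ?A" "?v \<in> ell2 ?A"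
    using p \<xi> by (auto intro: bdd_op_ell2 dest: adjoint_pair_bdd)
  have "Re_op ?A (W_op G \<sigma> u) \<xi> = (\<lambda>m. (1 / 2) * (?u m + ?v m))"
    by (simp add: Re_op_eq[OF p \<xi>] algebra_simps)
  then have 1: "4 * (ell2_norm ?A (Re_op ?A (W_op G \<sigma> u) \<xi>))\<^sup>2 = (ell2_norm ?A (\<lambda>m. ?u m + ?v m))\<^sup>2"
    by (simp only: scal.ell2_norm_sm) (simp add: power_mult_distrib power2_eq_square)
  have "Im_op ?A (W_op G \<sigma> u) \<xi> = (\<lambda>m. (1 / (2 * \<i>)) * (?u m + - ?v m))"
    by (simp add: Im_op_eq[OF p \<xi>] algebra_simps)
  then have 2: "4 * (ell2_norm ?A (Im_op ?A (W_op G \<sigma> u) \<xi>))\<^sup>2 = (ell2_norm ?A (\<lambda>m. ?u m + - ?v m))\<^sup>2"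
    by (simp only: scal.ell2_norm_sm) (simp add: power_mult_distrib power2_eq_square norm_divide norm_mult)
  have "(ell2_norm ?A (\<lambda>m. ?u m + ?v m))\<^sup>2 + (ell2_norm ?A (\<lambda>m. ?u m + - ?v m))\<^sup>2
      = 2 * (ell2_norm ?A ?u)\<^sup>2 + 2 * (ell2_norm ?A ?v)\<^sup>2"
    unfolding scal.ell2_norm_add_power2[OF uv] scal.ell2_norm_add_power2[OF uv(1) ell2_uminus[OF uv(2)]]
    by (simp add: scal.ip_uminus)
  then show ?thesis using 1 2 \<xi> by (simp add: ell2_norm_W ell2_norm_Wadj)
qed

end

text \<open>Commutation of two unitaries passes to their inverses, which are their adjoints, and
  hence to linear combinations of each unitary with its adjoint. \<open>X_op\<close> and
  \<open>Y_op\<close> are such combinations.\<close>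

lemma commute_on_W:
  assumes "u \<in> carrier G" "v \<in> carrier G" "commute_on (carrier G) (W_op G \<sigma> u) (W_op G \<sigma> v)"
    and "\<And>\<xi>. \<xi> \<in> ell2 (carrier G) \<Longrightarrow> P \<xi> = (\<lambda>m. a * W_op G \<sigma> u \<xi> m + b * Wadj u \<xi> m)"
    and "\<And>\<xi>. \<xi> \<in> ell2 (carrier G) \<Longrightarrow> Q \<xi> = (\<lambda>m. c * W_op G \<sigma> v \<xi> m + e * Wadj v \<xi> m)"
  shows "commute_on (carrier G) P Q"
proof -
  note U = adjoint_pair_bdd[OF adjoint_pair_W[OF assms(1)]]
  note V = adjoint_pair_bdd[OF adjoint_pair_W[OF assms(2)]]
  have 1: "commute_on (carrier G) (W_op G \<sigma> u) (Wadj v)"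
    by (rule commute_on_inverse[OF U(1) V assms(3) W_Wadj[OF assms(2)] Wadj_W[OF assms(2)]])
  have 2: "commute_on (carrier G) (W_op G \<sigma> u) Q"
    by (rule commute_on_comb[OF U(1) V assms(3) 1 assms(5)])
  have Q: "bdd_op (carrier G) Q" by (rule bdd_op_cong[OF assms(5) bdd_op_comb[OF V]])
  have 3: "commute_on (carrier G) Q (Wadj u)"
    by (rule commute_on_inverse[OF Q U commute_on_sym[OF 2] W_Wadj[OF assms(1)] Wadj_W[OF assms(1)]])
  show ?thesis
    by (rule commute_on_sym[OF commute_on_comb[OF Q U commute_on_sym[OF 2] 3 assms(4)]])
qed

section \<open>The conjugation \<open>J_op\<close> and commutators with the right action\<close>

lemma inv_bij: "bij_betw (\<lambda>p. inv p) (carrier G) (carrier G)"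
  by (rule bij_betw_byWitness[where f' = "\<lambda>p. inv p"]) auto

lemma
  assumes "\<xi> \<in> ell2 (carrier G)"
  shows J_op_ell2: "J_op G \<xi> \<in> ell2 (carrier G)"
    and ell2_norm_J_op: "ell2_norm (carrier G) (J_op G \<xi>) = ell2_norm (carrier G) \<xi>"
    and J_op_J_op: "J_op G (J_op G \<xi>) = \<xi>"
proof -
  have *: "(norm (J_op G \<xi> p))\<^sup>2 = (norm (\<xi> (inv p)))\<^sup>2" if "p \<in> carrier G" for p
    using that by (simp add: J_op_def)
  have "(\<lambda>p. (norm (\<xi> (inv p)))\<^sup>2) summable_on carrier G"
    using summable_on_reindex_bij_betw[OF inv_bij, of "\<lambda>p. (norm (\<xi> p))\<^sup>2"] assms by (simp add: ell2_def)
  then have "(\<lambda>p. (norm (J_op G \<xi> p))\<^sup>2) summable_on carrier G"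
    by (subst summable_on_cong[OF *])
  then show "J_op G \<xi> \<in> ell2 (carrier G)" by (simp add: ell2_def J_op_def)
  show "ell2_norm (carrier G) (J_op G \<xi>) = ell2_norm (carrier G) \<xi>"
    unfolding ell2_norm_def
    using infsum_cong[of "carrier G" "\<lambda>p. (norm (J_op G \<xi> p))\<^sup>2" "\<lambda>p. (norm (\<xi> (inv p)))\<^sup>2", OF *]
      infsum_reindex_bij_betw[OF inv_bij, of "\<lambda>p. (norm (\<xi> p))\<^sup>2"] by simp
  show "J_op G (J_op G \<xi>) = \<xi>" using ell2_outside[OF assms] by (auto simp: J_op_def)
qed

text \<open>The conjugation is antiunitary, hence the exchange of the two arguments.\<close>

lemma ell2_inner_J_op: "ell2_inner (carrier G) (J_op G \<xi>) (J_op G \<eta>) = ell2_inner (carrier G) \<eta> \<xi>"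
proof -
  have "ell2_inner (carrier G) (J_op G \<xi>) (J_op G \<eta>) = (\<Sum>\<^sub>\<infinity>p\<in>carrier G. cnj (\<eta> (inv p)) * \<xi> (inv p))"
    unfolding ell2_inner_def by (rule infsum_cong) (simp add: J_op_def)
  also have "\<dots> = ell2_inner (carrier G) \<eta> \<xi>"
    unfolding ell2_inner_def by (rule infsum_reindex_bij_betw[OF inv_bij])
  finally show ?thesis .
qed

text \<open>For hermitian \<open>Y\<close> the right action is \<open>J Y J\<close>. The two
  conjugations restore linearity, and the two exchanges of arguments that they cause cancel.\<close>

lemma hermitian_right_act:
  assumes Y: "hermitian (carrier G) Y"
  shows "hermitian (carrier G) (right_act G Y)"
proof -
  let ?A = "carrier G" and ?T = "\<lambda>\<xi>. J_op G (Y (J_op G \<xi>))"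
  note bY = adjoint_pair_bdd(1)[OF Y]
  have eq: "right_act G Y \<xi> = ?T \<xi>" if "\<xi> \<in> ell2 ?A" for \<xi>
    unfolding right_act_def by (simp add: bounded_adjoint_eq[OF Y] J_op_ell2 that)
  have Jadd: "J_op G (\<lambda>m. \<xi> m + \<eta> m) = (\<lambda>m. J_op G \<xi> m + J_op G \<eta> m)" for \<xi> \<eta>
    by (auto simp: J_op_def)
  have Jcmul: "J_op G (\<lambda>m. a * \<xi> m) = (\<lambda>m. cnj a * J_op G \<xi> m)" for a \<xi>
    by (auto simp: J_op_def)
  obtain C where C: "0 \<le> C" "\<And>\<xi>. \<xi> \<in> ell2 ?A \<Longrightarrow> ell2_norm ?A (Y \<xi>) \<le> C * ell2_norm ?A \<xi>"
    using bdd_op_bound[OF bY] by blast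
  have T: "?T \<xi> \<in> ell2 ?A" if "\<xi> \<in> ell2 ?A" for \<xi>
    by (intro J_op_ell2 bdd_op_ell2[OF bY] that)
  have "bdd_op ?A ?T"
    unfolding bdd_op_def
  proof (intro conjI ballI T)
    show "lin_on (ell2 ?A) ?T"
      unfolding lin_on_def by (auto simp: Jadd Jcmul bdd_op_add[OF bY] bdd_op_cmul[OF bY] J_op_ell2)
    have "ell2_norm ?A (?T \<xi>) \<le> C * ell2_norm ?A \<xi>" if "\<xi> \<in> ell2 ?A" for \<xi>
      using C(2)[OF J_op_ell2[OF that]] that by (simp add: ell2_norm_J_op J_op_ell2 bdd_op_ell2[OF bY])
    then show "\<exists>C\<ge>0. \<forall>\<xi>\<in>ell2 ?A. ell2_norm ?A (?T \<xi>) \<le> C * ell2_norm ?A \<xi>" using C(1) by blast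
  qed
  moreover have "ell2_inner ?A (?T \<xi>) \<eta> = ell2_inner ?A \<xi> (?T \<eta>)" if \<xi>: "\<xi> \<in> ell2 ?A" and \<eta>: "\<eta> \<in> ell2 ?A" for \<xi> \<eta>
  proof -
    have "ell2_inner ?A (?T \<xi>) \<eta> = ell2_inner ?A (?T \<xi>) (J_op G (J_op G \<eta>))" by (simp add: J_op_J_op \<eta>)
    also have "\<dots> = ell2_inner ?A (J_op G \<eta>) (Y (J_op G \<xi>))" by (rule ell2_inner_J_op)
    also have "\<dots> = ell2_inner ?A (Y (J_op G \<eta>)) (J_op G \<xi>)"
      by (rule adjoint_pairD[OF Y, symmetric]) (simp_all add: J_op_ell2 \<xi> \<eta>)
    also have "\<dots> = ell2_inner ?A (J_op G (?T \<eta>)) (J_op G \<xi>)"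
      by (simp add: J_op_J_op bdd_op_ell2[OF bY] J_op_ell2 \<eta>)
    also have "\<dots> = ell2_inner ?A \<xi> (?T \<eta>)" by (rule ell2_inner_J_op)
    finally show ?thesis .
  qed
  ultimately have "hermitian ?A ?T" by (simp add: adjoint_pair_def)
  then show ?thesis by (rule adjoint_pair_cong[rotated 2]) (simp_all add: eq)
qed

lemma hermitian_commutator: "hermitian (carrier G) Y \<Longrightarrow> hermitian (carrier G) (commutator G Y)"
  unfolding commutator_def by (intro hermitian_diff hermitian_right_act)

end

section \<open>First-order operators from bounded ones\<close>

lemma deriv_op_fin_supp: "\<xi> \<in> fin_supp A \<Longrightarrow> deriv_op y \<xi> \<in> fin_supp A"
  by (erule fin_supp_pointwise) (simp add: deriv_op_def)

lemma deriv_op_skew: "ell2_inner A (deriv_op y \<xi>) \<eta> = - ell2_inner A \<xi> (deriv_op y \<eta>)"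
  by (simp add: ell2_inner_def deriv_op_def mult_ac flip: infsum_uminus)

text \<open>Collects, for one summand, hypotheses of \<open>first_order_family\<close> that do not
  depend on its membership in \<open>L\<close>, with one constant for the norm bound and the cutoff
  commutator.\<close>

definition first_order :: "'g set \<Rightarrow> nat set \<Rightarrow> (nat \<Rightarrow> 'g \<Rightarrow> real) \<Rightarrow> ('g \<Rightarrow> real) \<Rightarrow> 'g op \<Rightarrow> real \<Rightarrow> bool" where
  "first_order A J x w T C \<longleftrightarrow> 0 \<le> C \<and> lin_on (sobolev A w) T \<and>
     (\<forall>\<xi>\<in>sobolev A w. T \<xi> \<in> ell2 A \<and> ell2_norm A (T \<xi>) \<le> C * ell2_norm A (\<lambda>m. sqrt (w m) *\<^sub>R \<xi> m)) \<and>
     (\<forall>\<xi>\<in>fin_supp A. \<forall>\<eta>\<in>fin_supp A. ell2_inner A (T \<xi>) \<eta> = - ell2_inner A \<xi> (T \<eta>)) \<and>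
     (\<forall>\<xi>\<in>fin_supp A. \<forall>n. ell2_norm A (\<lambda>m. T (\<lambda>m. cutoff J x n m *\<^sub>R \<xi> m) m - cutoff J x n m *\<^sub>R T \<xi> m)
        \<le> C * ell2_norm A \<xi>)"

text \<open>The properties of a coefficient shared by \<open>X_op\<close>, \<open>Y_op\<close> and
  the identity. Their commutators with derivations are again contractions; the constant 2 in the
  cutoff estimate is that of \<open>wshift_cutoff\<close>.\<close>

definition order_zero :: "'g set \<Rightarrow> nat set \<Rightarrow> (nat \<Rightarrow> 'g \<Rightarrow> real) \<Rightarrow> 'g op \<Rightarrow> bool" where
  "order_zero A J x P \<longleftrightarrow> hermitian A P \<and> (\<forall>\<xi>\<in>ell2 A. ell2_norm A (P \<xi>) \<le> ell2_norm A \<xi>) \<and>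
     (\<forall>\<xi>\<in>fin_supp A. P \<xi> \<in> fin_supp A) \<and>
     (\<forall>j\<in>J. \<forall>\<xi>\<in>fin_supp A.
        ell2_norm A (\<lambda>m. deriv_op (x j) (P \<xi>) m - P (deriv_op (x j) \<xi>) m) \<le> ell2_norm A \<xi>) \<and>
     (\<forall>j\<in>J. \<forall>\<xi>\<in>fin_supp A. \<forall>n.
        ell2_norm A (\<lambda>m. P (\<lambda>m. cutoff J x n m *\<^sub>R deriv_op (x j) \<xi> m) m
          - cutoff J x n m *\<^sub>R P (deriv_op (x j) \<xi>) m) \<le> 2 * ell2_norm A \<xi>)"

lemma deriv_op_sobolev:
  assumes "finite J" "j \<in> J" "w = (\<lambda>m. 1 + (\<Sum>j\<in>J. (x j m)\<^sup>2))" "\<xi> \<in> sobolev A w"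
  shows "deriv_op (x j) \<xi> \<in> ell2 A"
    and "ell2_norm A (deriv_op (x j) \<xi>) \<le> ell2_norm A (\<lambda>m. sqrt (w m) *\<^sub>R \<xi> m)"
proof -
  have *: "norm (deriv_op (x j) \<xi> m) \<le> 1 * norm (sqrt (w m) *\<^sub>R \<xi> m)" for m
  proof -
    have "(x j m)\<^sup>2 \<le> (\<Sum>j\<in>J. (x j m)\<^sup>2)" by (rule member_le_sum) (use assms in auto)
    then have "\<bar>x j m\<bar> \<le> sqrt (w m)" unfolding assms(3) by (intro real_le_rsqrt) simp
    then have "\<bar>x j m\<bar> * norm (\<xi> m) \<le> \<bar>sqrt (w m)\<bar> * norm (\<xi> m)" by (intro mult_right_mono) auto
    then show ?thesis by (simp add: deriv_op_def norm_mult)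
  qed
  have "deriv_op (x j) \<xi> m = 0" if "m \<notin> A" for m
    using assms(4) that ell2_outside[of \<xi> A m] by (simp add: deriv_op_def sobolev_def)
  with * show "deriv_op (x j) \<xi> \<in> ell2 A"
    "ell2_norm A (deriv_op (x j) \<xi>) \<le> ell2_norm A (\<lambda>m. sqrt (w m) *\<^sub>R \<xi> m)"
    using ell2_dominated[of "\<lambda>m. sqrt (w m) *\<^sub>R \<xi> m" A 1 "deriv_op (x j) \<xi>"]
      ell2_norm_dominated[of "\<lambda>m. sqrt (w m) *\<^sub>R \<xi> m" A 1 "deriv_op (x j) \<xi>"] assms(4)
    by (auto simp: sobolev_def)
qed

lemma order_zeroD:
  assumes "order_zero A J x P"
  shows "hermitian A P" and "bdd_op A P"
    and "\<And>\<xi>. \<xi> \<in> ell2 A \<Longrightarrow> ell2_norm A (P \<xi>) \<le> ell2_norm A \<xi>"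
    and "\<And>\<xi>. \<xi> \<in> fin_supp A \<Longrightarrow> P \<xi> \<in> fin_supp A"
    and "\<And>j \<xi>. j \<in> J \<Longrightarrow> \<xi> \<in> fin_supp A \<Longrightarrow>
      ell2_norm A (\<lambda>m. deriv_op (x j) (P \<xi>) m - P (deriv_op (x j) \<xi>) m) \<le> ell2_norm A \<xi>"
  using assms adjoint_pair_bdd[of A P P] by (auto simp: order_zero_def)

text \<open>The hypothesis \<open>comm\<close> makes the product of a hermitian and a skew operator
  skew. The norm bound would hold with 1; the constant 2 is dictated by the cutoff
  commutator.\<close>

lemma first_order_product:
  assumes P: "order_zero A J x P" and J: "finite J" "s \<in> J"
    and w: "w = (\<lambda>m. 1 + (\<Sum>j\<in>J. (x j m)\<^sup>2))"
    and comm: "\<And>\<xi>. \<xi> \<in> fin_supp A \<Longrightarrow> deriv_op (x s) (P \<xi>) = P (deriv_op (x s) \<xi>)"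
  shows "first_order A J x w (\<lambda>\<xi>. P (deriv_op (x s) \<xi>)) 2"
  unfolding first_order_def
proof (intro conjI ballI allI)
  note D = deriv_op_sobolev[OF J w]
  have b: "bdd_op A P" by (rule order_zeroD(2)[OF P])
  have a: "deriv_op (x s) (\<lambda>m. \<xi> m + \<eta> m) = (\<lambda>m. deriv_op (x s) \<xi> m + deriv_op (x s) \<eta> m)"
    "deriv_op (x s) (\<lambda>m. a * \<xi> m) = (\<lambda>m. a * deriv_op (x s) \<xi> m)" for \<xi> \<eta> a
    by (simp_all add: deriv_op_def algebra_simps)
  show "lin_on (sobolev A w) (\<lambda>\<xi>. P (deriv_op (x s) \<xi>))"
    unfolding lin_on_def a by (auto simp: bdd_op_add[OF b] bdd_op_cmul[OF b] D)
  fix \<xi> :: "_ \<Rightarrow> complex"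
  {
    assume \<xi>: "\<xi> \<in> sobolev A w"
    show "P (deriv_op (x s) \<xi>) \<in> ell2 A" by (rule bdd_op_ell2[OF b D(1)[OF \<xi>]])
    have "ell2_norm A (P (deriv_op (x s) \<xi>)) \<le> ell2_norm A (\<lambda>m. sqrt (w m) *\<^sub>R \<xi> m)"
      using order_zeroD(3)[OF P D(1)[OF \<xi>]] D(2)[OF \<xi>] by linarith
    then show "ell2_norm A (P (deriv_op (x s) \<xi>)) \<le> 2 * ell2_norm A (\<lambda>m. sqrt (w m) *\<^sub>R \<xi> m)"
      using ell2_norm_nonneg[of A "\<lambda>m. sqrt (w m) *\<^sub>R \<xi> m"] by linarith
  next
    fix \<eta> :: "_ \<Rightarrow> complex" assume \<xi>: "\<xi> \<in> fin_supp A" and \<eta>: "\<eta> \<in> fin_supp A"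
    have "ell2_inner A (P (deriv_op (x s) \<xi>)) \<eta> = ell2_inner A (deriv_op (x s) \<xi>) (P \<eta>)"
      by (rule adjoint_pairD[OF order_zeroD(1)[OF P]]) (intro fin_supp_ell2 deriv_op_fin_supp \<xi> \<eta>)+
    then show "ell2_inner A (P (deriv_op (x s) \<xi>)) \<eta> = - ell2_inner A \<xi> (P (deriv_op (x s) \<eta>))"
      by (simp add: deriv_op_skew comm \<eta>)
  next
    fix n assume \<xi>: "\<xi> \<in> fin_supp A"
    have "deriv_op (x s) (\<lambda>m. cutoff J x n m *\<^sub>R \<xi> m) = (\<lambda>m. cutoff J x n m *\<^sub>R deriv_op (x s) \<xi> m)"
      by (simp add: deriv_op_def)
    then show "ell2_norm A (\<lambda>m. P (deriv_op (x s) (\<lambda>m. cutoff J x n m *\<^sub>R \<xi> m)) m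
        - cutoff J x n m *\<^sub>R P (deriv_op (x s) \<xi>) m) \<le> 2 * ell2_norm A \<xi>"
      using P J \<xi> by (simp add: order_zero_def)
  }
qed simp

text \<open>As the coefficients commute with each other, and the derivations do too, the
  second-order parts cancel: what remains is \<open>P\<close> applied to the commutator of the
  \<open>s\<close>-th derivation with \<open>Q\<close>, minus \<open>Q\<close> applied to the
  commutator of the \<open>t\<close>-th derivation with \<open>P\<close>, each acting on a first
  derivative of \<xi>.\<close>

lemma first_order_commutator:
  assumes P: "order_zero A J x P" and Q: "order_zero A J x Q" and PQ: "commute_on A P Q"
    and J: "finite J" "s \<in> J" "t \<in> J" and \<xi>: "\<xi> \<in> fin_supp A"
  shows "(ell2_norm A (\<lambda>m. P (deriv_op (x s) (Q (deriv_op (x t) \<xi>))) m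
      - Q (deriv_op (x t) (P (deriv_op (x s) \<xi>))) m))\<^sup>2
    \<le> 4 * (\<Sum>j\<in>J. (ell2_norm A (deriv_op (x j) \<xi>))\<^sup>2)"
proof -
  let ?s = "deriv_op (x s) \<xi>" and ?t = "deriv_op (x t) \<xi>"
  let ?d = "\<lambda>m. deriv_op (x s) (Q ?t) m - Q (deriv_op (x s) ?t) m"
  let ?e = "\<lambda>m. deriv_op (x t) (P ?s) m - P (deriv_op (x t) ?s) m"
  note fs = deriv_op_fin_supp order_zeroD(4)[OF P] order_zeroD(4)[OF Q]
  have F: "?s \<in> fin_supp A" "?t \<in> fin_supp A" by (intro fs \<xi>)+
  have E: "deriv_op (x s) (Q ?t) \<in> ell2 A" "Q (deriv_op (x s) ?t) \<in> ell2 A"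
    "deriv_op (x t) (P ?s) \<in> ell2 A" "P (deriv_op (x t) ?s) \<in> ell2 A" "deriv_op (x s) ?t \<in> ell2 A"
    by (intro fin_supp_ell2 fs F)+
  have de: "?d \<in> ell2 A" "?e \<in> ell2 A" by (intro ell2_diff E)+
  have swap: "deriv_op (x s) ?t = deriv_op (x t) ?s" by (auto simp: deriv_op_def)
  have "P (Q (deriv_op (x s) ?t)) = Q (P (deriv_op (x t) ?s))"
    using PQ E(5) unfolding commute_on_def swap by blast
  then have "(\<lambda>m. P (deriv_op (x s) (Q ?t)) m - Q (deriv_op (x t) (P ?s)) m) = (\<lambda>m. P ?d m - Q ?e m)"
    by (simp add: bdd_op_diff[OF order_zeroD(2)[OF P]] bdd_op_diff[OF order_zeroD(2)[OF Q]] E)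
  then have "ell2_norm A (\<lambda>m. P (deriv_op (x s) (Q ?t)) m - Q (deriv_op (x t) (P ?s)) m)
      \<le> ell2_norm A (P ?d) + ell2_norm A (Q ?e)"
    using ell2_norm_diff_le[OF bdd_op_ell2[OF order_zeroD(2)[OF P] de(1)] bdd_op_ell2[OF order_zeroD(2)[OF Q] de(2)]]
    by simp
  also have "\<dots> \<le> ell2_norm A ?d + ell2_norm A ?e"
    by (intro add_mono order_zeroD(3)[OF P] order_zeroD(3)[OF Q] de)
  also have "\<dots> \<le> ell2_norm A ?t + ell2_norm A ?s"
    by (intro add_mono order_zeroD(5)[OF P] order_zeroD(5)[OF Q] J F)
  finally have "(ell2_norm A (\<lambda>m. P (deriv_op (x s) (Q ?t)) m - Q (deriv_op (x t) (P ?s)) m))\<^sup>2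
      \<le> (ell2_norm A ?t + ell2_norm A ?s)\<^sup>2"
    by (rule power_mono) simp
  \<comment> \<open>Each of the two squares is at most the full sum, also when \<open>s = t\<close>;
    twice two gives the factor 4.\<close>
  also have "\<dots> \<le> 2 * (ell2_norm A ?t)\<^sup>2 + 2 * (ell2_norm A ?s)\<^sup>2"
    using sum_squares_bound[of "ell2_norm A ?t" "ell2_norm A ?s"] by (simp add: power2_sum)
  also have "\<dots> \<le> 4 * (\<Sum>j\<in>J. (ell2_norm A (deriv_op (x j) \<xi>))\<^sup>2)"
    using member_le_sum[OF J(2), of "\<lambda>j. (ell2_norm A (deriv_op (x j) \<xi>))\<^sup>2"]
      member_le_sum[OF J(3), of "\<lambda>j. (ell2_norm A (deriv_op (x j) \<xi>))\<^sup>2"] J(1) by simp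
  finally show ?thesis .
qed

text \<open>An imaginary multiple of a hermitian operator is skew. If \<open>B\<close> bounds it,
  its commutator with a cutoff, a contraction, costs \<open>B\<close> twice, hence the constant
  \<open>2 * B\<close>.\<close>

lemma first_order_bounded:
  assumes H: "hermitian A H" and z: "cnj z = - z" and w: "\<And>m. 1 \<le> w m"
  obtains C where "first_order A J x w (\<lambda>\<xi> m. z * H \<xi> m) C"
    "\<And>\<xi>. \<xi> \<in> fin_supp A \<Longrightarrow> ell2_norm A (\<lambda>m. z * H \<xi> m) \<le> C * ell2_norm A \<xi>"
proof -
  let ?T = "\<lambda>\<xi> m. z * H \<xi> m"
  have bH: "bdd_op A H" by (rule adjoint_pair_bdd(1)[OF H])
  have bT: "bdd_op A ?T" using bdd_op_comb[OF bH bH, of z 0] by simp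
  obtain B where B: "0 \<le> B" "\<And>\<xi>. \<xi> \<in> ell2 A \<Longrightarrow> ell2_norm A (?T \<xi>) \<le> B * ell2_norm A \<xi>"
    using bdd_op_bound[OF bT] by blast
  have sob: "\<xi> \<in> ell2 A" if "\<xi> \<in> sobolev A w" for \<xi> using that by (simp add: sobolev_def)
  have "first_order A J x w ?T (2 * B)"
    unfolding first_order_def
  proof (intro conjI ballI allI)
    show "0 \<le> 2 * B" using B by simp
    show "lin_on (sobolev A w) ?T"
      using bT unfolding bdd_op_def lin_on_def by (simp add: sobolev_def)
    fix \<xi> :: "_ \<Rightarrow> complex"
    {
      assume \<xi>: "\<xi> \<in> sobolev A w"
      show "?T \<xi> \<in> ell2 A" by (rule bdd_op_ell2[OF bT sob[OF \<xi>]])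
      have "norm (\<xi> m) \<le> 1 * norm (sqrt (w m) *\<^sub>R \<xi> m)" for m
        using mult_right_mono[of 1 "sqrt (w m)" "norm (\<xi> m)"] w[of m] by simp
      then have "ell2_norm A \<xi> \<le> 1 * ell2_norm A (\<lambda>m. sqrt (w m) *\<^sub>R \<xi> m)"
        using \<xi> ell2_outside[OF sob[OF \<xi>]] by (intro ell2_norm_dominated) (auto simp: sobolev_def)
      then have "B * ell2_norm A \<xi> \<le> 2 * B * ell2_norm A (\<lambda>m. sqrt (w m) *\<^sub>R \<xi> m)"
        using B(1) by (intro mult_mono) auto
      then show "ell2_norm A (?T \<xi>) \<le> 2 * B * ell2_norm A (\<lambda>m. sqrt (w m) *\<^sub>R \<xi> m)"
        using B(2)[OF sob[OF \<xi>]] by linarith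
    next
      fix \<eta> :: "_ \<Rightarrow> complex" assume "\<xi> \<in> fin_supp A" "\<eta> \<in> fin_supp A"
      then show "ell2_inner A (?T \<xi>) \<eta> = - ell2_inner A \<xi> (?T \<eta>)"
        using adjoint_pairD[OF H, of \<xi> \<eta>] z by (simp add: scal.ip_sm_left scal.ip_sm_right fin_supp_ell2)
    next
      fix n assume "\<xi> \<in> fin_supp A"
      then have \<xi>: "\<xi> \<in> ell2 A" by (rule fin_supp_ell2)
      have c: "(\<lambda>m. cutoff J x n m *\<^sub>R \<zeta> m) \<in> ell2 A \<and> ell2_norm A (\<lambda>m. cutoff J x n m *\<^sub>R \<zeta> m) \<le> ell2_norm A \<zeta>"
        if "\<zeta> \<in> ell2 A" for \<zeta> :: "'a \<Rightarrow> complex"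
      proof -
        have "0 \<le> cutoff J x n m" "cutoff J x n m \<le> 1" for m
          by (auto simp: cutoff_def sum_nonneg)
        then have "norm (cutoff J x n m *\<^sub>R \<zeta> m) \<le> 1 * norm (\<zeta> m)" for m
          by (simp add: mult_left_le_one_le)
        then show ?thesis
          using ell2_dominated[OF that, of 1 "\<lambda>m. cutoff J x n m *\<^sub>R \<zeta> m"]
            ell2_norm_dominated[OF that, of 1 "\<lambda>m. cutoff J x n m *\<^sub>R \<zeta> m"] ell2_outside[OF that] by auto
      qed
      have T: "?T \<xi> \<in> ell2 A" by (rule bdd_op_ell2[OF bT \<xi>])
      have "ell2_norm A (\<lambda>m. ?T (\<lambda>m. cutoff J x n m *\<^sub>R \<xi> m) m - cutoff J x n m *\<^sub>R ?T \<xi> m)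
          \<le> ell2_norm A (?T (\<lambda>m. cutoff J x n m *\<^sub>R \<xi> m)) + ell2_norm A (\<lambda>m. cutoff J x n m *\<^sub>R ?T \<xi> m)"
        using c[OF \<xi>] c[OF T] by (intro ell2_norm_diff_le bdd_op_ell2[OF bT]) auto
      also have "\<dots> \<le> B * ell2_norm A (\<lambda>m. cutoff J x n m *\<^sub>R \<xi> m) + ell2_norm A (?T \<xi>)"
        using c[OF \<xi>] c[OF T] by (intro add_mono B(2)) auto
      also have "\<dots> \<le> B * ell2_norm A \<xi> + B * ell2_norm A \<xi>"
        using c[OF \<xi>] B by (intro add_mono mult_left_mono B(2) \<xi>) auto
      finally show "ell2_norm A (\<lambda>m. ?T (\<lambda>m. cutoff J x n m *\<^sub>R \<xi> m) m - cutoff J x n m *\<^sub>R ?T \<xi> m)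
          \<le> 2 * B * ell2_norm A \<xi>" by simp
    }
  qed
  moreover have "ell2_norm A (?T \<xi>) \<le> 2 * B * ell2_norm A \<xi>" if "\<xi> \<in> fin_supp A" for \<xi>
    using B(2)[OF fin_supp_ell2[OF that]] mult_nonneg_nonneg[OF B(1) ell2_norm_nonneg[of A \<xi>]] by linarith
  ultimately show ?thesis by (rule that)
qed

lemma order_zero_id:
  shows "order_zero A J x (\<lambda>\<xi>. \<xi>)"
proof -
  have "bdd_op A (\<lambda>\<xi>. \<xi>)"
    unfolding bdd_op_def lin_on_def by (auto intro!: exI[of _ 1])
  then show ?thesis by (simp add: order_zero_def adjoint_pair_def)
qed

context twisted_group
begin

context
  fixes u s J and x :: "nat \<Rightarrow> 'g \<Rightarrow> real" and P a b
  assumes u: "u \<in> carrier G" and J: "finite J"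
    and x: "\<And>j p. j \<in> J \<Longrightarrow> p \<in> carrier G \<Longrightarrow> x j (p \<otimes> inv u) = x j p - (if j = s then 1 else 0)"
    and P: "\<And>\<xi>. \<xi> \<in> ell2 (carrier G) \<Longrightarrow> P \<xi> = (\<lambda>m. a * W_op G \<sigma> u \<xi> m + b * Wadj u \<xi> m)"
begin

lemma x_mult: "j \<in> J \<Longrightarrow> p \<in> carrier G \<Longrightarrow> x j (p \<otimes> u) = x j p + (if j = s then 1 else 0)"
  using x[of j "p \<otimes> u"] u by (auto simp: m_assoc)

text \<open>Translation by \<open>u\<close> changes the \<open>s\<close>-th coordinate by 1 and no
  other one. The \<open>s\<close>-th derivation therefore reproduces
  \<open>W_op G \<sigma> u\<close> with factor \<open>\<i>\<close> and its adjoint with factor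
  \<open>- \<i>\<close>, and the remaining derivations commute with both.\<close>

lemma deriv_op_W_commutator:
  assumes "j \<in> J" "\<xi> \<in> fin_supp (carrier G)"
  shows "deriv_op (x j) (P \<xi>) m - P (deriv_op (x j) \<xi>) m
    = (if j = s then \<i> * (a * W_op G \<sigma> u \<xi> m + (- b) * Wadj u \<xi> m) else 0)"
proof -
  have "P \<xi> = (\<lambda>m. a * W_op G \<sigma> u \<xi> m + b * Wadj u \<xi> m)"
    "P (deriv_op (x j) \<xi>) = (\<lambda>m. a * W_op G \<sigma> u (deriv_op (x j) \<xi>) m + b * Wadj u (deriv_op (x j) \<xi>) m)"
    using assms(2) by (intro P fin_supp_ell2 deriv_op_fin_supp; simp)+
  note e = this
  show ?thesis
  proof (cases "m \<in> carrier G")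
    case True
    note X = x[OF assms(1) True] x_mult[OF assms(1) True]
    show ?thesis
      unfolding e by (simp add: deriv_op_def W_op_def Wadj_def wshift_def True X) (simp add: algebra_simps)
  next
    case False
    then show ?thesis unfolding e by (simp add: deriv_op_def W_op_def Wadj_def wshift_def)
  qed
qed

text \<open>Both \<open>P\<close> and its commutator with the \<open>s\<close>-th derivation are
  combinations of two unitaries with coefficients of modulus 1/2, hence contractions. The same
  halves average the two estimates from \<open>wshift_cutoff\<close>.\<close>

lemma order_zero_W:
  assumes H: "hermitian (carrier G) P" and ab: "norm a = 1 / 2" "norm b = 1 / 2"
  shows "order_zero (carrier G) J x P"
  unfolding order_zero_def
proof (intro conjI ballI allI H)
  let ?A = "carrier G"
  note bW = adjoint_pair_bdd[OF adjoint_pair_W[OF u]]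
  have comb: "ell2_norm ?A (\<lambda>m. a * \<xi> m + b' * \<eta> m) \<le> c"
    if "\<xi> \<in> ell2 ?A" "\<eta> \<in> ell2 ?A" "ell2_norm ?A \<xi> \<le> c" "ell2_norm ?A \<eta> \<le> c" "norm b' = 1 / 2" for \<xi> \<eta> c b'
    using ell2_norm_triangle[OF scal.ell2_sm[OF that(1)] scal.ell2_sm[OF that(2)], of a b'] that ab
    by (simp add: scal.ell2_norm_sm)
  have Wcomb: "ell2_norm ?A (\<lambda>m. a * W_op G \<sigma> u \<xi> m + b' * Wadj u \<xi> m) \<le> ell2_norm ?A \<xi>"
    if "\<xi> \<in> ell2 ?A" "norm b' = 1 / 2" for \<xi> b'
    using that by (intro comb bdd_op_ell2[OF bW(1)] bdd_op_ell2[OF bW(2)])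
      (simp_all add: ell2_norm_W[OF u] ell2_norm_Wadj[OF u])
  show "ell2_norm ?A (P \<xi>) \<le> ell2_norm ?A \<xi>" if "\<xi> \<in> ell2 ?A" for \<xi>
    using Wcomb[OF that ab(2)] P[OF that] by simp
  have fs: "W_op G \<sigma> u \<xi> \<in> fin_supp ?A" "Wadj u \<xi> \<in> fin_supp ?A" if "\<xi> \<in> fin_supp ?A" for \<xi>
    using that unfolding W_op_eq_wshift Wadj_def
    by (auto intro!: wshift_fin_supp bij_betw_imp_inj_on[OF W_shift(1)[OF u]] bij_betw_imp_inj_on[OF Wadj_shift(1)[OF u]])
  show "P \<xi> \<in> fin_supp ?A" if "\<xi> \<in> fin_supp ?A" for \<xi>
    unfolding P[OF fin_supp_ell2[OF that]]
    by (rule fin_supp_add; rule fin_supp_pointwise[OF fs(1)[OF that]] fin_supp_pointwise[OF fs(2)[OF that]]; simp)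
  show "ell2_norm ?A (\<lambda>m. deriv_op (x j) (P \<xi>) m - P (deriv_op (x j) \<xi>) m) \<le> ell2_norm ?A \<xi>"
    if "j \<in> J" "\<xi> \<in> fin_supp ?A" for j \<xi>
  proof (cases "j = s")
    case True
    have "(\<lambda>m. deriv_op (x j) (P \<xi>) m - P (deriv_op (x j) \<xi>) m)
        = (\<lambda>m. \<i> * (a * W_op G \<sigma> u \<xi> m + (- b) * Wadj u \<xi> m))"
      unfolding deriv_op_W_commutator[OF that] using True by simp
    then show ?thesis
      using Wcomb[OF fin_supp_ell2[OF that(2)], of "- b"] ab by (simp only: scal.ell2_norm_sm) simp
  next
    case False
    then show ?thesis unfolding deriv_op_W_commutator[OF that] by simp
  qed
  show "ell2_norm ?A (\<lambda>m. P (\<lambda>m. cutoff J x n m *\<^sub>R deriv_op (x j) \<xi> m) m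
      - cutoff J x n m *\<^sub>R P (deriv_op (x j) \<xi>) m) \<le> 2 * ell2_norm ?A \<xi>"
    if j: "j \<in> J" and \<xi>: "\<xi> \<in> fin_supp ?A" for j \<xi> n
  proof -
    \<comment> \<open>At most one coordinate moves, and by 1: this is the hypothesis
      \<open>near\<close> of \<open>wshift_cutoff\<close> for both translations.\<close>
    have delta: "(\<Sum>j\<in>J. \<bar>if j = s then 1 else 0\<bar>) \<le> (1 :: real)"
      using J by (simp add: if_distrib[of abs] sum.delta cong: if_cong)
    note c1 = wshift_cutoff[OF W_shift[OF u] fin_supp_ell2[OF \<xi>] J j, where x = x and n = n]
    note c2 = wshift_cutoff[OF Wadj_shift[OF u] fin_supp_ell2[OF \<xi>] J j, where x = x and n = n]
    let ?V = "\<lambda>T m. T (\<lambda>m. cutoff J x n m *\<^sub>R deriv_op (x j) \<xi> m) m - cutoff J x n m *\<^sub>R T (deriv_op (x j) \<xi>) m"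
    have near: "(\<Sum>j\<in>J. \<bar>x j p - x j (p \<otimes> inv u)\<bar>) \<le> 1" "(\<Sum>j\<in>J. \<bar>x j p - x j (p \<otimes> u)\<bar>) \<le> 1"
      if "p \<in> ?A" for p
      using delta by (simp_all add: x x_mult that cong: sum.cong if_cong)
    have e: "deriv_op (x j) \<xi> \<in> ell2 ?A" "(\<lambda>m. cutoff J x n m *\<^sub>R deriv_op (x j) \<xi> m) \<in> ell2 ?A"
      by (intro fin_supp_ell2 deriv_op_fin_supp \<xi>, intro fin_supp_ell2 fin_supp_pointwise[OF deriv_op_fin_supp[OF \<xi>, of "x j"]])
        simp
    have "?V P = (\<lambda>m. a * ?V (W_op G \<sigma> u) m + b * ?V (Wadj u) m)"
      unfolding P[OF e(1)] P[OF e(2)] by (simp add: algebra_simps scaleR_conv_of_real)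
    then show ?thesis
      using comb[of "?V (W_op G \<sigma> u)" "?V (Wadj u)" "2 * ell2_norm ?A \<xi>" b] c1 c2 near ab
      by (simp add: W_op_eq_wshift Wadj_def)
  qed
qed

end

end

section \<open>The finite quotients of the lattice\<close>

lemma Zk_unit_vec:
  assumes "2 \<le> k s"
  shows "unit_vec q s \<in> carrier (Zk q k)"
proof -
  \<comment> \<open>Modulo 1 the only representative is 0, and the entry 1 of the unit vector would
    lie outside the carrier.\<close>
  have "modulus (k s) \<noteq> 1" using assms by (auto simp: modulus_def numeral_eq_enat one_enat_def split: enat.splits)
  then show ?thesis
    unfolding Zk_def unit_vec_def by (auto simp: PiE_iff)
qed

text \<open>An infinite \<open>k j\<close> has modulus 0, so this coordinate is an honest integer
  and subtraction involves no reduction. Finite coordinates may wrap around, but they do not enter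
  the weight or the derivations.\<close>

lemma Zk_coordinate_shift:
  assumes "p \<in> carrier (Zk q k)" "2 \<le> k s" "j \<in> {1..q}" "k j = \<infinity>"
  shows "(p \<otimes>\<^bsub>Zk q k\<^esub> inv\<^bsub>Zk q k\<^esub> unit_vec q s) j = p j - (if j = s then 1 else 0)"
proof -
  have "modulus (k j) = 0" using assms(4) by (simp add: modulus_def)
  moreover have u: "unit_vec q s \<in> (\<Pi>\<^sub>E i\<in>{1..q}. carrier (integer_mod_group (modulus (k i))))"
    using Zk_unit_vec[where k = k and q = q and s = s, OF assms(2)] by (simp add: Zk_def)
  moreover have "unit_vec q s j \<in> carrier (integer_mod_group (modulus (k j)))"
    using u assms(3) by blast
  ultimately show ?thesis
    using assms(3) by (simp add: Zk_def inv_product_group[OF u]) (simp add: unit_vec_def)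
qed

lemma finite_Zk_sublevel:
  assumes "\<And>j. j \<in> {1..q} \<Longrightarrow> 2 \<le> k j"
  shows "finite {m \<in> carrier (Zk q k). 1 + inf_form q k m \<le> r}"
proof (rule finite_subset)
  let ?S = "\<lambda>j. if k j = \<infinity> then {- \<lceil>r\<rceil>..\<lceil>r\<rceil>} else {0..<int (modulus (k j))}"
  show "finite (\<Pi>\<^sub>E j\<in>{1..q}. ?S j)" by (intro finite_PiE) auto
  show "{m \<in> carrier (Zk q k). 1 + inf_form q k m \<le> r} \<subseteq> (\<Pi>\<^sub>E j\<in>{1..q}. ?S j)"
  proof clarify
    fix m assume m: "m \<in> carrier (Zk q k)" "1 + inf_form q k m \<le> r"
    have "m j \<in> ?S j" if j: "j \<in> {1..q}" for j
    proof (cases "k j = \<infinity>")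
      case True
      have "(real_of_int (m j))\<^sup>2 \<le> inf_form q k m"
        unfolding inf_form_def by (rule member_le_sum) (use j True in auto)
      then have "real_of_int ((m j)\<^sup>2) \<le> r" using m(2) by simp
      then have "(m j)\<^sup>2 \<le> \<lceil>r\<rceil>" by linarith
      \<comment> \<open>For integers the absolute value is at most the square, which turns the bound
        on the form into a bound on the coordinate.\<close>
      moreover have "\<bar>m j\<bar> \<le> (m j)\<^sup>2"
        using self_le_power[of "\<bar>m j\<bar>" 2] by (cases "m j = 0") auto
      ultimately have "\<bar>m j\<bar> \<le> \<lceil>r\<rceil>" by linarith
      then show ?thesis using True by (auto simp: abs_le_iff)
    next
      case False
      then have "modulus (k j) \<noteq> 0"
        using assms[OF j] by (auto simp: modulus_def numeral_eq_enat split: enat.splits)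
      moreover have "m j \<in> carrier (integer_mod_group (modulus (k j)))"
        using m(1) j by (auto simp: Zk_def)
      ultimately show ?thesis using False by (auto simp: carrier_integer_mod_group)
    qed
    then show "m \<in> (\<Pi>\<^sub>E j\<in>{1..q}. ?S j)" using m(1) by (auto simp: Zk_def PiE_iff)
  qed
qed

section \<open>Clifford matrices\<close>

lemma cliff_gen_carrier: "j \<in> {1..N} \<Longrightarrow> cliff_gen j \<in> cliff_carrier N"
  by (auto simp: cliff_carrier_def cliff_monom_def)

lemma cliff_one_carrier: "cliff_one \<in> cliff_carrier N"
  by (auto simp: cliff_carrier_def cliff_monom_def)

lemma cliff_mult_carrier: "cliff_mult N a b \<in> cliff_carrier N"
proof -
  have "cliff_mult N a b K = 0" if "\<not> K \<subseteq> {1..N}" for K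
    unfolding cliff_mult_def
  proof (intro sum.neutral ballI)
    fix I J assume "I \<in> Pow {1..N}" "J \<in> Pow {1..N}"
    then have "K \<noteq> sym_diff I J" using that by auto
    then show "a I * b J * cliff_sign I J * cliff_monom (sym_diff I J) K = 0"
      by (simp add: cliff_monom_def)
  qed
  then show ?thesis by (simp add: cliff_carrier_def)
qed

context
  fixes N and c :: "clifford \<Rightarrow> complex ^ 's ^ 's"
  assumes c: "faithful_clifford_rep N c"
begin

lemma clifford_rep_uminus: "a \<in> cliff_carrier N \<Longrightarrow> c (\<lambda>I. - a I) = - c a"
proof -
  assume a: "a \<in> cliff_carrier N"
  have "c (\<lambda>I. -1 * a I) = map_matrix ((*) (-1)) (c a)"
    using c a unfolding faithful_clifford_rep_def by blast
  then show ?thesis by (simp add: map_matrix_def vec_eq_iff)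
qed

lemma clifford_rep_mult:
  "a \<in> cliff_carrier N \<Longrightarrow> b \<in> cliff_carrier N \<Longrightarrow> c (cliff_mult N a b) = c a ** c b"
  using c unfolding faithful_clifford_rep_def by blast

lemma clifford_matrix_skew: "j \<in> {1..N} \<Longrightarrow> madj (c (cliff_gen j)) = - c (cliff_gen j)"
  using c clifford_rep_uminus[OF cliff_gen_carrier, of j] cliff_gen_carrier[of j N]
  unfolding faithful_clifford_rep_def madj_def by (simp flip: cliff_gen_star)

lemma clifford_matrix_square:
  assumes "j \<in> {1..N}"
  shows "c (cliff_gen j) ** c (cliff_gen j) = - mat 1"
proof -
  have "c (cliff_gen j) ** c (cliff_gen j) = c (\<lambda>K. - cliff_one K)"
    by (rule clifford_rep_mult[OF cliff_gen_carrier cliff_gen_carrier, OF assms assms,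
        unfolded cliff_gen_square[OF assms], symmetric])
  also have "\<dots> = - mat 1"
    using c by (simp add: clifford_rep_uminus cliff_one_carrier faithful_clifford_rep_def)
  finally show ?thesis .
qed

lemma clifford_matrix_anticommute:
  assumes "j \<in> {1..N}" "l \<in> {1..N}" "j \<noteq> l"
  shows "c (cliff_gen j) ** c (cliff_gen l) = - (c (cliff_gen l) ** c (cliff_gen j))"
proof -
  have "c (cliff_gen j) ** c (cliff_gen l) = c (cliff_mult N (cliff_gen j) (cliff_gen l))"
    by (rule clifford_rep_mult[symmetric]) (intro cliff_gen_carrier assms)+
  also have "\<dots> = c (\<lambda>K. - cliff_mult N (cliff_gen l) (cliff_gen j) K)"
    by (simp only: cliff_gen_anticommute[OF assms])
  also have "\<dots> = - (c (cliff_gen l) ** c (cliff_gen j))"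
    using clifford_rep_mult[OF cliff_gen_carrier cliff_gen_carrier, OF assms(2,1)]
    by (simp add: clifford_rep_uminus cliff_mult_carrier)
  finally show ?thesis .
qed

end

section \<open>The Dirac operators\<close>

text \<open>The statement for a single index. Of the relations between the unitaries it uses those
  with infinite \<open>k j\<close>, where the scalar is 1; they give the commutation of the
  coefficients in the principal part.\<close>

lemma Dirac_self_adjoint_compact_resolvent:
  fixes d d' :: nat and f :: "nat \<Rightarrow> nat" and k k' :: "nat \<Rightarrow> enat"
    and \<sigma>' :: "(nat \<Rightarrow> int) \<Rightarrow> (nat \<Rightarrow> int) \<Rightarrow> complex"
    and c :: "clifford \<Rightarrow> complex ^ 's ^ 's"
  assumes dd: "d \<le> d'" and f: "\<And>j. j \<in> {1..d'} \<Longrightarrow> f j \<in> {1..d'}" "\<And>j. j \<in> {1..d'} \<Longrightarrow> f j \<noteq> j"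
    and k2: "\<And>j. j \<in> {1..d'} \<Longrightarrow> 2 \<le> k' j" and kk: "\<And>j. j \<in> {1..d} \<Longrightarrow> k' j = k j"
    and \<sigma>': "\<And>x y. x \<in> carrier (Zk d' k') \<Longrightarrow> y \<in> carrier (Zk d' k') \<Longrightarrow> norm (\<sigma>' x y) = 1"
    and commute: "\<And>j s. j \<in> {1..d} \<Longrightarrow> k j = \<infinity> \<Longrightarrow> s \<in> {1..d'} \<Longrightarrow>
      commute_on (carrier (Zk d' k')) (U_op d' k' \<sigma>' (f j)) (U_op d' k' \<sigma>' s)"
    and c: "faithful_clifford_rep (d + d') c"
  shows "self_adjoint (carrier (Zk d' k')) (D_dom d' k') (D_op d d' f k k' \<sigma>' c) \<and>
    compact_resolvent (carrier (Zk d' k')) (D_dom d' k') (D_op d d' f k k' \<sigma>' c)"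
proof -
  define A where "A = carrier (Zk d' k')"
  define J where "J = {j \<in> {1..d'}. k' j = \<infinity>}"
  define x :: "nat \<Rightarrow> (nat \<Rightarrow> int) \<Rightarrow> real" where "x j p = real_of_int (p j)" for j p
  define w where "w = (\<lambda>m. 1 + (\<Sum>j\<in>J. (x j m)\<^sup>2))"
  \<comment> \<open>The direction to which the \<open>l\<close>-th summand belongs: directions up to
    \<open>d\<close> occur twice, as \<open>l\<close> and \<open>d + l\<close>, the others once. The
    summand is unbounded exactly when its direction is infinite.\<close>
  define dir where "dir l = (if l \<le> d then l else l - d)" for l
  define L where "L = {l \<in> {1..d + d'}. dir l \<in> J}"
  define \<epsilon> :: "nat \<Rightarrow> complex" where "\<epsilon> j = (if j < f j then 1 else -1)" for j
  define P where "P l = (if l \<le> d then X_op d' f k' \<sigma>' l else if l \<le> 2 * d then Y_op d' f k' \<sigma>' (l - d)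
    else (\<lambda>\<xi>. \<xi>))" for l
  \<comment> \<open>Together with \<open>b\<close>, the coefficients that express
    \<open>X_op\<close> and \<open>Y_op\<close> through the unitary and its adjoint; the sign
    \<epsilon> is the one in the definition of \<open>Y_op\<close>.\<close>
  define a where "a l = (if l \<le> d then 1 / 2 else \<epsilon> (dir l) / (2 * \<i>))" for l
  define b where "b l = (if l \<le> d then 1 / 2 else - \<epsilon> (dir l) / (2 * \<i>))" for l
  let ?\<Gamma> = "Gamma_op d d' f k k' \<sigma>'"
  let ?u = "\<lambda>s. unit_vec d' s"
  interpret G: comm_group "Zk d' k'" by (rule comm_group_Zk)
  interpret twisted_group "Zk d' k'" \<sigma>' by unfold_locales (rule \<sigma>')
  have w_inf: "w = (\<lambda>m. 1 + inf_form d' k' m)" by (simp add: w_def inf_form_def J_def x_def)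
  have w1: "1 \<le> w m" for m by (simp add: w_def sum_nonneg)
  have J: "finite J" by (simp add: J_def)
  have deriv: "deriv_op (x j) = partial_op j" for j by (simp add: deriv_op_def partial_op_def x_def)
  have u: "?u s \<in> carrier (Zk d' k')" if "s \<in> {1..d'}" for s by (rule Zk_unit_vec[of k' s, OF k2[OF that]])
  have shift: "x j (p \<otimes>\<^bsub>Zk d' k'\<^esub> inv\<^bsub>Zk d' k'\<^esub> ?u s) = x j p - (if j = s then 1 else 0)"
    if "s \<in> {1..d'}" "j \<in> J" "p \<in> carrier (Zk d' k')" for j s p
    using Zk_coordinate_shift[of p d' k' s j] that k2 by (simp add: x_def J_def)
  have dir: "dir l \<in> {1..d'}" if "l \<in> {1..d + d'}" for l using that dd by (auto simp: dir_def)
  have dir2: "dir l \<in> {1..d}" if "l \<in> {1..2 * d}" for l using that by (auto simp: dir_def)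
  have fdir: "f (dir l) \<in> {1..d'}" if "l \<in> {1..2 * d}" for l using dir2[OF that] dd by (intro f) auto
  have pair: "adjoint_pair A (U_op d' k' \<sigma>' s) (Wadj (?u s))" if "s \<in> {1..d'}" for s
    unfolding A_def U_op_def by (rule adjoint_pair_W[OF u[OF that]])
  have hX: "hermitian A (X_op d' f k' \<sigma>' j)" and hY: "hermitian A (Y_op d' f k' \<sigma>' j)"
    if "j \<in> {1..d}" for j
  proof -
    have fj: "f j \<in> {1..d'}" using that dd by (intro f) auto
    show "hermitian A (X_op d' f k' \<sigma>' j)"
      unfolding X_op_def A_def[symmetric] by (rule hermitian_Re_op[OF pair[OF fj]])
    show "hermitian A (Y_op d' f k' \<sigma>' j)"
      unfolding Y_op_def A_def[symmetric]
      by (rule hermitian_scale_real[OF hermitian_Im_op[OF pair[OF fj]]]) simp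
  qed
  have P_eq: "P l \<xi> = (\<lambda>m. a l * W_op (Zk d' k') \<sigma>' (?u (f (dir l))) \<xi> m + b l * Wadj (?u (f (dir l))) \<xi> m)"
    if l: "l \<in> {1..2 * d}" and \<xi>: "\<xi> \<in> ell2 A" for l \<xi>
    using Re_op_eq[OF pair[OF fdir[OF l]] \<xi>] Im_op_eq[OF pair[OF fdir[OF l]] \<xi>] l
    by (auto simp: P_def X_op_def Y_op_def A_def[symmetric] a_def b_def dir_def \<epsilon>_def U_op_def algebra_simps)
  have P_id: "P l = (\<lambda>\<xi>. \<xi>)" if "\<not> l \<le> 2 * d" for l using that by (simp add: P_def)
  have P_zero: "order_zero A J x (P l)" if l: "l \<in> L" for l
  proof (cases "l \<le> 2 * d")
    case True
    then have l2: "l \<in> {1..2 * d}" using l by (simp add: L_def)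
    have herm: "hermitian A (P l)"
      using l2 dir2[OF l2] hX[of l] hY[of "l - d"] by (auto simp: P_def dir_def)
    show ?thesis
      unfolding A_def
    proof (rule order_zero_W[where x = x and s = "f (dir l)" and P = "P l" and a = "a l" and b = "b l", 
          OF u[OF fdir[OF l2]] J])
      show "hermitian (carrier (Zk d' k')) (P l)" using herm by (simp add: A_def)
      show "cmod (a l) = 1 / 2" "cmod (b l) = 1 / 2"
        by (auto simp: a_def b_def \<epsilon>_def norm_divide norm_mult)
    qed (use shift[OF fdir[OF l2]] P_eq[OF l2] in \<open>simp_all add: A_def\<close>)
  qed (simp add: P_id order_zero_id)
  have P_comm_deriv: "deriv_op (x (dir l)) (P l \<xi>) = P l (deriv_op (x (dir l)) \<xi>)"
    if l: "l \<in> L" and \<xi>: "\<xi> \<in> fin_supp A" for l \<xi>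
  proof (cases "l \<le> 2 * d")
    case True
    then have l2: "l \<in> {1..2 * d}" using l by (simp add: L_def)
    have "dir l \<in> J" using l by (simp add: L_def)
    \<comment> \<open>Freeness of fixed points enters here: the translation in direction
      \<open>f (dir l)\<close> leaves the coordinate \<open>dir l\<close> unchanged, so the
      commutator with this derivation vanishes.\<close>
    have ne: "dir l \<noteq> f (dir l)" using f(2)[of "dir l"] dir2[OF l2] dd by auto
    have "deriv_op (x (dir l)) (P l \<xi>) m - P l (deriv_op (x (dir l)) \<xi>) m
        = (if dir l = f (dir l) then \<i> * (a l * W_op (Zk d' k') \<sigma>' (?u (f (dir l))) \<xi> m
            + (- b l) * Wadj (?u (f (dir l))) \<xi> m) else 0)" for m
    proof (rule deriv_op_W_commutator[OF u[OF fdir[OF l2]]])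
      show "dir l \<in> J" by fact
    qed (use J shift[OF fdir[OF l2]] P_eq[OF l2] \<xi> in \<open>simp_all add: A_def\<close>)
    then have "deriv_op (x (dir l)) (P l \<xi>) m - P l (deriv_op (x (dir l)) \<xi>) m = 0" for m
      using ne by simp
    then show ?thesis by auto
  qed (simp add: P_id)
  have P_comm: "commute_on A (P l) (P l')" if l: "l \<in> L" "l' \<in> L" for l l'
  proof (cases "l \<le> 2 * d \<and> l' \<le> 2 * d")
    case True
    then have l2: "l \<in> {1..2 * d}" "l' \<in> {1..2 * d}" using l by (simp_all add: L_def)
    \<comment> \<open>The relation holds between \<open>U (f j)\<close> and any \<open>U s\<close>;
      here it is applied with \<open>j = dir l\<close> and \<open>s = f (dir l')\<close>.\<close>
    have "k (dir l) = \<infinity>" using l(1) kk[OF dir2[OF l2(1)]] by (simp add: L_def J_def)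
    note com = commute[OF dir2[OF l2(1)] this fdir[OF l2(2)]]
    show ?thesis
      unfolding A_def
      by (rule commute_on_W[OF u[OF fdir[OF l2(1)]] u[OF fdir[OF l2(2)]] com[unfolded U_op_def]])
        (rule P_eq[unfolded A_def], rule l2, assumption)+
  qed (auto simp: P_id commute_on_def)
  have \<Gamma>_L: "?\<Gamma> l = (\<lambda>\<xi>. P l (deriv_op (x (dir l)) \<xi>))" if "l \<in> L" for l
  proof -
    have k': "k' (dir l) = \<infinity>" and l: "l \<in> {1..d + d'}" using that by (simp_all add: L_def J_def)
    \<comment> \<open>\<open>Gamma_op\<close> decides by \<open>k\<close> for indices up to
      \<open>2 * d\<close> and by \<open>k'\<close> beyond; the two agree on the directions
      \<open>1..d\<close>.\<close>
    have "k (dir l) = \<infinity>" if "l \<le> 2 * d" using k' l that kk[OF dir2[of l]] by simp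
    then show ?thesis
      using k' unfolding Gamma_op_def P_def Let_def deriv by (auto simp: dir_def)
  qed
  have \<Gamma>_first_L: "first_order A J x w (?\<Gamma> l) 2" if "l \<in> L" for l
    unfolding \<Gamma>_L[OF that]
    by (rule first_order_product[OF P_zero[OF that] J _ w_def P_comm_deriv[OF that]])
      (use that in \<open>simp add: L_def\<close>)
  have \<Gamma>_first: "\<exists>C. first_order A J x w (?\<Gamma> l) C \<and>
      (l \<notin> L \<longrightarrow> (\<forall>\<xi>\<in>fin_supp A. ell2_norm A (?\<Gamma> l \<xi>) \<le> C * ell2_norm A \<xi>))"
    if l: "l \<in> {1..d + d'}" for l
  proof (cases "l \<in> L")
    case True
    then show ?thesis using \<Gamma>_first_L by blast
  next
    case False
    have k': "k' (dir l) \<noteq> \<infinity>" using False l dir[OF l] by (simp add: L_def J_def)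
    \<comment> \<open>In each of the three finite cases the scalar is a real number divided by
      \<open>2 * \<i> * pi\<close>, hence imaginary, and the operator is a commutator with a
      hermitian operator or an imaginary part.\<close>
    have "\<exists>H z. hermitian A H \<and> cnj z = - z \<and> ?\<Gamma> l = (\<lambda>\<xi> m. z * H \<xi> m)"
    proof -
      consider "l \<le> d" | "d < l" "l \<le> 2 * d" | "2 * d < l" by linarith
      then show ?thesis
      proof cases
        case 1
        then have l1: "l \<in> {1..d}" using l by simp
        then have "k l \<noteq> \<infinity>" using k' kk[of l] 1 by (simp add: dir_def)
        then have "?\<Gamma> l = (\<lambda>\<xi> m. (- of_nat (modulus (k l)) / (2 * \<i> * pi)) * commutator (Zk d' k') (Y_op d' f k' \<sigma>' l) \<xi> m)"
          using 1 by (simp add: Gamma_op_def del: not_infinity_eq)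
        moreover have "hermitian A (commutator (Zk d' k') (Y_op d' f k' \<sigma>' l))"
          unfolding A_def by (rule hermitian_commutator[OF hY[OF l1, unfolded A_def]])
        moreover have "cnj (- of_nat (modulus (k l)) / (2 * \<i> * pi)) = - (- of_nat (modulus (k l)) / (2 * \<i> * pi))"
          by simp
        ultimately show ?thesis by blast
      next
        case 2
        let ?j = "l - d"
        have l1: "?j \<in> {1..d}" using 2 by auto
        then have "k ?j \<noteq> \<infinity>" using k' kk[of ?j] 2 by (simp add: dir_def)
        then have "?\<Gamma> l = (\<lambda>\<xi> m. (of_nat (modulus (k ?j)) / (2 * \<i> * pi)) * commutator (Zk d' k') (X_op d' f k' \<sigma>' ?j) \<xi> m)"
          using 2 by (simp add: Gamma_op_def Let_def del: not_infinity_eq)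
        moreover have "hermitian A (commutator (Zk d' k') (X_op d' f k' \<sigma>' ?j))"
          unfolding A_def by (rule hermitian_commutator[OF hX[OF l1, unfolded A_def]])
        moreover have "cnj (of_nat (modulus (k ?j)) / (2 * \<i> * pi)) = - (of_nat (modulus (k ?j)) / (2 * \<i> * pi))"
          by simp
        ultimately show ?thesis by blast
      next
        case 3
        let ?j = "l - d"
        let ?h = "\<lambda>m :: nat \<Rightarrow> int. 1 - (\<Prod>i\<in>{1..d'}. z_gen k' ?j i powi m i)"
        let ?V = "\<lambda>(\<eta> :: (nat \<Rightarrow> int) \<Rightarrow> complex) p. \<eta> p - v_op d' (z_gen k' ?j) \<eta> p"
        have "norm (z_gen k' ?j i) = 1" for i by (simp add: z_gen_def norm_exp_eq_Re)
        then have "norm (\<Prod>i\<in>{1..d'}. z_gen k' ?j i powi m i) = 1" for m :: "nat \<Rightarrow> int"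
          by (simp add: prod_norm[symmetric] norm_power_int)
        \<comment> \<open>The operator \<open>1 - v\<close> is multiplication by 1 minus a
          unimodular monomial, so it is bounded and diagonal, with the conjugate multiplier as
          adjoint.\<close>
        then have "norm (?h m) \<le> 2" for m
          using norm_triangle_ineq4[of 1 "\<Prod>i\<in>{1..d'}. z_gen k' ?j i powi m i"] by simp
        then have "adjoint_pair A (\<lambda>\<xi> m. ?h m * \<xi> m) (\<lambda>\<xi> m. cnj (?h m) * \<xi> m)"
          by (rule adjoint_pair_diagonal)
        moreover have "(\<lambda>\<xi> m. ?h m * \<xi> m) = ?V" by (simp add: v_op_def algebra_simps)
        ultimately have "adjoint_pair A ?V (\<lambda>\<xi> m. cnj (?h m) * \<xi> m)" by (simp only:)
        then have "hermitian A (Im_op A ?V)" by (rule hermitian_Im_op)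
        moreover have "?\<Gamma> l = (\<lambda>\<xi> m. (of_nat (modulus (k' ?j)) / (2 * \<i> * pi)) * Im_op A ?V \<xi> m)"
          using 3 k' by (simp add: Gamma_op_def Let_def A_def dir_def del: not_infinity_eq)
        moreover have "cnj (of_nat (modulus (k' ?j)) / (2 * \<i> * pi)) = - (of_nat (modulus (k' ?j)) / (2 * \<i> * pi))"
          by simp
        ultimately show ?thesis by blast
      qed
    qed
    then obtain H z where H: "hermitian A H" "cnj z = - z" "?\<Gamma> l = (\<lambda>\<xi> m. z * H \<xi> m)" by blast
    obtain C where "first_order A J x w (\<lambda>\<xi> m. z * H \<xi> m) C"
      "\<And>\<xi>. \<xi> \<in> fin_supp A \<Longrightarrow> ell2_norm A (\<lambda>m. z * H \<xi> m) \<le> C * ell2_norm A \<xi>"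
      by (rule first_order_bounded[OF H(1,2) w1]) (rule that)
    then show ?thesis unfolding H(3) by (intro exI[of _ C] conjI impI ballI)
  qed
  then obtain C where C: "\<And>l. l \<in> {1..d + d'} \<Longrightarrow> first_order A J x w (?\<Gamma> l) (C l)"
    and C'': "\<And>l. l \<in> {1..d + d'} \<Longrightarrow>
      l \<notin> L \<longrightarrow> (\<forall>\<xi>\<in>fin_supp A. ell2_norm A (?\<Gamma> l \<xi>) \<le> C l * ell2_norm A \<xi>)"
    by metis
  have C': "ell2_norm A (?\<Gamma> l \<xi>) \<le> C l * ell2_norm A \<xi>"
    if "l \<in> {1..d + d'} - L" "\<xi> \<in> fin_supp A" for l \<xi>
    using C''[of l] that by blast
  \<comment> \<open>The summands are grouped by direction. For \<open>j \<le> d\<close> the two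
    summands carry \<open>X\<close> and \<open>Y\<close>, and their squared norms add up to that of
    the derivative; for larger \<open>j\<close> the single summand is the derivation itself.\<close>
  have elliptic: "(\<Sum>j\<in>J. (ell2_norm A (deriv_op (x j) \<xi>))\<^sup>2) \<le> (\<Sum>l\<in>L. (ell2_norm A (?\<Gamma> l \<xi>))\<^sup>2)"
    if \<xi>: "\<xi> \<in> fin_supp A" for \<xi>
  proof -
    let ?N = "\<lambda>l. (ell2_norm A (?\<Gamma> l \<xi>))\<^sup>2"
    have L: "finite L" "dir ` L \<subseteq> J" by (auto simp: L_def)
    have "(ell2_norm A (deriv_op (x j) \<xi>))\<^sup>2 \<le> sum ?N {l \<in> L. dir l = j}" if j: "j \<in> J" for j
    proof -
      let ?D = "deriv_op (x j) \<xi>"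
      have D: "?D \<in> ell2 A" by (intro fin_supp_ell2 deriv_op_fin_supp \<xi>)
      have j1: "j \<in> {1..d'}" using j by (simp add: J_def)
      show ?thesis
      proof (cases "j \<le> d")
        case True
        have fj: "f j \<in> {1..d'}" by (rule f(1)[OF j1])
        have l: "j \<in> L" "d + j \<in> L" "dir j = j" "dir (d + j) = j" using True j1 j dd by (auto simp: L_def dir_def)
        have "(ell2_norm A ?D)\<^sup>2 = (ell2_norm A (Re_op A (U_op d' k' \<sigma>' (f j)) ?D))\<^sup>2
            + (ell2_norm A (Im_op A (U_op d' k' \<sigma>' (f j)) ?D))\<^sup>2"
          using ell2_norm_Re_Im_W[OF u[OF fj] D[unfolded A_def]] by (simp add: U_op_def A_def)
        also have "Re_op A (U_op d' k' \<sigma>' (f j)) ?D = ?\<Gamma> j \<xi>"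
          using True by (simp add: \<Gamma>_L[OF l(1)] l(3) P_def X_op_def A_def)
        also have "(ell2_norm A (Im_op A (U_op d' k' \<sigma>' (f j)) ?D))\<^sup>2 = ?N (d + j)"
          using True j1 scal.ell2_norm_sm[of A "\<epsilon> j" "Im_op A (U_op d' k' \<sigma>' (f j)) ?D"]
          by (simp add: \<Gamma>_L[OF l(2)] l(4) P_def Y_op_def A_def \<epsilon>_def split: if_splits)
        also have "?N j + ?N (d + j) = sum ?N {j, d + j}"
          using j1 True by (subst sum.insert) (auto simp: J_def)
        also have "\<dots> \<le> sum ?N {l \<in> L. dir l = j}"
          using L(1) l by (intro sum_mono2) auto
        finally show ?thesis .
      next
        case False
        have l: "d + j \<in> L" "dir (d + j) = j" using False j1 j dd by (auto simp: L_def dir_def)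
        have "(ell2_norm A ?D)\<^sup>2 = sum ?N {d + j}"
          using False by (simp add: \<Gamma>_L[OF l(1)] l(2) P_def)
        also have "\<dots> \<le> sum ?N {l \<in> L. dir l = j}"
          using L(1) l by (intro sum_mono2) auto
        finally show ?thesis .
      qed
    qed
    then have "(\<Sum>j\<in>J. (ell2_norm A (deriv_op (x j) \<xi>))\<^sup>2) \<le> (\<Sum>j\<in>J. sum ?N {l \<in> L. dir l = j})"
      by (rule sum_mono)
    also have "\<dots> = sum ?N L" by (rule sum.group[OF L(1) J L(2)])
    finally show ?thesis .
  qed
  interpret F: first_order_family A J x "{1..d + d'}" L ?\<Gamma> "\<lambda>l. c (cliff_gen l)" C w
  proof
    show "w = (\<lambda>m. 1 + (\<Sum>j\<in>J. (x j m)\<^sup>2))" by (rule w_def)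
    show "finite {m \<in> A. w m \<le> r}" for r
      unfolding A_def w_inf by (rule finite_Zk_sublevel[OF k2])
    show "L \<subseteq> {1..d + d'}" by (auto simp: L_def)
    show "finite J" "finite {1..d + d'}" by (simp_all add: J)
    fix l assume l: "l \<in> {1..d + d'}"
    note Cl = C[OF l, unfolded first_order_def]
    show "0 \<le> C l" "lin_on (sobolev A w) (?\<Gamma> l)" using Cl by blast+
    show "?\<Gamma> l \<xi> \<in> ell2 A" if "\<xi> \<in> sobolev A w" for \<xi> using Cl that by blast
    show "ell2_norm A (?\<Gamma> l \<xi>) \<le> C l * ell2_norm A (\<lambda>m. sqrt (w m) *\<^sub>R \<xi> m)"
      if "\<xi> \<in> sobolev A w" for \<xi> using Cl that by blast
    show "ell2_inner A (?\<Gamma> l \<xi>) \<eta> = - ell2_inner A \<xi> (?\<Gamma> l \<eta>)"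
      if "\<xi> \<in> fin_supp A" "\<eta> \<in> fin_supp A" for \<xi> \<eta> using Cl that by blast
    show "ell2_norm A (\<lambda>m. ?\<Gamma> l (\<lambda>m. cutoff J x n m *\<^sub>R \<xi> m) m - cutoff J x n m *\<^sub>R ?\<Gamma> l \<xi> m)
        \<le> C l * ell2_norm A \<xi>"
      if "\<xi> \<in> fin_supp A" for \<xi> n using Cl that by blast
    show "madj (c (cliff_gen l)) = - c (cliff_gen l)" by (rule clifford_matrix_skew[OF c l])
    show "c (cliff_gen l) ** c (cliff_gen l) = - mat 1" by (rule clifford_matrix_square[OF c l])
    fix l' assume "l' \<in> {1..d + d'}" "l \<noteq> l'"
    then show "c (cliff_gen l) ** c (cliff_gen l') = - (c (cliff_gen l') ** c (cliff_gen l))"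
      by (intro clifford_matrix_anticommute[OF c] l)
  next
    fix l and \<xi> :: "(nat \<Rightarrow> int) \<Rightarrow> complex" assume l: "l \<in> L" and \<xi>: "\<xi> \<in> fin_supp A"
    show "?\<Gamma> l \<xi> \<in> fin_supp A"
      unfolding \<Gamma>_L[OF l] by (intro order_zeroD(4)[OF P_zero[OF l]] deriv_op_fin_supp \<xi>)
    fix l' assume l': "l' \<in> L"
    show "(ell2_norm A (\<lambda>m. ?\<Gamma> l (?\<Gamma> l' \<xi>) m - ?\<Gamma> l' (?\<Gamma> l \<xi>) m))\<^sup>2
        \<le> 4 * (\<Sum>j\<in>J. (ell2_norm A (deriv_op (x j) \<xi>))\<^sup>2)"
      unfolding \<Gamma>_L[OF l] \<Gamma>_L[OF l']
      by (rule first_order_commutator[OF P_zero[OF l] P_zero[OF l'] P_comm[OF l l'] J _ _ \<xi>])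
        (use l l' in \<open>simp_all add: L_def\<close>)
  qed (fact C' elliptic)+
  have "F.vdom = (D_dom d' k' :: ((nat \<Rightarrow> int) \<Rightarrow> complex ^ 's) set)"
    unfolding F.vdom_def by (simp add: D_dom_def A_def w_inf)
  moreover have "F.dirac = D_op d d' f k k' \<sigma>' c" by (intro ext) (simp only: F.dirac_def D_op_def)
  ultimately show ?thesis using F.dirac_self_adjoint_compact_resolvent unfolding A_def by (simp only:)
qed

theorem lemma2p53:
  fixes d d' :: nat
    and f :: "nat \<Rightarrow> nat"
    and k k' :: "enat \<Rightarrow> nat \<Rightarrow> enat"
    and \<sigma> \<sigma>' :: "enat \<Rightarrow> (nat \<Rightarrow> int) \<Rightarrow> (nat \<Rightarrow> int) \<Rightarrow> complex"
    and c :: "clifford \<Rightarrow> complex ^ 's ^ 's"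
  assumes "2 \<le> d" and "d \<le> d'"
    and "f permutes {1..d'}"
    and "\<And>j. j \<in> {1..d'} \<Longrightarrow> f j \<noteq> j"
    and "\<And>j. j \<in> {1..d'} \<Longrightarrow> f (f j) = j"
    and "{d + 1..d'} \<subseteq> f ` {1..d}"
    and "\<And>n. (k n, \<sigma> n) \<in> Xi d"
    and "\<And>n. (k' n, \<sigma>' n) \<in> Xi d'"
    and "Xi_converges d k \<sigma>"
    and "\<And>j. j \<in> {1..d} \<Longrightarrow> k \<infinity> j = \<infinity>"
    and "Xi_converges d' k' \<sigma>'"
    and "\<And>j. j \<in> {1..d'} \<Longrightarrow> k' \<infinity> j = \<infinity>"
    and "\<And>j. j \<in> {1..d} \<Longrightarrow> (\<forall>n::nat. k (enat n) j < \<infinity>) \<or> (\<forall>n::nat. k (enat n) j = \<infinity>)"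
    and "\<And>n j. j \<in> {1..d} \<Longrightarrow> k' n (f j) = k' n j"
    and "\<And>n j. j \<in> {1..d} \<Longrightarrow> k' n j = k n j"
    and "\<And>n x y. x \<in> carrier (Zk d (k n)) \<Longrightarrow> y \<in> carrier (Zk d (k n)) \<Longrightarrow>
           \<sigma> n x y = \<sigma>' n (embed d d' x) (embed d d' y)"
    and "\<And>n j s \<xi>. j \<in> {1..d} \<Longrightarrow> s \<in> {1..d'} \<Longrightarrow> \<xi> \<in> ell2 (carrier (Zk d' (k' n))) \<Longrightarrow>
           U_op d' (k' n) (\<sigma>' n) (f j) (U_op d' (k' n) (\<sigma>' n) s \<xi>) =
           (\<lambda>m. lambda_scalar (k n) f j s *
                  U_op d' (k' n) (\<sigma>' n) s (U_op d' (k' n) (\<sigma>' n) (f j) \<xi>) m)"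
    and "faithful_clifford_rep (d + d') c"
  shows "\<forall>n. self_adjoint (carrier (Zk d' (k' n))) (D_dom d' (k' n))
               (D_op d d' f (k n) (k' n) (\<sigma>' n) c) \<and>
             compact_resolvent (carrier (Zk d' (k' n))) (D_dom d' (k' n))
               (D_op d d' f (k n) (k' n) (\<sigma>' n) c)"
proof
  fix n
  have Xi: "\<And>j. j \<in> {1..d'} \<Longrightarrow> 2 \<le> k' n j" "normalized_cocycle (Zk d' (k' n)) (\<sigma>' n)"
    using assms(8)[of n] by (auto simp: Xi_def)
  show "self_adjoint (carrier (Zk d' (k' n))) (D_dom d' (k' n)) (D_op d d' f (k n) (k' n) (\<sigma>' n) c) \<and>
      compact_resolvent (carrier (Zk d' (k' n))) (D_dom d' (k' n)) (D_op d d' f (k n) (k' n) (\<sigma>' n) c)"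
  proof (rule Dirac_self_adjoint_compact_resolvent[OF assms(2) _ assms(4) Xi(1) assms(15) _ _ assms(18)])
    show "f j \<in> {1..d'}" if "j \<in> {1..d'}" for j
      using permutes_in_image[OF assms(3)] that by blast
    show "norm (\<sigma>' n x y) = 1" if "x \<in> carrier (Zk d' (k' n))" "y \<in> carrier (Zk d' (k' n))" for x y
      using Xi(2) that by (simp add: normalized_cocycle_def)
    \<comment> \<open>For infinite \<open>k n j\<close> both case distinctions in
      \<open>lambda_scalar\<close> fail, and the scalar is 1.\<close>
    show "commute_on (carrier (Zk d' (k' n))) (U_op d' (k' n) (\<sigma>' n) (f j)) (U_op d' (k' n) (\<sigma>' n) s)"
      if "j \<in> {1..d}" "k n j = \<infinity>" "s \<in> {1..d'}" for j s
      unfolding commute_on_def using assms(17)[OF that(1,3)] that(2) by (simp add: lambda_scalar_def)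
  qed
qed

end
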